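(* Let $\mathcal{K}\subseteq\mathbb{R}^d$, $x^\star\in\mathcal{K}$ and $A\in\mathbb{R}^{n\times d}$, and let $\mathcal{C}$, $L$, $\mu_c$, $\mathcal{W}$, $b_m$ and $\alpha(\eta,SA)$ be as defined in the context. Let $\theta>0$. If the step size is $\eta=\frac{1}{L(b_m+\sqrt d+\theta)^2}$ and the entries of the sketching matrix $S\in\mathbb{R}^{m\times n}$ are drawn i.i.d. from the standard normal distribution, then, with probability at least $1-2e^{-\theta^2/2}$, $$\alpha(\eta,SA)\le 1-\frac{\mu_c}{L}\,\frac{(b_m-\mathcal{W}-\theta)^2}{(b_m+\sqrt d+\theta)^2}.$$
   Context: $\mathcal{C}\subseteq\mathbb{R}^d$ is the smallest closed cone containing $\mathcal{K}-x^\star=\{x-x^\star:x\in\mathcal{K}\}$; $A\mathcal{C}=\{Ac:c\in\mathcal{C}\}$; $\mathcal{B}^d$ is the Euclidean unit ball of $\mathbb{R}^d$ and $\mathbb{S}^{n-1}$ is the Euclidean unit sphere of $\mathbb{R}^n$. The contraction factor is $$\alpha(\eta,SA)=\sup_{u,v\in\mathcal{C}\cap\mathcal{B}^d}v^T(I-\eta A^TS^TSA)u.$$ The constant $L$ is the largest singular value of $A^TA$, so that $\|Az_d\|_2^2\le L\|z_d\|_2^2$ for all $z_d\in\mathbb{R}^d$. The cone-restricted strong convexity constant $\mu_c$ is the largest positive constant such that $\|Az_c\|_2^2\ge\mu_c\|z_c\|_2^2$ for all $z_c\in\mathcal{C}$. The Gaussian width of a set $\Omega\subseteq\mathbb{R}^n$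 is $\mathcal{W}(\Omega)=\mathbb{E}_g\big(\sup_{v\in\Omega}v^Tg\big)$ with $g\sim\mathcal{N}(0,I_n)$, and $\mathcal{W}:=\mathcal{W}(A\mathcal{C}\cap\mathbb{S}^{n-1})$. Finally $b_m=\sqrt{2}\,\Gamma\big(\tfrac{m+1}{2}\big)/\Gamma\big(\tfrac m2\big)$.
   Formalization: The condition b_m − W − θ ≥ 0 is added; without it the claim fails, e.g. for d = n = 2, m = 1, K = R², x* = 0, A = I, θ = 2, where S has a kernel vector, so α ≥ 1 always while the claimed bound is below 1. *)

theory Defs
  imports "HOL-Probability.Probability"
begin

definition closed_cone_hull :: "'a::real_normed_vector set \<Rightarrow> 'a set" where
  "closed_cone_hull X = (\<lambda>T. closed T \<and> cone T) hull X"

definition tangent_cone :: "'a::real_normed_vector set \<Rightarrow> 'a \<Rightarrow> 'a set" where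
  "tangent_cone K xs = closed_cone_hull {x - xs |x. x \<in> K}"

definition contraction_factor ::
  "(real ^ 'd) set \<Rightarrow> real \<Rightarrow> real ^ 'd ^ 'm \<Rightarrow> real" where
  "contraction_factor C \<eta> M =
     (SUP (u, v) \<in> (C \<inter> cball 0 1) \<times> (C \<inter> cball 0 1).
        v \<bullet> ((mat 1 - \<eta> *\<^sub>R (transpose M ** M)) *v u))"

definition is_singular_value :: "real ^ 'n ^ 'n \<Rightarrow> real \<Rightarrow> bool" where
  "is_singular_value M \<sigma> \<longleftrightarrow>
     \<sigma> \<ge> 0 \<and> (\<exists>v. v \<noteq> 0 \<and> (transpose M ** M) *v v = \<sigma>\<^sup>2 *\<^sub>R v)"

definition largest_singular_value :: "real ^ 'n ^ 'n \<Rightarrow> real" where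
  "largest_singular_value M = Max {\<sigma>. is_singular_value M \<sigma>}"

(* A relation rather than a function: a largest positive constant need not exist
   (none is positive if A annihilates a nonzero element of C, none is largest if C = {0}). *)
definition is_restricted_convexity_const ::
  "real ^ 'd ^ 'n \<Rightarrow> (real ^ 'd) set \<Rightarrow> real \<Rightarrow> bool" where
  "is_restricted_convexity_const A C \<mu> \<longleftrightarrow>
     \<mu> > 0 \<and> (\<forall>z\<in>C. (norm (A *v z))\<^sup>2 \<ge> \<mu> * (norm z)\<^sup>2) \<and>
     (\<forall>\<mu>'>0. (\<forall>z\<in>C. (norm (A *v z))\<^sup>2 \<ge> \<mu>' * (norm z)\<^sup>2) \<longrightarrow> \<mu>' \<le> \<mu>)"

definition std_gaussian :: "(real ^ 'n) measure" where
  "std_gaussian = density lborel (\<lambda>x. ennreal (\<Prod>i\<in>UNIV. std_normal_density (x $ i)))"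

(* Meaningful for nonempty bounded sets only: the supremum over the empty set is
   an unspecified real. *)
definition gaussian_width :: "(real ^ 'n) set \<Rightarrow> real" where
  "gaussian_width \<Omega> = (\<integral>g. (SUP v\<in>\<Omega>. v \<bullet> g) \<partial>std_gaussian)"

definition gauss_b :: "nat \<Rightarrow> real" where
  "gauss_b m = sqrt 2 * Gamma ((real m + 1) / 2) / Gamma (real m / 2)"

definition iid_std_normal_matrix ::
  "'w measure \<Rightarrow> ('w \<Rightarrow> real ^ 'n ^ 'm) \<Rightarrow> bool" where
  "iid_std_normal_matrix P S \<longleftrightarrow>
     prob_space.indep_vars P (\<lambda>_. borel) (\<lambda>(i, j) \<omega>. S \<omega> $ i $ j) UNIV \<and>
     (\<forall>i j. distributed P lborel (\<lambda>\<omega>. S \<omega> $ i $ j) std_normal_density)"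

lemma transpose_mult_inner:
  fixes M :: "real ^ 'n ^ 'n"
  shows "((transpose M ** M) *v v) \<bullet> w = (M *v v) \<bullet> (M *v w)"
  by (simp add: dot_lmul_matrix flip: matrix_vector_mul_assoc)

lemma finite_singular_values:
  fixes M :: "real ^ 'n ^ 'n"
  shows "finite {\<sigma>. is_singular_value M \<sigma>}"
proof -
  let ?S = "{\<sigma>. is_singular_value M \<sigma>}"
  have "\<forall>\<sigma>\<in>?S. \<exists>v. v \<noteq> 0 \<and> (transpose M ** M) *v v = \<sigma>\<^sup>2 *\<^sub>R v"
    by (simp add: is_singular_value_def)
  from bchoice[OF this] obtain f where f:
    "f \<sigma> \<noteq> 0 \<and> (transpose M ** M) *v f \<sigma> = \<sigma>\<^sup>2 *\<^sub>R f \<sigma>"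
    if "\<sigma> \<in> ?S" for \<sigma> by blast
  have orth: "f s \<bullet> f t = 0" if "s \<in> ?S" "t \<in> ?S" "s \<noteq> t" for s t
  proof -
    have "s\<^sup>2 * (f s \<bullet> f t) = ((transpose M ** M) *v f s) \<bullet> f t"
      using f[OF that(1)] by simp
    also have "\<dots> = ((transpose M ** M) *v f t) \<bullet> f s"
      by (metis transpose_mult_inner inner_commute)
    also have "\<dots> = t\<^sup>2 * (f s \<bullet> f t)"
      using f[OF that(2)] by (simp add: inner_commute)
    finally have "s\<^sup>2 = t\<^sup>2 \<or> f s \<bullet> f t = 0" by auto
    moreover have "s \<ge> 0" "t \<ge> 0"
      using that by (auto simp: is_singular_value_def)
    ultimately show ?thesis using that(3) by (simp add: power2_eq_iff_nonneg)
  qed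
  have "inj_on f ?S"
    using orth f by (intro inj_onI) (metis inner_eq_zero_iff)
  moreover have "pairwise orthogonal (f ` ?S)"
    using orth by (auto simp: pairwise_def orthogonal_def)
  then have "finite (f ` ?S)" by (rule pairwise_orthogonal_imp_finite)
  ultimately show ?thesis by (rule finite_imageD[rotated])
qed

end

theory Submission
  imports Defs
begin

text \<open>
Write \<open>T\<close> for the set of unit vectors in the image \<open>A C\<close> of the cone, so that \<open>W\<close> is its Gaussian
width. Two events carry the theorem: that \<open>norm (S y) \<ge> b - W - \<theta>\<close> for all \<open>y\<close> in \<open>T\<close>
(\<open>min_deviation\<close>), and that \<open>norm (S y) \<le> b + sqrt d + \<theta>\<close> for all unit vectors \<open>y\<close> in the range of \<open>A\<close>
(\<open>max_deviation\<close> and \<open>width_subspace\<close>). Each fails with probability at most \<open>exp (- \<theta>\<^sup>2 / 2)\<close>.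

On both events the bound is linear algebra (\<open>contraction_factor_deterministic\<close>). Since \<open>L\<close> bounds
\<open>(norm (A z))\<^sup>2\<close> by \<open>L (norm z)\<^sup>2\<close>, the step size makes \<open>Q = I - \<eta> (S A)^T (S A)\<close> positive semidefinite.
Hence \<open>v \<bullet> Q u\<close> is at most the mean of \<open>u \<bullet> Q u\<close> and \<open>v \<bullet> Q v\<close>, and on the cone
\<open>u \<bullet> Q u = (norm u)\<^sup>2 - \<eta> (norm (S A u))\<^sup>2\<close> is bounded through the first event and the restricted convexity.

Both probability bounds are instances of \<open>gordon_deviation\<close>, a form of Gordon's comparison theorem that
contains Gaussian concentration with the optimal constant. It compares the Gaussian field
\<open>X = u \<bullet> S y\<close> with \<open>Y = u \<bullet> g - y \<bullet> h\<close>, where \<open>g\<close> and \<open>h\<close> are independent standard Gaussian vectors: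
for unit vectors \<open>Cov X + 1 - Cov Y = (1 - u \<bullet> u') (1 - y \<bullet> y')\<close>, which is nonnegative and vanishes for
\<open>y = y'\<close>. The supremum of \<open>u \<bullet> g\<close> over the unit sphere is the norm of \<open>g\<close> with mean \<open>b\<close>
(\<open>norm_std_gaussian\<close>), and that of \<open>y \<bullet> h\<close> over \<open>T\<close> has mean \<open>W\<close>.

The proof of \<open>gordon_deviation\<close> is a single interpolation. The min-max is replaced by a smooth
function \<open>F\<close>, called \<open>soft_val\<close> below, and one considers
  \<open>\<Psi> t = E_X (exp (- \<tau> * E_Y (F (sqrt t * X + sqrt (1 - t) * Y))))\<close>,
which runs from \<open>exp (- \<tau> * E (F Y))\<close> at \<open>t = 0\<close> to \<open>E (exp (- \<tau> * F X))\<close> at \<open>t = 1\<close>. In a time step of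
length \<open>h\<close> a small amount of \<open>Y\<close> inside the exponential becomes a small amount of \<open>X\<close> outside. Changing
\<open>Y\<close> to \<open>X\<close> inside does not lower the inner mean, up to terms of order \<open>h\<close> to the power \<open>3/2\<close>, because the
second derivatives of \<open>F\<close> have the signs that match Gordon's conditions (\<open>mean_d2_le\<close>). Moving the
average outside costs a factor \<open>exp (\<tau>\<^sup>2 h / 2)\<close> up to terms of the same order, because the gradient of
\<open>F\<close> is a probability distribution and each entry of \<open>X\<close> has variance at most one (\<open>exp_step\<close>). The
ingredients are Taylor expansions and the stability of the normal law. Summing over \<open>1 / h\<close> steps and
letting \<open>h\<close> tend to zero gives \<open>E (exp (- \<tau> * F X)) \<le> exp (- \<tau> * E (F Y) + \<tau>\<^sup>2 / 2)\<close>, and Markov's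
inequality at \<open>\<tau> = \<theta>\<close> gives the tail bound.
\<close>

section \<open>The soft min-max of an array\<close>

text \<open>The minimum over \<open>I\<close> of the maximum over \<open>J\<close> of an array \<open>x\<close> is replaced by
  \<open>soft_val x\<close>, in which both extremes are taken through exponentials at inverse temperature \<open>\<beta>\<close>.
  The two differ by at most a logarithm of the number of indices over \<open>\<beta>\<close>, and \<open>soft_val\<close> has
  derivatives that are bounded uniformly in \<open>x\<close>, whereas the minimum of maxima has kinks.\<close>
locale soft_minmax =
  fixes I :: "'i set" and J :: "'j set" and \<beta> :: real
  assumes finI: "finite I" and finJ: "finite J" and neI: "I \<noteq> {}" and neJ: "J \<noteq> {}"
    and beta: "\<beta> > 0"
begin

definition Zin :: "('i \<Rightarrow> 'j \<Rightarrow> real) \<Rightarrow> 'i \<Rightarrow> real" where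
  "Zin x i = (\<Sum>j\<in>J. exp (\<beta> * x i j))"

definition Zout :: "('i \<Rightarrow> 'j \<Rightarrow> real) \<Rightarrow> real" where
  "Zout x = (\<Sum>i\<in>I. 1 / Zin x i)"

definition soft_val :: "('i \<Rightarrow> 'j \<Rightarrow> real) \<Rightarrow> real" where
  "soft_val x = - ln (Zout x) / \<beta>"

text \<open>The Gibbs weights of the inner maximum and of the outer minimum. The partial derivative of
  \<open>soft_val\<close> in the entry \<open>(i, j)\<close> is \<open>p x i * q x i j\<close>, so that its gradient is a probability
  distribution on \<open>I \<times> J\<close>.\<close>
definition q :: "('i \<Rightarrow> 'j \<Rightarrow> real) \<Rightarrow> 'i \<Rightarrow> 'j \<Rightarrow> real" where
  "q x i j = exp (\<beta> * x i j) / Zin x i"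

definition p :: "('i \<Rightarrow> 'j \<Rightarrow> real) \<Rightarrow> 'i \<Rightarrow> real" where
  "p x i = 1 / Zin x i / Zout x"

lemma Zin_pos: "Zin x i > 0"
  unfolding Zin_def using finJ neJ by (intro sum_pos) auto

lemma Zout_pos: "Zout x > 0"
  unfolding Zout_def using finI neI Zin_pos by (intro sum_pos) auto

lemma q_nonneg: "q x i j \<ge> 0" and p_nonneg: "p x i \<ge> 0"
  using Zin_pos[of x i] Zout_pos[of x] by (auto simp: q_def p_def)

lemma q_sum: "(\<Sum>j\<in>J. q x i j) = 1"
  using Zin_pos[of x i] by (simp add: q_def Zin_def flip: sum_divide_distrib)

lemma p_sum: "(\<Sum>i\<in>I. p x i) = 1"
  using Zout_pos[of x] unfolding p_def sum_divide_distrib[symmetric] by (simp flip: Zout_def)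

definition ray :: "('i \<Rightarrow> 'j \<Rightarrow> real) \<Rightarrow> ('i \<Rightarrow> 'j \<Rightarrow> real) \<Rightarrow> real \<Rightarrow> 'i \<Rightarrow> 'j \<Rightarrow> real" where
  "ray x v s = (\<lambda>i j. x i j + s * v i j)"

definition inner_mean :: "('i \<Rightarrow> 'j \<Rightarrow> real) \<Rightarrow> ('i \<Rightarrow> 'j \<Rightarrow> real) \<Rightarrow> 'i \<Rightarrow> real" where
  "inner_mean x w i = (\<Sum>j\<in>J. q x i j * w i j)"

definition outer_mean :: "('i \<Rightarrow> 'j \<Rightarrow> real) \<Rightarrow> ('i \<Rightarrow> real) \<Rightarrow> real" where
  "outer_mean x w = (\<Sum>i\<in>I. p x i * w i)"

text \<open>Along a ray with direction \<open>v\<close> every derivative of \<open>soft_val\<close> is a polynomial in the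
  outer means of these moments of \<open>v\<close> under the inner weights.\<close>
abbreviation mom :: "nat \<Rightarrow> ('i \<Rightarrow> 'j \<Rightarrow> real) \<Rightarrow> ('i \<Rightarrow> 'j \<Rightarrow> real) \<Rightarrow> 'i \<Rightarrow> real" where
  "mom k v x \<equiv> inner_mean x (\<lambda>i j. v i j ^ k)"

lemma Zin_deriv:
  "((\<lambda>s. Zin (ray x v s) i) has_real_derivative \<beta> * Zin (ray x v s) i * mom 1 v (ray x v s) i) (at s)"
proof -
  have "((\<lambda>s. Zin (ray x v s) i) has_real_derivative (\<Sum>j\<in>J. exp (\<beta> * ray x v s i j) * (\<beta> * v i j))) (at s)"
    unfolding Zin_def ray_def by (auto intro!: derivative_eq_intros simp: mult_ac)
  also have "(\<Sum>j\<in>J. exp (\<beta> * ray x v s i j) * (\<beta> * v i j)) = \<beta> * Zin (ray x v s) i * mom 1 v (ray x v s) i"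
    using Zin_pos[of "ray x v s" i]
    by (simp add: inner_mean_def q_def sum_distrib_left sum_distrib_right mult_ac)
  finally show ?thesis .
qed

lemma Zout_deriv:
  "((\<lambda>s. Zout (ray x v s)) has_real_derivative
     - \<beta> * Zout (ray x v s) * outer_mean (ray x v s) (mom 1 v (ray x v s))) (at s)"
proof -
  let ?Z = "Zin (ray x v s)" let ?m = "mom 1 v (ray x v s)"
  have "((\<lambda>s. Zout (ray x v s)) has_real_derivative
     (\<Sum>i\<in>I. - (\<beta> * ?Z i * ?m i) / (?Z i)\<^sup>2)) (at s)"
    unfolding Zout_def using Zin_pos[of "ray x v s"]
    by (auto intro!: derivative_eq_intros Zin_deriv simp: power2_eq_square less_imp_neq[symmetric])
  also have "(\<Sum>i\<in>I. - (\<beta> * ?Z i * ?m i) / (?Z i)\<^sup>2)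
      = - \<beta> * Zout (ray x v s) * outer_mean (ray x v s) (mom 1 v (ray x v s))"
    using Zin_pos[of "ray x v s"] Zout_pos[of "ray x v s"]
    by (simp add: outer_mean_def p_def sum_distrib_left power2_eq_square
        less_imp_neq[symmetric] sum_negf mult_ac)
  finally show ?thesis .
qed

lemma q_deriv:
  "((\<lambda>s. q (ray x v s) i j) has_real_derivative
     \<beta> * q (ray x v s) i j * (v i j - mom 1 v (ray x v s) i)) (at s)"
proof -
  let ?Z = "Zin (ray x v s) i" let ?m = "mom 1 v (ray x v s) i"
  have e: "((\<lambda>s. exp (\<beta> * ray x v s i j)) has_real_derivative exp (\<beta> * ray x v s i j) * (\<beta> * v i j)) (at s)"
    unfolding ray_def by (auto intro!: derivative_eq_intros)
  have "((\<lambda>s. q (ray x v s) i j) has_real_derivative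
     (exp (\<beta> * ray x v s i j) * (\<beta> * v i j) * ?Z - exp (\<beta> * ray x v s i j) * (\<beta> * ?Z * ?m)) / (?Z * ?Z)) (at s)"
    unfolding q_def using Zin_pos[of "ray x v s" i]
    by (intro DERIV_divide e Zin_deriv) simp
  also have "(exp (\<beta> * ray x v s i j) * (\<beta> * v i j) * ?Z - exp (\<beta> * ray x v s i j) * (\<beta> * ?Z * ?m)) / (?Z * ?Z)
     = \<beta> * q (ray x v s) i j * (v i j - ?m)"
    using Zin_pos[of "ray x v s" i] by (simp add: q_def field_simps)
  finally show ?thesis .
qed

lemma mom_deriv:
  "((\<lambda>s. mom k v (ray x v s) i) has_real_derivative
     \<beta> * (mom (Suc k) v (ray x v s) i - mom k v (ray x v s) i * mom 1 v (ray x v s) i)) (at s)"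
proof -
  have "((\<lambda>s. mom k v (ray x v s) i) has_real_derivative
     (\<Sum>j\<in>J. \<beta> * q (ray x v s) i j * (v i j - mom 1 v (ray x v s) i) * v i j ^ k)) (at s)"
    unfolding inner_mean_def[of _ "\<lambda>i j. v i j ^ k"] by (intro DERIV_sum DERIV_cmult_right q_deriv)
  also have "(\<Sum>j\<in>J. \<beta> * q (ray x v s) i j * (v i j - mom 1 v (ray x v s) i) * v i j ^ k)
    = \<beta> * (mom (Suc k) v (ray x v s) i - mom k v (ray x v s) i * mom 1 v (ray x v s) i)"
  proof -
    have "(\<Sum>j\<in>J. \<beta> * q (ray x v s) i j * (v i j - m) * v i j ^ k)
      = \<beta> * (mom (Suc k) v (ray x v s) i - mom k v (ray x v s) i * m)" for m
      by (simp add: inner_mean_def right_diff_distrib left_diff_distrib sum_subtractf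
          sum_distrib_left sum_distrib_right mult_ac)
    then show ?thesis .
  qed
  finally show ?thesis .
qed

lemma p_deriv:
  "((\<lambda>s. p (ray x v s) i) has_real_derivative
     \<beta> * p (ray x v s) i * (outer_mean (ray x v s) (mom 1 v (ray x v s)) - mom 1 v (ray x v s) i)) (at s)"
proof -
  let ?Z = "Zin (ray x v s) i" let ?W = "Zout (ray x v s)" let ?m = "mom 1 v (ray x v s) i"
  let ?e = "outer_mean (ray x v s) (mom 1 v (ray x v s))"
  have 1: "((\<lambda>s. Zin (ray x v s) i * Zout (ray x v s)) has_real_derivative
     (\<beta> * ?Z * ?m) * ?W + (- \<beta> * ?W * ?e) * ?Z) (at s)"
    by (intro DERIV_mult Zin_deriv Zout_deriv)
  have "((\<lambda>s. inverse (Zin (ray x v s) i * Zout (ray x v s))) has_real_derivative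
     - (inverse (?Z * ?W) * ((\<beta> * ?Z * ?m) * ?W + (- \<beta> * ?W * ?e) * ?Z) * inverse (?Z * ?W))) (at s)"
    using Zin_pos[of "ray x v s" i] Zout_pos[of "ray x v s"] by (intro DERIV_inverse' 1) simp
  moreover have "(\<lambda>s. inverse (Zin (ray x v s) i * Zout (ray x v s))) = (\<lambda>s. p (ray x v s) i)"
    by (simp add: p_def field_simps)
  moreover have "- (inverse (?Z * ?W) * ((\<beta> * ?Z * ?m) * ?W + (- \<beta> * ?W * ?e) * ?Z) * inverse (?Z * ?W))
    = \<beta> * p (ray x v s) i * (?e - ?m)"
    using Zin_pos[of "ray x v s" i] Zout_pos[of "ray x v s"]
    by (simp add: p_def field_simps)
  ultimately show ?thesis by simp
qed

text \<open>The outer weights favour small inner values. Up to the factor \<open>\<beta>\<close>, their logarithmic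
  derivative is the mean of the first moment minus the first moment itself, which accounts for the
  two extra terms.\<close>
lemma outer_mean_deriv:
  assumes "\<And>i. ((\<lambda>s. w s i) has_real_derivative w' i) (at s)"
  shows "((\<lambda>s. outer_mean (ray x v s) (w s)) has_real_derivative
     outer_mean (ray x v s) (\<lambda>i. w' i - \<beta> * (mom 1 v (ray x v s) i * w s i))
     + \<beta> * (outer_mean (ray x v s) (mom 1 v (ray x v s)) * outer_mean (ray x v s) (w s))) (at s)"
proof -
  let ?p = "p (ray x v s)" let ?m = "mom 1 v (ray x v s)" 
  have "((\<lambda>s. outer_mean (ray x v s) (w s)) has_real_derivative
     (\<Sum>i\<in>I. \<beta> * ?p i * (outer_mean (ray x v s) ?m - ?m i) * w s i + w' i * ?p i)) (at s)"
    unfolding outer_mean_def[of _ "w _"] by (intro DERIV_sum DERIV_mult p_deriv assms)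
  also have "(\<Sum>i\<in>I. \<beta> * ?p i * (outer_mean (ray x v s) ?m - ?m i) * w s i + w' i * ?p i)
    = outer_mean (ray x v s) (\<lambda>i. w' i - \<beta> * (?m i * w s i))
     + \<beta> * (outer_mean (ray x v s) ?m * outer_mean (ray x v s) (w s))"
  proof -
    have "(\<Sum>i\<in>I. \<beta> * ?p i * (e - ?m i) * w s i + w' i * ?p i)
      = outer_mean (ray x v s) (\<lambda>i. w' i - \<beta> * (?m i * w s i)) + \<beta> * (e * outer_mean (ray x v s) (w s))" for e
      by (simp add: outer_mean_def sum_subtractf sum.distrib sum_distrib_left algebra_simps)
    then show ?thesis .
  qed
  finally show ?thesis .
qed

text \<open>The first three derivatives of \<open>soft_val\<close> at \<open>x\<close> in the direction \<open>v\<close>.\<close>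
definition d1 :: "('i \<Rightarrow> 'j \<Rightarrow> real) \<Rightarrow> ('i \<Rightarrow> 'j \<Rightarrow> real) \<Rightarrow> real" where
  "d1 v x = outer_mean x (mom 1 v x)"

definition d2 :: "('i \<Rightarrow> 'j \<Rightarrow> real) \<Rightarrow> ('i \<Rightarrow> 'j \<Rightarrow> real) \<Rightarrow> real" where
  "d2 v x = \<beta> * (outer_mean x (\<lambda>i. mom 2 v x i - 2 * (mom 1 v x i)\<^sup>2) + (d1 v x)\<^sup>2)"

definition d3 :: "('i \<Rightarrow> 'j \<Rightarrow> real) \<Rightarrow> ('i \<Rightarrow> 'j \<Rightarrow> real) \<Rightarrow> real" where
  "d3 v x = \<beta>\<^sup>2 * (outer_mean x (\<lambda>i. mom 3 v x i - 6 * mom 2 v x i * mom 1 v x i + 6 * mom 1 v x i ^ 3)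
     + d1 v x * outer_mean x (\<lambda>i. mom 2 v x i - 2 * (mom 1 v x i)\<^sup>2))
     + 2 * \<beta> * d1 v x * d2 v x"

lemma soft_val_deriv: "((\<lambda>s. soft_val (ray x v s)) has_real_derivative d1 v (ray x v s)) (at s)"
proof -
  have "((\<lambda>s. soft_val (ray x v s)) has_real_derivative
     - ((- \<beta> * Zout (ray x v s) * d1 v (ray x v s)) * inverse (Zout (ray x v s))) / \<beta>) (at s)"
    unfolding soft_val_def d1_def using Zout_pos[of "ray x v s"]
    by (intro DERIV_cdivide DERIV_minus DERIV_chain2[OF DERIV_ln Zout_deriv, THEN DERIV_cong]) simp_all
  moreover have "- ((- \<beta> * Zout (ray x v s) * d1 v (ray x v s)) * inverse (Zout (ray x v s))) / \<beta> = d1 v (ray x v s)"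
    using Zout_pos[of "ray x v s"] beta by (simp add: field_simps)
  ultimately show ?thesis by simp
qed

lemma d1_deriv: "((\<lambda>s. d1 v (ray x v s)) has_real_derivative d2 v (ray x v s)) (at s)"
  unfolding d1_def d2_def
  by (rule DERIV_cong[OF outer_mean_deriv[OF mom_deriv]])
    (simp add: power2_eq_square numeral_2_eq_2 outer_mean_def sum_distrib_left algebra_simps)

lemma d2_deriv: "((\<lambda>s. d2 v (ray x v s)) has_real_derivative d3 v (ray x v s)) (at s)"
proof -
  let ?y = "ray x v s"
  have 1: "((\<lambda>s. mom 2 v (ray x v s) i - 2 * (mom 1 v (ray x v s) i)\<^sup>2) has_real_derivative
    \<beta> * (mom 3 v ?y i - mom 2 v ?y i * mom 1 v ?y i)
     - 2 * (2 * (\<beta> * (mom 2 v ?y i - mom 1 v ?y i * mom 1 v ?y i)) * mom 1 v ?y i)) (at s)" for i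
    using mom_deriv[of x v 1 i s] mom_deriv[of x v 2 i s]
    by (auto intro!: derivative_eq_intros simp: numeral_2_eq_2 numeral_3_eq_3)
  have 2: "outer_mean ?y (\<lambda>i. (\<beta> * (mom 3 v ?y i - mom 2 v ?y i * mom 1 v ?y i)
     - 2 * (2 * (\<beta> * (mom 2 v ?y i - mom 1 v ?y i * mom 1 v ?y i)) * mom 1 v ?y i))
     - \<beta> * (mom 1 v ?y i * (mom 2 v ?y i - 2 * (mom 1 v ?y i)\<^sup>2)))
    = \<beta> * outer_mean ?y (\<lambda>i. mom 3 v ?y i - 6 * mom 2 v ?y i * mom 1 v ?y i + 6 * mom 1 v ?y i ^ 3)"
    unfolding outer_mean_def sum_distrib_left
    by (intro sum.cong refl) (simp add: algebra_simps power2_eq_square power3_eq_cube)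
  have "((\<lambda>s. d2 v (ray x v s)) has_real_derivative
     \<beta> * (\<beta> * outer_mean ?y (\<lambda>i. mom 3 v ?y i - 6 * mom 2 v ?y i * mom 1 v ?y i + 6 * mom 1 v ?y i ^ 3)
       + \<beta> * (d1 v ?y * outer_mean ?y (\<lambda>i. mom 2 v ?y i - 2 * (mom 1 v ?y i)\<^sup>2))
       + 2 * (d2 v ?y * d1 v ?y))) (at s)"
    unfolding d2_def[of v "ray x v _"]
    by (rule DERIV_cong[OF DERIV_cmult[OF DERIV_add[OF outer_mean_deriv[OF 1] DERIV_power[OF d1_deriv, where n=2]]]])
      (simp only: 2 d1_def[symmetric] d2_def, simp)
  also have "\<beta> * (\<beta> * outer_mean ?y (\<lambda>i. mom 3 v ?y i - 6 * mom 2 v ?y i * mom 1 v ?y i + 6 * mom 1 v ?y i ^ 3)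
       + \<beta> * (d1 v ?y * outer_mean ?y (\<lambda>i. mom 2 v ?y i - 2 * (mom 1 v ?y i)\<^sup>2))
       + 2 * (d2 v ?y * d1 v ?y)) = d3 v ?y"
    unfolding d3_def by (simp add: power2_eq_square algebra_simps)
  finally show ?thesis .
qed

lemma inner_mean_bound: "\<bar>inner_mean x w i\<bar> \<le> M" if "\<And>j. j \<in> J \<Longrightarrow> \<bar>w i j\<bar> \<le> M"
proof -
  have "\<bar>inner_mean x w i\<bar> \<le> (\<Sum>j\<in>J. \<bar>q x i j * w i j\<bar>)"
    unfolding inner_mean_def by (rule sum_abs)
  also have "\<dots> \<le> (\<Sum>j\<in>J. q x i j * M)"
    using that q_nonneg by (intro sum_mono) (auto simp: abs_mult intro!: mult_left_mono)
  finally show ?thesis by (simp add: q_sum flip: sum_distrib_right)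
qed

lemma outer_mean_bound: "\<bar>outer_mean x w\<bar> \<le> M" if "\<And>i. i \<in> I \<Longrightarrow> \<bar>w i\<bar> \<le> M"
proof -
  have "\<bar>outer_mean x w\<bar> \<le> (\<Sum>i\<in>I. \<bar>p x i * w i\<bar>)"
    unfolding outer_mean_def by (rule sum_abs)
  also have "\<dots> \<le> (\<Sum>i\<in>I. p x i * M)"
    using that p_nonneg by (intro sum_mono) (auto simp: abs_mult intro!: mult_left_mono)
  finally show ?thesis by (simp add: p_sum flip: sum_distrib_right)
qed

context
  fixes v :: "'i \<Rightarrow> 'j \<Rightarrow> real" and M :: real
  assumes M: "\<And>i j. i \<in> I \<Longrightarrow> j \<in> J \<Longrightarrow> \<bar>v i j\<bar> \<le> M"
begin

lemma M_nonneg: "M \<ge> 0"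
  using M neI neJ by (metis abs_ge_zero all_not_in_conv order_trans)

lemma mom_bound: "i \<in> I \<Longrightarrow> \<bar>mom k v x i\<bar> \<le> M ^ k"
  using M by (intro inner_mean_bound) (auto simp: power_abs intro!: power_mono)

lemma d1_bound: "\<bar>d1 v x\<bar> \<le> M"
  unfolding d1_def using mom_bound[where k=1 and x=x] by (intro outer_mean_bound) auto

lemma var_bound: "\<bar>outer_mean x (\<lambda>i. mom 2 v x i - 2 * (mom 1 v x i)\<^sup>2)\<bar> \<le> 3 * M\<^sup>2"
proof (rule outer_mean_bound)
  fix i assume "i \<in> I"
  then have "\<bar>mom 2 v x i\<bar> \<le> M\<^sup>2" "\<bar>mom 1 v x i\<bar> \<le> M"
    using mom_bound[where i=i and k=2 and x=x] mom_bound[where i=i and k=1 and x=x] by auto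
  moreover from this(2) have "(mom 1 v x i)\<^sup>2 \<le> M\<^sup>2" by (metis abs_le_square_iff abs_of_nonneg M_nonneg)
  ultimately show "\<bar>mom 2 v x i - 2 * (mom 1 v x i)\<^sup>2\<bar> \<le> 3 * M\<^sup>2"
    using zero_le_power2[of "mom 1 v x i"] by linarith
qed

lemma d2_bound: "\<bar>d2 v x\<bar> \<le> 4 * \<beta> * M\<^sup>2"
proof -
  have "(d1 v x)\<^sup>2 \<le> M\<^sup>2" using d1_bound by (metis abs_le_square_iff abs_of_nonneg M_nonneg)
  then have "\<bar>outer_mean x (\<lambda>i. mom 2 v x i - 2 * (mom 1 v x i)\<^sup>2) + (d1 v x)\<^sup>2\<bar> \<le> 4 * M\<^sup>2"
    using var_bound[of x] zero_le_power2[of "d1 v x"] by linarith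
  then show ?thesis unfolding d2_def using beta by (simp add: abs_mult)
qed

lemma d3_bound: "\<bar>d3 v x\<bar> \<le> 24 * \<beta>\<^sup>2 * M ^ 3"
proof -
  \<comment> \<open>\<open>1 + 6 + 6 = 13\<close>; the other two summands of \<open>d3\<close> contribute \<open>3\<close> and \<open>8\<close>.\<close>
  have 1: "\<bar>outer_mean x (\<lambda>i. mom 3 v x i - 6 * mom 2 v x i * mom 1 v x i + 6 * mom 1 v x i ^ 3)\<bar> \<le> 13 * M ^ 3"
  proof (rule outer_mean_bound)
    fix i assume i: "i \<in> I"
    have "\<bar>mom 2 v x i * mom 1 v x i\<bar> \<le> M\<^sup>2 * M"
      unfolding abs_mult using mom_bound[OF i, where k=2 and x=x] mom_bound[OF i, where k=1 and x=x] M_nonneg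
      by (intro mult_mono) auto
    moreover have "\<bar>mom 1 v x i ^ 3\<bar> \<le> M ^ 3"
      unfolding power_abs using mom_bound[OF i, where k=1 and x=x] by (intro power_mono) auto
    moreover have "\<bar>mom 3 v x i\<bar> \<le> M ^ 3" using mom_bound[OF i] .
    ultimately show "\<bar>mom 3 v x i - 6 * mom 2 v x i * mom 1 v x i + 6 * mom 1 v x i ^ 3\<bar> \<le> 13 * M ^ 3"
      by (simp add: power2_eq_square power3_eq_cube)
  qed
  have 2: "\<bar>d1 v x * outer_mean x (\<lambda>i. mom 2 v x i - 2 * (mom 1 v x i)\<^sup>2)\<bar> \<le> M * (3 * M\<^sup>2)"
    unfolding abs_mult using d1_bound var_bound M_nonneg by (intro mult_mono) auto
  have 3: "\<bar>d1 v x * d2 v x\<bar> \<le> M * (4 * \<beta> * M\<^sup>2)"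
    unfolding abs_mult using d1_bound d2_bound M_nonneg by (intro mult_mono) auto
  let ?a = "outer_mean x (\<lambda>i. mom 3 v x i - 6 * mom 2 v x i * mom 1 v x i + 6 * mom 1 v x i ^ 3)
     + d1 v x * outer_mean x (\<lambda>i. mom 2 v x i - 2 * (mom 1 v x i)\<^sup>2)"
  have "\<bar>?a\<bar> \<le> 16 * M ^ 3" using 1 2 by (simp add: power2_eq_square power3_eq_cube)
  then have "\<beta>\<^sup>2 * \<bar>?a\<bar> \<le> \<beta>\<^sup>2 * (16 * M ^ 3)" by (intro mult_left_mono) auto
  then have a: "\<bar>\<beta>\<^sup>2 * ?a\<bar> \<le> \<beta>\<^sup>2 * (16 * M ^ 3)" by (simp add: abs_mult)
  have "2 * \<beta> * \<bar>d1 v x * d2 v x\<bar> \<le> 2 * \<beta> * (M * (4 * \<beta> * M\<^sup>2))"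
    using 3 beta by (intro mult_left_mono) auto
  then have b: "\<bar>2 * \<beta> * d1 v x * d2 v x\<bar> \<le> \<beta>\<^sup>2 * (8 * M ^ 3)"
    using beta by (simp add: abs_mult power2_eq_square power3_eq_cube mult_ac)
  show ?thesis
    unfolding d3_def using a b by (simp add: algebra_simps) 
qed

text \<open>The bounds on \<open>d2\<close> and \<open>d3\<close> do not involve the base point. The Taylor remainders are therefore
  uniform in \<open>x\<close>, which the later averages over random base points rely on.\<close>
lemma soft_val_taylor2: "\<bar>soft_val (\<lambda>i j. x i j + v i j) - soft_val x - d1 v x\<bar> \<le> 2 * \<beta> * M\<^sup>2"
proof -
  let ?D = "\<lambda>m s. case m of 0 \<Rightarrow> soft_val (ray x v s) | Suc 0 \<Rightarrow> d1 v (ray x v s) | _ \<Rightarrow> d2 v (ray x v s)"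
  have "\<forall>m t. m < 2 \<and> 0 \<le> t \<and> t \<le> 1 \<longrightarrow> (?D m has_real_derivative ?D (Suc m) t) (at t)"
  proof (intro allI impI)
    fix m :: nat and t :: real assume "m < 2 \<and> 0 \<le> t \<and> t \<le> 1"
    then consider "m = 0" | "m = 1" by linarith
    then show "(?D m has_real_derivative ?D (Suc m) t) (at t)"
      by cases (simp_all add: soft_val_deriv d1_deriv)
  qed
  then obtain t where "soft_val (ray x v 1) = (\<Sum>m<2. ?D m 0 / fact m * 1 ^ m) + ?D 2 t / fact 2 * 1 ^ 2"
    using Maclaurin[of 1 2 ?D "\<lambda>s. soft_val (ray x v s)"] by (auto simp del: One_nat_def)
  then have "soft_val (ray x v 1) - soft_val (ray x v 0) - d1 v (ray x v 0) = d2 v (ray x v t) / 2"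
    by (simp add: numeral_2_eq_2 lessThan_Suc)
  then show ?thesis using d2_bound[of "ray x v t"] by (simp add: ray_def)
qed

lemma soft_val_taylor3: "\<bar>soft_val (\<lambda>i j. x i j + v i j) - soft_val x - d1 v x - d2 v x / 2\<bar> \<le> 4 * \<beta>\<^sup>2 * M ^ 3"
proof -
  let ?D = "\<lambda>m s. case m of 0 \<Rightarrow> soft_val (ray x v s) | Suc 0 \<Rightarrow> d1 v (ray x v s)
     | Suc (Suc 0) \<Rightarrow> d2 v (ray x v s) | _ \<Rightarrow> d3 v (ray x v s)"
  have "\<forall>m t. m < 3 \<and> 0 \<le> t \<and> t \<le> 1 \<longrightarrow> (?D m has_real_derivative ?D (Suc m) t) (at t)"
  proof (intro allI impI)
    fix m :: nat and t :: real assume "m < 3 \<and> 0 \<le> t \<and> t \<le> 1"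
    then consider "m = 0" | "m = 1" | "m = 2" by linarith
    then show "(?D m has_real_derivative ?D (Suc m) t) (at t)"
      by cases (simp_all add: soft_val_deriv d1_deriv d2_deriv numeral_2_eq_2)
  qed
  then obtain t where "soft_val (ray x v 1) = (\<Sum>m<3. ?D m 0 / fact m * 1 ^ m) + ?D 3 t / fact 3 * 1 ^ 3"
    using Maclaurin[of 1 3 ?D "\<lambda>s. soft_val (ray x v s)"] by (auto simp del: One_nat_def)
  then have "soft_val (ray x v 1) - soft_val (ray x v 0) - d1 v (ray x v 0) - d2 v (ray x v 0) / 2 = d3 v (ray x v t) / 6"
    by (simp add: numeral_3_eq_3 lessThan_Suc fact_numeral)
  then show ?thesis using d3_bound[of "ray x v t"] by (simp add: ray_def)
qed

text \<open>The gradient consists of convex weights, hence Lipschitz constant one in the maximum norm.\<close>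
lemma soft_val_lipschitz: "\<bar>soft_val (\<lambda>i j. x i j + v i j) - soft_val x\<bar> \<le> M"
proof -
  obtain t where "soft_val (ray x v 1) - soft_val (ray x v 0) = (1 - 0) * d1 v (ray x v t)"
    using MVT2[of 0 1 "\<lambda>s. soft_val (ray x v s)" "\<lambda>s. d1 v (ray x v s)"] soft_val_deriv by auto
  then show ?thesis using d1_bound[of "ray x v t"] by (simp add: ray_def)
qed

end

text \<open>For each row, \<open>1 / Zin\<close> is one of the positive terms of \<open>Zout\<close>, and \<open>Zin\<close> has \<open>card J\<close> terms.\<close>
lemma soft_val_le: "soft_val x \<le> m + ln (card J) / \<beta>" if i: "i \<in> I" and m: "\<And>j. j \<in> J \<Longrightarrow> x i j \<le> m"
proof -
  have cJ: "card J > 0" using finJ neJ by (simp add: card_gt_0_iff)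
  have "Zin x i \<le> (\<Sum>j\<in>J. exp (\<beta> * m))"
    unfolding Zin_def using m beta by (intro sum_mono) auto
  then have "Zin x i \<le> card J * exp (\<beta> * m)" by simp
  then have "1 / (card J * exp (\<beta> * m)) \<le> 1 / Zin x i"
    using Zin_pos[of x i] cJ by (intro divide_left_mono mult_pos_pos) auto
  also have "\<dots> \<le> Zout x"
    unfolding Zout_def using finI i Zin_pos[of x] by (intro member_le_sum) (auto simp: less_imp_le)
  finally have "ln (1 / (card J * exp (\<beta> * m))) \<le> ln (Zout x)"
    using cJ by (intro ln_mono) auto
  then have "- (ln (card J) + \<beta> * m) \<le> ln (Zout x)"
    using cJ by (simp add: ln_div ln_mult)
  then have "- ln (Zout x) / \<beta> \<le> (ln (card J) + \<beta> * m) / \<beta>"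
    using beta by (intro divide_right_mono) auto
  then show ?thesis unfolding soft_val_def using beta by (simp add: field_simps)
qed

text \<open>Here one column suffices to bound \<open>Zin\<close> from below, and \<open>Zout\<close> has \<open>card I\<close> terms.\<close>
lemma soft_val_ge:
  "m - ln (card I) / \<beta> \<le> soft_val x" if m: "\<And>i. i \<in> I \<Longrightarrow> \<exists>j\<in>J. m \<le> x i j"
proof -
  have "1 / Zin x i \<le> exp (- \<beta> * m)" if "i \<in> I" for i
  proof -
    obtain j where j: "j \<in> J" "m \<le> x i j" using m[of i] \<open>i \<in> I\<close> by blast
    have "exp (\<beta> * m) \<le> exp (\<beta> * x i j)" using j beta by simp
    also have "\<dots> \<le> Zin x i" unfolding Zin_def using finJ j by (intro member_le_sum) auto
    finally have "1 / Zin x i \<le> 1 / exp (\<beta> * m)"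
      using Zin_pos[of x i] by (intro divide_left_mono mult_pos_pos) auto
    then show ?thesis by (simp add: exp_minus inverse_eq_divide)
  qed
  then have "Zout x \<le> card I * exp (- \<beta> * m)"
    unfolding Zout_def by (rule sum_bounded_above)
  then have "ln (Zout x) \<le> ln (card I * exp (- \<beta> * m))"
    using Zout_pos by (intro ln_mono) auto
  also have "\<dots> = ln (card I) - \<beta> * m"
    using finI neI by (simp add: ln_mult card_gt_0_iff)
  finally have "(\<beta> * m - ln (card I)) / \<beta> \<le> - ln (Zout x) / \<beta>"
    using beta by (intro divide_right_mono) auto
  then show ?thesis unfolding soft_val_def using beta by (simp add: field_simps)
qed

end

section \<open>Families of independent standard normal variables\<close>

abbreviation gauss1 :: "real measure" where
  "gauss1 \<equiv> density lborel (\<lambda>x. ennreal (std_normal_density x))"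

definition gauss_space :: "('k::finite \<Rightarrow> real) measure" where
  "gauss_space = PiM UNIV (\<lambda>_. gauss1)"

lemma prob_space_gauss1: "prob_space gauss1"
  by (rule prob_space_normal_density) simp

lemma sets_gauss1: "sets gauss1 = sets borel" by simp

lemma sets_gauss_space [measurable_cong]:
  "sets gauss_space = sets (PiM UNIV (\<lambda>_. borel))"
  unfolding gauss_space_def by (intro sets_PiM_cong) auto

lemma space_gauss_space [simp]: "space gauss_space = UNIV"
  by (simp add: gauss_space_def space_PiM)

interpretation gauss1: prob_space gauss1 by (rule prob_space_gauss1)

interpretation gauss_prod: product_prob_space "\<lambda>_::'k. gauss1" UNIV
  by unfold_locales

interpretation gauss_space: prob_space gauss_space
  unfolding gauss_space_def by (intro prob_space_PiM prob_space_gauss1)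

lemma prob_gauss_space_UNIV [simp]: "measure gauss_space UNIV = 1"
  using gauss_space.prob_space by simp

text \<open>Stability of the normal law: for independent standard normal \<open>x, y\<close> and a point \<open>(s, t)\<close> of the
  unit circle, \<open>s * x + t * y\<close> is standard normal. A normal density has a positive standard deviation,
  so the points on the two axes are separate cases.\<close>
lemma gauss1_stable:
  assumes "s \<ge> 0" "t \<ge> 0" "s\<^sup>2 + t\<^sup>2 = 1"
  shows "distr (gauss1 \<Otimes>\<^sub>M gauss1) borel (\<lambda>(x, y). s * x + t * y) = gauss1"
proof -
  interpret pair_prob_space gauss1 gauss1 by unfold_locales
  have fst: "distr (gauss1 \<Otimes>\<^sub>M gauss1) borel fst = gauss1"
    using gauss1.distr_pair_fst[of gauss1] distr_cong[OF refl sets_gauss1, of "gauss1 \<Otimes>\<^sub>M gauss1" fst fst] by simp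
  have snd: "distr (gauss1 \<Otimes>\<^sub>M gauss1) borel snd = gauss1"
  proof (rule measure_eqI)
    fix A assume "A \<in> sets (distr (gauss1 \<Otimes>\<^sub>M gauss1) borel snd)"
    then have A: "A \<in> sets borel" by simp
    then have "emeasure (distr (gauss1 \<Otimes>\<^sub>M gauss1) borel snd) A = emeasure (gauss1 \<Otimes>\<^sub>M gauss1) (UNIV \<times> A)"
      by (subst emeasure_distr) (auto simp: space_pair_measure intro!: arg_cong2[where f=emeasure])
    also have "\<dots> = emeasure gauss1 A"
      using A gauss1.emeasure_space_1 by (subst gauss1.emeasure_pair_measure_Times) auto
    finally show "emeasure (distr (gauss1 \<Otimes>\<^sub>M gauss1) borel snd) A = emeasure gauss1 A" .
  qed simp
  have lb: "distr (gauss1 \<Otimes>\<^sub>M gauss1) lborel f = distr (gauss1 \<Otimes>\<^sub>M gauss1) borel f" for f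
    by (rule distr_cong) auto
  have dfst: "distributed (gauss1 \<Otimes>\<^sub>M gauss1) lborel fst (normal_density 0 1)"
    unfolding distributed_def using fst by (simp add: lb)
  have dsnd: "distributed (gauss1 \<Otimes>\<^sub>M gauss1) lborel snd (normal_density 0 1)"
    unfolding distributed_def using snd by (simp add: lb)
  show ?thesis
  proof (cases "s = 0 \<or> t = 0")
    case True
    then show ?thesis
    proof
      assume "s = 0"
      with assms have "t = 1" by (simp add: power2_eq_1_iff)
      then show ?thesis using snd \<open>s = 0\<close> by (simp add: case_prod_unfold)
    next
      assume "t = 0"
      with assms have "s = 1" by (simp add: power2_eq_1_iff)
      then show ?thesis using fst \<open>t = 0\<close> by (simp add: case_prod_unfold)
    qed
  next
    case False
    then have "s > 0" "t > 0" using assms by auto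
    have "sets (borel \<Otimes>\<^sub>M borel) = sets (gauss1 \<Otimes>\<^sub>M gauss1)"
      by (intro sets_pair_measure_cong) auto
    from distr_id2[OF this]
    have "distr (gauss1 \<Otimes>\<^sub>M gauss1) (borel \<Otimes>\<^sub>M borel) (\<lambda>x. (fst x, snd x)) = gauss1 \<Otimes>\<^sub>M gauss1"
      by simp
    then have ind: "indep_var borel fst borel snd"
      unfolding indep_var_distribution_eq fst snd by simp
    have 1: "distributed (gauss1 \<Otimes>\<^sub>M gauss1) lborel (\<lambda>x. 0 + s * fst x) (normal_density (0 + s * 0) (\<bar>s\<bar> * 1))"
      by (rule normal_density_affine[OF dfst]) (use \<open>s > 0\<close> in auto)
    have 2: "distributed (gauss1 \<Otimes>\<^sub>M gauss1) lborel (\<lambda>x. 0 + t * snd x) (normal_density (0 + t * 0) (\<bar>t\<bar> * 1))"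
      by (rule normal_density_affine[OF dsnd]) (use \<open>t > 0\<close> in auto)
    have ind': "indep_var borel (\<lambda>x. s * fst x) borel (\<lambda>x. t * snd x)"
      using indep_var_compose[OF ind, of "\<lambda>x. s * x" borel "\<lambda>x. t * x" borel] by (simp add: o_def)
    have "distributed (gauss1 \<Otimes>\<^sub>M gauss1) lborel (\<lambda>x. s * fst x + t * snd x)
       (normal_density (0 + 0) (sqrt (s\<^sup>2 + t\<^sup>2)))"
      using 1 2 \<open>s > 0\<close> \<open>t > 0\<close> by (intro add_indep_normal[OF ind']) simp_all
    then show ?thesis
      unfolding distributed_def using assms by (simp add: case_prod_unfold lb)
  qed
qed

text \<open>On a box the probability factorises over the coordinates, first in the inner and then in the
  outer integral; what remains is the one-dimensional stability.\<close>
lemma gauss_space_stable: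
  assumes "s \<ge> 0" "t \<ge> 0" "s\<^sup>2 + t\<^sup>2 = 1"
  shows "distr (gauss_space \<Otimes>\<^sub>M gauss_space) gauss_space (\<lambda>(w, z) k. s * w k + t * z k)
     = (gauss_space :: ('k::finite \<Rightarrow> real) measure)"
proof -
  let ?G = "gauss_space :: ('k \<Rightarrow> real) measure"
  interpret pair_prob_space ?G ?G by unfold_locales
  interpret P: pair_prob_space gauss1 gauss1 by unfold_locales
  have meas: "(\<lambda>(w, z) k. s * w k + t * z k) \<in> measurable (?G \<Otimes>\<^sub>M ?G) ?G"
    unfolding measurable_cong_sets[OF refl sets_gauss_space]
    by (rule measurable_PiM_single') (auto simp: case_prod_unfold)
  show ?thesis
    unfolding gauss_space_def
  proof (rule gauss_prod.PiM_eqI)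
    fix A :: "'k \<Rightarrow> real set" assume "\<And>i. i \<in> UNIV \<Longrightarrow> A i \<in> sets gauss1"
    then have A[measurable]: "A i \<in> sets borel" for i by simp
    have PA: "Pi\<^sub>E UNIV A \<in> sets ?G"
      unfolding sets_gauss_space by (rule sets_PiM_I_finite) auto
    have "emeasure (distr (?G \<Otimes>\<^sub>M ?G) ?G (\<lambda>(w, z) k. s * w k + t * z k)) (Pi\<^sub>E UNIV A)
      = emeasure (?G \<Otimes>\<^sub>M ?G) {x. \<forall>k. s * fst x k + t * snd x k \<in> A k}"
      using meas A by (subst emeasure_distr)
        (use PA in \<open>auto simp: space_pair_measure PiE_UNIV_domain intro!: arg_cong2[where f=emeasure]\<close>)
    also have "\<dots> = (\<integral>\<^sup>+x. (\<Prod>k\<in>UNIV. indicator (A k) (s * fst x k + t * snd x k)) \<partial>(?G \<Otimes>\<^sub>M ?G))"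
    proof -
      let ?E = "{x. \<forall>k. s * fst x k + t * snd x k \<in> A k}"
      have "?E \<in> sets (?G \<Otimes>\<^sub>M ?G)"
        using meas[THEN measurable_sets, OF PA]
        by (simp add: space_pair_measure PiE_UNIV_domain Pi_def vimage_def case_prod_unfold)
      then have "emeasure (?G \<Otimes>\<^sub>M ?G) ?E = (\<integral>\<^sup>+x. indicator ?E x \<partial>(?G \<Otimes>\<^sub>M ?G))"
        by (rule nn_integral_indicator[symmetric])
      also have "\<dots> = (\<integral>\<^sup>+x. (\<Prod>k\<in>UNIV. indicator (A k) (s * fst x k + t * snd x k)) \<partial>(?G \<Otimes>\<^sub>M ?G))"
      proof (intro nn_integral_cong)
        fix x :: "('k \<Rightarrow> real) \<times> ('k \<Rightarrow> real)"
        show "indicator ?E x = (\<Prod>k\<in>UNIV. indicator (A k) (s * fst x k + t * snd x k) :: ennreal)"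
        proof (cases "x \<in> ?E")
          case False
          then obtain k where "s * fst x k + t * snd x k \<notin> A k" by auto
          then have "(\<Prod>k\<in>UNIV. indicator (A k) (s * fst x k + t * snd x k) :: ennreal) = 0"
            by (intro prod_zero bexI[of _ k]) auto
          with False show ?thesis by simp
        qed simp
      qed
      finally show ?thesis .
    qed
    also have "\<dots> = (\<integral>\<^sup>+w. \<integral>\<^sup>+z. (\<Prod>k\<in>UNIV. indicator (A k) (s * w k + t * z k)) \<partial>?G \<partial>?G)"
      by (subst gauss_space.nn_integral_fst[symmetric]) auto
    also have "\<dots> = (\<integral>\<^sup>+w. (\<Prod>k\<in>UNIV. \<integral>\<^sup>+z. indicator (A k) (s * w k + t * z) \<partial>gauss1) \<partial>?G)"
      unfolding gauss_space_def
      by (intro nn_integral_cong gauss_prod.product_nn_integral_prod) auto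
    also have "\<dots> = (\<Prod>k\<in>UNIV. \<integral>\<^sup>+w. \<integral>\<^sup>+z. indicator (A k) (s * w + t * z) \<partial>gauss1 \<partial>gauss1)"
      unfolding gauss_space_def
      by (intro gauss_prod.product_nn_integral_prod) auto
    also have "\<dots> = (\<Prod>k\<in>UNIV. emeasure gauss1 (A k))"
    proof (intro prod.cong refl)
      fix k
      have "(\<integral>\<^sup>+w. \<integral>\<^sup>+z. indicator (A k) (s * w + t * z) \<partial>gauss1 \<partial>gauss1)
        = (\<integral>\<^sup>+x. indicator (A k) (s * fst x + t * snd x) \<partial>(gauss1 \<Otimes>\<^sub>M gauss1))"
        by (subst gauss1.nn_integral_fst[symmetric]) auto
      also have "\<dots> = (\<integral>\<^sup>+x. indicator (A k) x \<partial>distr (gauss1 \<Otimes>\<^sub>M gauss1) borel (\<lambda>(x, y). s * x + t * y))"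
        by (subst nn_integral_distr) (auto simp: case_prod_unfold)
      finally show "(\<integral>\<^sup>+w. \<integral>\<^sup>+z. indicator (A k) (s * w + t * z) \<partial>gauss1 \<partial>gauss1) = emeasure gauss1 (A k)"
        unfolding gauss1_stable[OF assms] by simp
    qed
    finally show "emeasure (distr (PiM UNIV (\<lambda>_. gauss1) \<Otimes>\<^sub>M PiM UNIV (\<lambda>_. gauss1)) (PiM UNIV (\<lambda>_. gauss1)) (\<lambda>(w, z) k. s * w k + t * z k)) (Pi\<^sub>E UNIV A) = (\<Prod>i\<in>UNIV. emeasure gauss1 (A i))"
      by (simp add: gauss_space_def)
  qed auto
qed

text \<open>Completing the square turns \<open>exp (c * x)\<close> times the standard density into a constant multiple of
  a shifted density.\<close>
lemma integrable_exp_gauss1: "integrable gauss1 (\<lambda>x. exp (c * \<bar>x\<bar>))"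
proof -
  have 1: "integrable lborel (\<lambda>x. std_normal_density x * exp (c * x))" for c
  proof -
    have "integrable lborel (\<lambda>x. std_normal_density (-c + 1 * x))"
      by (rule lborel_integrable_real_affine) (auto simp: integrable_normal_density)
    then have "integrable lborel (\<lambda>x. exp (c\<^sup>2/2) * std_normal_density (-c + 1 * x))"
      by (rule integrable_mult_right)
    also have "(\<lambda>x. exp (c\<^sup>2/2) * std_normal_density (-c + 1 * x)) = (\<lambda>x. std_normal_density x * exp (c * x))"
      by (auto simp: std_normal_density_def fun_eq_iff power2_eq_square field_simps simp flip: exp_add)
    finally show ?thesis .
  qed
  have "integrable lborel (\<lambda>x. std_normal_density x * exp (c * \<bar>x\<bar>))"
  proof (rule Bochner_Integration.integrable_bound)
    show "integrable lborel (\<lambda>x. std_normal_density x * exp (c * x) + std_normal_density x * exp ((-c) * x))"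
      by (intro Bochner_Integration.integrable_add 1)
    have "norm (std_normal_density x * exp (c * \<bar>x\<bar>))
      \<le> norm (std_normal_density x * exp (c * x) + std_normal_density x * exp ((-c) * x))" for x
    proof -
      have "exp (c * \<bar>x\<bar>) \<le> exp (c * x) + exp ((-c) * x)" by (cases "x \<ge> 0") auto
      then have "std_normal_density x * exp (c * \<bar>x\<bar>) \<le> std_normal_density x * (exp (c * x) + exp ((-c) * x))"
        by (intro mult_left_mono) auto
      then show ?thesis by (simp add: distrib_left)
    qed
    then show "AE x in lborel. norm (std_normal_density x * exp (c * \<bar>x\<bar>))
      \<le> norm (std_normal_density x * exp (c * x) + std_normal_density x * exp ((-c) * x))" by simp
  qed auto
  then show ?thesis by (subst integrable_density) auto
qed

text \<open>The sum norm serves as the gauge for all remainder terms: it dominates every linear function up to a constant,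
  and its exponential is a product over the coordinates, so that all exponential moments are finite.\<close>
definition radius :: "('k::finite \<Rightarrow> real) \<Rightarrow> real" where
  "radius w = (\<Sum>k\<in>UNIV. \<bar>w k\<bar>)"

lemma radius_nonneg [simp]: "radius w \<ge> 0"
  by (auto simp: radius_def intro: sum_nonneg)

lemma radius_measurable [measurable]: "radius \<in> borel_measurable gauss_space"
  unfolding radius_def by measurable

lemma integrable_exp_radius:
  "integrable gauss_space (\<lambda>w :: 'k::finite \<Rightarrow> real. exp (c * radius w))"
proof -
  have "integrable gauss_space (\<lambda>w :: 'k \<Rightarrow> real. \<Prod>k\<in>UNIV. exp (c * \<bar>w k\<bar>))"
    unfolding gauss_space_def
    by (intro gauss_prod.product_integrable_prod integrable_exp_gauss1) auto
  also have "(\<lambda>w :: 'k \<Rightarrow> real. \<Prod>k\<in>UNIV. exp (c * \<bar>w k\<bar>)) = (\<lambda>w. exp (c * radius w))"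
    by (simp add: radius_def sum_distrib_left exp_sum)
  finally show ?thesis .
qed

lemma integrable_power_exp_radius:
  assumes "c \<ge> 0"
  shows "integrable gauss_space (\<lambda>w :: 'k::finite \<Rightarrow> real. radius w ^ n * exp (c * radius w))"
proof (rule Bochner_Integration.integrable_bound[OF integrable_exp_radius[of "real n + c"]])
  have "radius w ^ n * exp (c * radius w) \<le> exp ((real n + c) * radius w)" for w :: "'k \<Rightarrow> real"
  proof -
    have "radius w \<le> exp (radius w)" using exp_ge_add_one_self[of "radius w"] by linarith
    then have "radius w ^ n \<le> exp (radius w) ^ n" by (intro power_mono) auto
    then show ?thesis by (simp add: exp_add algebra_simps flip: exp_of_nat_mult)
  qed
  then show "AE w :: 'k \<Rightarrow> real in gauss_space. norm (radius w ^ n * exp (c * radius w)) \<le> norm (exp ((real n + c) * radius w))"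
    by (intro AE_I2) simp
qed measurable

lemma integrable_power_radius: "integrable gauss_space (\<lambda>w :: 'k::finite \<Rightarrow> real. radius w ^ n)"
  using integrable_power_exp_radius[of 0 n] by simp

lemma integrable_radius: "integrable gauss_space (\<lambda>w :: 'k::finite \<Rightarrow> real. a + b * radius w)"
  using integrable_power_radius[of 1, where 'k='k]
  by (intro Bochner_Integration.integrable_add gauss_space.integrable_const integrable_mult_right) simp

lemma gauss1_integral: "(\<integral>x. f x \<partial>gauss1) = (\<integral>x. std_normal_density x * f x \<partial>lborel)"
  if "f \<in> borel_measurable borel" for f :: "real \<Rightarrow> real"
  using that by (subst integral_density) auto

lemma integral_coord: "(\<integral>w. w k \<partial>gauss_space) = 0"
  and integral_coord2: "(\<integral>w. w k * w l \<partial>gauss_space) = (if k = l then 1 else 0)"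
  for k l :: "'k::finite"
proof -
  have i1: "integrable gauss1 (\<lambda>x. x)"
    using integrable_std_normal_moment[of 1] by (subst integrable_density) auto
  have i2: "integrable gauss1 (\<lambda>x. x * x)"
    using integrable_std_normal_moment[of 2] by (subst integrable_density) (auto simp: power2_eq_square)
  have i1': "integrable gauss1 (\<lambda>x. if Q then x else 1)" and i2': "integrable gauss1 (\<lambda>x. if Q then x * x else 1)" for Q
    using i1 i2 by (cases Q; simp)+
  have v1: "(\<integral>x. x \<partial>gauss1) = 0"
    using integral_std_normal_moment_odd[of 0] by (simp add: gauss1_integral)
  have v2: "(\<integral>x. x * x \<partial>gauss1) = 1"
    using integral_std_normal_moment_even[of 1] by (simp add: gauss1_integral power2_eq_square)
  have "(\<integral>w. w k \<partial>gauss_space) = (\<integral>w. (\<Prod>i\<in>UNIV. if i = k then w i else 1) \<partial>gauss_space)"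
    by simp
  also have "\<dots> = (\<Prod>i\<in>UNIV. \<integral>x. (if i = k then x else 1) \<partial>gauss1)"
    unfolding gauss_space_def using i1'
    by (intro gauss_prod.product_integral_prod[where f="\<lambda>i x. if i = k then x else 1"]) simp_all
  also have "\<dots> = 0" by (rule prod_zero[OF _ bexI[of _ k]]) (auto simp: v1)
  finally show "(\<integral>w. w k \<partial>gauss_space) = 0" .
  show "(\<integral>w. w k * w l \<partial>gauss_space) = (if k = l then 1 else 0)"
  proof (cases "k = l")
    case True
    have "(\<integral>w. w k * w l \<partial>gauss_space) = (\<integral>w. (\<Prod>i\<in>UNIV. if i = k then w i * w i else 1) \<partial>gauss_space)"
      using True by simp
    also have "\<dots> = (\<Prod>i\<in>UNIV. \<integral>x. (if i = k then x * x else 1) \<partial>gauss1)"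
      unfolding gauss_space_def using i2'
      by (intro gauss_prod.product_integral_prod[where f="\<lambda>i x. if i = k then x * x else 1"]) simp_all
    also have "\<dots> = 1"
    proof (intro prod.neutral ballI)
      fix i show "(\<integral>x. (if i = k then x * x else 1) \<partial>gauss1) = 1"
        using v2 gauss1.prob_space by (cases "i = k") simp_all
    qed
    finally show ?thesis using True by simp
  next
    case False
    have "(\<integral>w. w k * w l \<partial>gauss_space) = (\<integral>w. (\<Prod>i\<in>UNIV. if i = k \<or> i = l then w i else 1) \<partial>gauss_space)"
    proof (rule Bochner_Integration.integral_cong[OF refl])
      fix w :: "'k \<Rightarrow> real"
      have "(\<Prod>i\<in>UNIV. if i = k \<or> i = l then w i else 1) = (\<Prod>i\<in>{k, l}. w i)"
        by (rule prod.mono_neutral_cong_right) auto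
      then show "w k * w l = (\<Prod>i\<in>UNIV. if i = k \<or> i = l then w i else 1)" using False by simp
    qed
    also have "\<dots> = (\<Prod>i\<in>UNIV. \<integral>x. (if i = k \<or> i = l then x else 1) \<partial>gauss1)"
      unfolding gauss_space_def using i1'
      by (intro gauss_prod.product_integral_prod[where f="\<lambda>i x. if i = k \<or> i = l then x else 1"]) simp_all
    also have "\<dots> = 0" by (rule prod_zero[OF _ bexI[of _ k]]) (auto simp: v1)
    finally show ?thesis using False by simp
  qed
qed


text \<open>Stability for arbitrary radii: two independent Gaussian displacements of sizes \<open>s\<close> and \<open>t\<close> amount
  to one of size \<open>r = sqrt (s\<^sup>2 + t\<^sup>2)\<close>. This is what makes the Gaussian averages below a semigroup.\<close>
lemma integral_gauss_space_stable:
  fixes g :: "('k::finite \<Rightarrow> real) \<Rightarrow> real"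
  assumes "s \<ge> 0" "t \<ge> 0" "r \<ge> 0" "r\<^sup>2 = s\<^sup>2 + t\<^sup>2"
    and g [measurable]: "g \<in> borel_measurable gauss_space"
    and int: "integrable gauss_space (\<lambda>w. g (\<lambda>k. r * w k))"
  shows "(\<integral>w. (\<integral>z. g (\<lambda>k. s * w k + t * z k) \<partial>gauss_space) \<partial>gauss_space)
    = (\<integral>w. g (\<lambda>k. r * w k) \<partial>gauss_space)"
proof (cases "r = 0")
  case True
  with assms have "s = 0" "t = 0" by (auto simp: sum_power2_eq_zero_iff)
  with True show ?thesis by simp
next
  case False
  then have r: "r > 0" using assms by simp
  let ?G = "gauss_space :: ('k \<Rightarrow> real) measure"
  interpret pair_prob_space ?G ?G by unfold_locales
  define T :: "('k \<Rightarrow> real) \<times> ('k \<Rightarrow> real) \<Rightarrow> 'k \<Rightarrow> real"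
    where "T = (\<lambda>(w, z) k. s / r * w k + t / r * z k)"
  have scale [measurable]: "(\<lambda>w k. r * w k) \<in> measurable ?G ?G"
    unfolding measurable_cong_sets[OF refl sets_gauss_space]
    by (rule measurable_PiM_single') auto
  have T [measurable]: "T \<in> measurable (?G \<Otimes>\<^sub>M ?G) ?G"
    unfolding T_def measurable_cong_sets[OF refl sets_gauss_space]
    by (rule measurable_PiM_single') (auto simp: case_prod_unfold)
  have "(s / r)\<^sup>2 + (t / r)\<^sup>2 = 1"
    using r by (simp add: power_divide flip: add_divide_distrib assms(4))
  then have D: "distr (?G \<Otimes>\<^sub>M ?G) ?G T = ?G"
    unfolding T_def using assms r by (intro gauss_space_stable) auto
  have gr [measurable]: "(\<lambda>w. g (\<lambda>k. r * w k)) \<in> borel_measurable ?G"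
    by measurable
  have rT: "(\<lambda>k. r * T x k) = (\<lambda>k. s * fst x k + t * snd x k)" for x
    using r by (auto simp: T_def case_prod_unfold fun_eq_iff field_simps)
  have "integrable (distr (?G \<Otimes>\<^sub>M ?G) ?G T) (\<lambda>w. g (\<lambda>k. r * w k))"
    unfolding D by (rule int)
  then have I: "integrable (?G \<Otimes>\<^sub>M ?G) (\<lambda>(w, z). g (\<lambda>k. s * w k + t * z k))"
    using rT by (simp add: integrable_distr_eq case_prod_unfold)
  have "(\<integral>w. g (\<lambda>k. r * w k) \<partial>?G) = (\<integral>w. g (\<lambda>k. r * w k) \<partial>distr (?G \<Otimes>\<^sub>M ?G) ?G T)"
    unfolding D ..
  also have "\<dots> = (\<integral>x. g (\<lambda>k. s * fst x k + t * snd x k) \<partial>(?G \<Otimes>\<^sub>M ?G))"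
    by (subst integral_distr) (simp_all add: rT)
  also have "\<dots> = (\<integral>w. (\<integral>z. g (\<lambda>k. s * w k + t * z k) \<partial>?G) \<partial>?G)"
    using integral_fst[OF I] by (simp add: case_prod_unfold)
  finally show ?thesis ..
qed

section \<open>Gaussian arrays and their mixtures\<close>

text \<open>A centred Gaussian array is given by its coefficients \<open>c\<close> with respect to finitely many
  independent standard normal coordinates. Its covariances are the inner products
  \<open>sum (\<lambda>k. c i j k * c i' j' k) UNIV\<close>.\<close>
definition gauss_field :: "('i \<Rightarrow> 'j \<Rightarrow> 'k::finite \<Rightarrow> real) \<Rightarrow> ('k \<Rightarrow> real) \<Rightarrow> 'i \<Rightarrow> 'j \<Rightarrow> real" where
  "gauss_field c w i j = (\<Sum>k\<in>UNIV. c i j k * w k)"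

lemma gauss_field_measurable [measurable]: "(\<lambda>w. gauss_field c w i j) \<in> borel_measurable gauss_space"
  unfolding gauss_field_def by measurable

lemma gauss_field_linear: "gauss_field c (\<lambda>k. s * w k + t * z k) i j = s * gauss_field c w i j + t * gauss_field c z i j"
  by (simp add: gauss_field_def sum.distrib sum_distrib_left algebra_simps)

lemma gauss_field_scale: "gauss_field c (\<lambda>k. s * w k) i j = s * gauss_field c w i j"
  by (simp add: gauss_field_def sum_distrib_left algebra_simps)

lemma integrable_coord: "integrable gauss_space (\<lambda>w :: 'k::finite \<Rightarrow> real. w k)"
  and integrable_coord2: "integrable gauss_space (\<lambda>w :: 'k::finite \<Rightarrow> real. w k * w l)"
proof -
  have le: "\<bar>w k\<bar> \<le> radius w" for k and w :: "'k \<Rightarrow> real"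
    unfolding radius_def by (rule member_le_sum[of k UNIV "\<lambda>k. \<bar>w k\<bar>"]) auto
  show "integrable gauss_space (\<lambda>w :: 'k \<Rightarrow> real. w k)"
    by (rule Bochner_Integration.integrable_bound[OF integrable_power_radius[of 1]]) (auto simp: le)
  have "\<bar>w k * w l\<bar> \<le> radius w ^ 2" for w :: "'k \<Rightarrow> real"
    unfolding abs_mult power2_eq_square using le by (intro mult_mono) auto
  then show "integrable gauss_space (\<lambda>w :: 'k \<Rightarrow> real. w k * w l)"
    by (intro Bochner_Integration.integrable_bound[OF integrable_power_radius[of 2]] AE_I2) auto
qed

lemma integral_linear: "(\<integral>w. (\<Sum>k\<in>UNIV. a k * w k) \<partial>gauss_space) = 0"
  for a :: "'k::finite \<Rightarrow> real"
  by (simp add: integral_coord integrable_coord)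

lemma integrable_linear: "integrable gauss_space (\<lambda>w. \<Sum>k\<in>UNIV. a k * w k)"
  for a :: "'k::finite \<Rightarrow> real"
  by (simp add: integrable_coord)

lemma integral_linear_sq: "(\<integral>w. (\<Sum>k\<in>UNIV. a k * w k)\<^sup>2 \<partial>gauss_space) = (\<Sum>k\<in>UNIV. (a k)\<^sup>2)"
  and integrable_linear_sq: "integrable gauss_space (\<lambda>w. (\<Sum>k\<in>UNIV. a k * w k)\<^sup>2)"
  for a :: "'k::finite \<Rightarrow> real"
proof -
  have e: "(\<Sum>k\<in>UNIV. a k * w k)\<^sup>2 = (\<Sum>k\<in>UNIV. \<Sum>l\<in>UNIV. (a k * a l) * (w k * w l))" for w
    by (simp add: power2_eq_square sum_product mult_ac)
  show "integrable gauss_space (\<lambda>w. (\<Sum>k\<in>UNIV. a k * w k)\<^sup>2)"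
    unfolding e by (intro Bochner_Integration.integrable_sum integrable_mult_right integrable_coord2)
  show "(\<integral>w. (\<Sum>k\<in>UNIV. a k * w k)\<^sup>2 \<partial>gauss_space) = (\<Sum>k\<in>UNIV. (a k)\<^sup>2)"
    unfolding e
    by (simp add: Bochner_Integration.integral_sum integrable_coord2 integral_coord2 if_distrib
        power2_eq_square cong: if_cong)
qed

lemma gauss_field_bound:
  fixes c :: "'i \<Rightarrow> 'j \<Rightarrow> 'k::finite \<Rightarrow> real"
  assumes "finite I" "finite J"
  obtains K where "K \<ge> 0" "\<And>w i j. i \<in> I \<Longrightarrow> j \<in> J \<Longrightarrow> \<bar>gauss_field c w i j\<bar> \<le> K * radius w"
proof
  let ?K = "\<Sum>i\<in>I. \<Sum>j\<in>J. \<Sum>k\<in>UNIV. \<bar>c i j k\<bar>"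
  show "?K \<ge> 0" by (intro sum_nonneg) auto
  fix w :: "'k \<Rightarrow> real" and i j assume ij: "i \<in> I" "j \<in> J"
  have le: "\<bar>w k\<bar> \<le> radius w" for k
    unfolding radius_def by (rule member_le_sum[of k UNIV "\<lambda>k. \<bar>w k\<bar>"]) auto
  have "\<bar>gauss_field c w i j\<bar> \<le> (\<Sum>k\<in>UNIV. \<bar>c i j k * w k\<bar>)"
    unfolding gauss_field_def by (rule sum_abs)
  also have "\<dots> \<le> (\<Sum>k\<in>UNIV. \<bar>c i j k\<bar> * radius w)"
    by (intro sum_mono) (auto simp: abs_mult le intro!: mult_left_mono)
  also have "\<dots> = (\<Sum>k\<in>UNIV. \<bar>c i j k\<bar>) * radius w" by (simp add: sum_distrib_right)
  also have "(\<Sum>k\<in>UNIV. \<bar>c i j k\<bar>) \<le> (\<Sum>j\<in>J. \<Sum>k\<in>UNIV. \<bar>c i j k\<bar>)"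
    using assms ij by (intro member_le_sum[of j J "\<lambda>j. \<Sum>k\<in>UNIV. \<bar>c i j k\<bar>"] sum_nonneg) auto
  also have "\<dots> \<le> ?K"
    using assms ij by (intro member_le_sum[of i I "\<lambda>i. \<Sum>j\<in>J. \<Sum>k\<in>UNIV. \<bar>c i j k\<bar>"] sum_nonneg) auto
  finally show "\<bar>gauss_field c w i j\<bar> \<le> ?K * radius w" by (simp add: mult_right_mono)
qed

lemma gauss_field_scaled_bound:
  assumes "s \<ge> 0" "\<bar>gauss_field c w i j\<bar> \<le> K * radius w"
  shows "\<bar>s * gauss_field c w i j\<bar> \<le> s * K * radius w"
  using mult_left_mono[OF assms(2,1)] assms(1) by (simp add: abs_mult mult_ac)

text \<open>The variance of \<open>f\<close> under the weights \<open>r\<close> is nonnegative.\<close>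
lemma convex_sq_le:
  fixes r f :: "'a \<Rightarrow> real"
  assumes "\<And>a. a \<in> S \<Longrightarrow> r a \<ge> 0" "sum r S = 1" 
  shows "(\<Sum>a\<in>S. r a * f a)\<^sup>2 \<le> (\<Sum>a\<in>S. r a * (f a)\<^sup>2)"
proof -
  let ?m = "\<Sum>a\<in>S. r a * f a"
  have "0 \<le> (\<Sum>a\<in>S. r a * (f a - ?m)\<^sup>2)"
    using assms by (intro sum_nonneg) auto
  also have "\<dots> = (\<Sum>a\<in>S. r a * (f a)\<^sup>2) - 2 * ?m * (\<Sum>a\<in>S. r a * f a) + ?m\<^sup>2 * sum r S"
  proof -
    have "(\<Sum>a\<in>S. r a * (f a - m)\<^sup>2) = (\<Sum>a\<in>S. r a * (f a)\<^sup>2) - 2 * m * (\<Sum>a\<in>S. r a * f a) + m\<^sup>2 * sum r S" for m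
      by (simp add: power2_eq_square sum_distrib_left sum_subtractf sum.distrib algebra_simps)
    then show ?thesis .
  qed
  finally show ?thesis using assms(2) by (simp add: power2_eq_square)
qed

lemma mix_field:
  "(\<Sum>(i,j)\<in>A. r i j * gauss_field c w i j) = (\<Sum>k\<in>UNIV. (\<Sum>(i,j)\<in>A. r i j * c i j k) * w k)"
proof -
  have "(\<Sum>(i,j)\<in>A. r i j * gauss_field c w i j) = (\<Sum>(i,j)\<in>A. \<Sum>k\<in>UNIV. r i j * c i j k * w k)"
    by (simp add: gauss_field_def sum_distrib_left mult.assoc)
  also have "\<dots> = (\<Sum>k\<in>UNIV. (\<Sum>(i,j)\<in>A. r i j * c i j k) * w k)"
    unfolding case_prod_unfold by (subst sum.swap) (simp add: sum_distrib_right)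
  finally show ?thesis .
qed

text \<open>The variance of the mixture with weights \<open>r\<close>, expressed through the covariances of the field.\<close>
lemma mix_sq:
  fixes c :: "'i \<Rightarrow> 'j \<Rightarrow> 'k::finite \<Rightarrow> real"
  shows "(\<Sum>k\<in>UNIV. (\<Sum>(i,j)\<in>A. r i j * c i j k)\<^sup>2)
    = (\<Sum>(i,j)\<in>A. \<Sum>(i',j')\<in>A. r i j * r i' j' * (\<Sum>k\<in>UNIV. c i j k * c i' j' k))"
proof -
  have "(\<Sum>k\<in>UNIV. (\<Sum>(i,j)\<in>A. r i j * c i j k)\<^sup>2)
    = (\<Sum>k\<in>UNIV. \<Sum>a\<in>A. \<Sum>b\<in>A. r (fst a) (snd a) * r (fst b) (snd b) * (c (fst a) (snd a) k * c (fst b) (snd b) k))"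
    by (simp add: power2_eq_square sum_product case_prod_unfold mult_ac)
  also have "\<dots> = (\<Sum>a\<in>A. \<Sum>b\<in>A. \<Sum>k\<in>UNIV. r (fst a) (snd a) * r (fst b) (snd b) * (c (fst a) (snd a) k * c (fst b) (snd b) k))"
    by (subst sum.swap, rule sum.cong[OF refl], subst sum.swap, rule refl)
  finally show ?thesis by (simp add: case_prod_unfold sum_distrib_left)
qed

definition displace :: "('i \<Rightarrow> 'j \<Rightarrow> 'k::finite \<Rightarrow> real) \<Rightarrow> real \<Rightarrow> ('k \<Rightarrow> real) \<Rightarrow> ('i \<Rightarrow> 'j \<Rightarrow> real) \<Rightarrow> 'i \<Rightarrow> 'j \<Rightarrow> real" where
  "displace c s w x = (\<lambda>i j. x i j + s * gauss_field c w i j)"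

lemma displace_measurable [measurable (raw)]:
  assumes "g \<in> measurable M gauss_space" "\<And>i j. (\<lambda>w. y w i j) \<in> borel_measurable M"
  shows "(\<lambda>w. displace c s (g w) (y w) i j) \<in> borel_measurable M"
  using assms measurable_compose[OF assms(1) gauss_field_measurable] unfolding displace_def by measurable

lemma displace_add: "displace c r w (\<lambda>i j. x i j + v i j) = (\<lambda>i j. displace c r w x i j + v i j)"
  by (simp add: displace_def fun_eq_iff)

section \<open>Gaussian averages of the soft min-max\<close>

context soft_minmax
begin

lemma Zin_measurable:
  assumes "\<And>i j. (\<lambda>w. g w i j) \<in> borel_measurable M"
  shows "(\<lambda>w. Zin (g w) i) \<in> borel_measurable M"
proof -
  have [measurable]: "(\<lambda>w. g w i j) \<in> borel_measurable M" for j by (rule assms)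
  show ?thesis unfolding Zin_def by measurable
qed

lemma Zout_measurable:
  assumes "\<And>i j. (\<lambda>w. g w i j) \<in> borel_measurable M"
  shows "(\<lambda>w. Zout (g w)) \<in> borel_measurable M"
  unfolding Zout_def
  by (intro borel_measurable_sum borel_measurable_divide borel_measurable_const Zin_measurable assms)

lemma soft_val_measurable [measurable (raw)]:
  assumes "\<And>i j. (\<lambda>w. g w i j) \<in> borel_measurable M"
  shows "(\<lambda>w. soft_val (g w)) \<in> borel_measurable M"
  unfolding soft_val_def using Zout_measurable[OF assms] by measurable

lemma p_measurable [measurable (raw)]:
  assumes "\<And>i j. (\<lambda>w. g w i j) \<in> borel_measurable M"
  shows "(\<lambda>w. p (g w) i) \<in> borel_measurable M"
  unfolding p_def using Zout_measurable[OF assms] Zin_measurable[OF assms] by measurable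

lemma q_measurable [measurable (raw)]:
  assumes "\<And>i j. (\<lambda>w. g w i j) \<in> borel_measurable M"
  shows "(\<lambda>w. q (g w) i j) \<in> borel_measurable M"
  unfolding q_def using Zin_measurable[OF assms] assms by measurable

text \<open>The average of \<open>soft_val\<close> over a Gaussian displacement of scale \<open>s\<close>; as a function of \<open>s\<^sup>2\<close> this
  is a heat semigroup applied to \<open>soft_val\<close>.\<close>
definition mean_soft_val :: "('i \<Rightarrow> 'j \<Rightarrow> 'k::finite \<Rightarrow> real) \<Rightarrow> real \<Rightarrow> ('i \<Rightarrow> 'j \<Rightarrow> real) \<Rightarrow> real" where
  "mean_soft_val c s x = (\<integral>w. soft_val (displace c s w x) \<partial>gauss_space)"

lemma d1_eq: "d1 v x = (\<Sum>i\<in>I. \<Sum>j\<in>J. p x i * q x i j * v i j)"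
  by (simp add: d1_def outer_mean_def inner_mean_def sum_distrib_left mult.assoc)

lemma weights_sum: "(\<Sum>i\<in>I. \<Sum>j\<in>J. p x i * q x i j) = 1"
  by (simp add: q_sum p_sum flip: sum_distrib_left)

lemma d1_field:
  "d1 (gauss_field c w) x = (\<Sum>k\<in>UNIV. (\<Sum>(i,j)\<in>I \<times> J. p x i * q x i j * c i j k) * w k)"
  using mix_field[where A="I \<times> J" and r="\<lambda>i j. p x i * q x i j" and c=c and w=w]
  by (simp add: d1_eq sum.cartesian_product)

lemma mom1_field:
  "i \<in> I \<Longrightarrow> inner_mean x (gauss_field c w) i = (\<Sum>k\<in>UNIV. (\<Sum>(i',j)\<in>{i} \<times> J. q x i' j * c i' j k) * w k)"
  using mix_field[where A="{i} \<times> J" and r="\<lambda>i j. q x i j" and c=c and w=w]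
  by (simp add: inner_mean_def flip: sum.cartesian_product)

text \<open>The Gaussian mean of \<open>d2 (gauss_field c w) x\<close>. It is obtained from the formula for \<open>d2\<close> by
  replacing the square of each linear function of \<open>w\<close> by the sum of its squared coefficients.\<close>
definition mean_d2 :: "('i \<Rightarrow> 'j \<Rightarrow> 'k::finite \<Rightarrow> real) \<Rightarrow> ('i \<Rightarrow> 'j \<Rightarrow> real) \<Rightarrow> real" where
  "mean_d2 c x = \<beta> * ((\<Sum>i\<in>I. p x i * ((\<Sum>j\<in>J. q x i j * (\<Sum>k\<in>UNIV. (c i j k)\<^sup>2))
      - 2 * (\<Sum>k\<in>UNIV. (\<Sum>(i',j)\<in>{i} \<times> J. q x i' j * c i' j k)\<^sup>2)))
      + (\<Sum>k\<in>UNIV. (\<Sum>(i,j)\<in>I \<times> J. p x i * q x i j * c i j k)\<^sup>2))"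

lemma d2_field_integral:
  fixes c :: "'i \<Rightarrow> 'j \<Rightarrow> 'k::finite \<Rightarrow> real"
  shows "has_bochner_integral gauss_space (\<lambda>w. d2 (gauss_field c w) x) (mean_d2 c x)"
proof -
  have e: "d2 (gauss_field c w) x = \<beta> * ((\<Sum>i\<in>I. p x i * ((\<Sum>j\<in>J. q x i j * (\<Sum>k\<in>UNIV. c i j k * w k)\<^sup>2)
      - 2 * (\<Sum>k\<in>UNIV. (\<Sum>(i',j)\<in>{i} \<times> J. q x i' j * c i' j k) * w k)\<^sup>2))
      + (\<Sum>k\<in>UNIV. (\<Sum>(i,j)\<in>I \<times> J. p x i * q x i j * c i j k) * w k)\<^sup>2)" for w
    unfolding d2_def d1_field outer_mean_def
    by (intro arg_cong2[where f="(*)"] arg_cong2[where f="(+)"] refl sum.cong)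
      (simp add: mom1_field, simp add: inner_mean_def gauss_field_def)
  have sq: "has_bochner_integral gauss_space (\<lambda>w. (\<Sum>k\<in>UNIV. a k * w k)\<^sup>2) (\<Sum>k\<in>UNIV. (a k)\<^sup>2)"
    for a :: "'k \<Rightarrow> real"
    unfolding has_bochner_integral_iff by (simp add: integral_linear_sq integrable_linear_sq)
  show ?thesis
    unfolding e mean_d2_def
    by (intro has_bochner_integral_mult_right has_bochner_integral_add has_bochner_integral_sum
        has_bochner_integral_diff sq)
qed

lemma d1_scale: "d1 (\<lambda>i j. s * v i j) x = s * d1 v x"
  by (simp add: d1_eq sum_distrib_left mult_ac)

lemma d2_scale: "d2 (\<lambda>i j. s * v i j) x = s\<^sup>2 * d2 v x"
proof -
  have m: "inner_mean x (\<lambda>i j. (s * v i j) ^ k) i = s ^ k * inner_mean x (\<lambda>i j. v i j ^ k) i" for k i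
    by (simp add: inner_mean_def power_mult_distrib sum_distrib_left mult_ac)
  have "outer_mean x (\<lambda>i. s\<^sup>2 * mom 2 v x i - 2 * (s ^ 1 * mom 1 v x i)\<^sup>2)
      = s\<^sup>2 * outer_mean x (\<lambda>i. mom 2 v x i - 2 * (mom 1 v x i)\<^sup>2)"
    unfolding outer_mean_def sum_distrib_left
    by (intro sum.cong refl) (simp add: power_mult_distrib right_diff_distrib)
  then show ?thesis
    unfolding d2_def d1_scale m by (simp add: power_mult_distrib distrib_left)
qed

lemma d1_field_integral:
  fixes c :: "'i \<Rightarrow> 'j \<Rightarrow> 'k::finite \<Rightarrow> real"
  shows "has_bochner_integral gauss_space (\<lambda>w. d1 (gauss_field c w) x) 0"
  unfolding d1_field has_bochner_integral_iff by (intro conjI integrable_linear integral_linear)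

lemma soft_val_field_integrable:
  fixes c :: "'i \<Rightarrow> 'j \<Rightarrow> 'k::finite \<Rightarrow> real"
  shows "integrable gauss_space (\<lambda>w. soft_val (displace c s w x))"
proof -
  obtain K where K: "K \<ge> 0" "\<And>w i j. i \<in> I \<Longrightarrow> j \<in> J \<Longrightarrow> \<bar>gauss_field c w i j\<bar> \<le> K * radius w"
    using gauss_field_bound[OF finI finJ] by blast
  have "\<bar>soft_val (displace c s w x)\<bar> \<le> \<bar>soft_val x\<bar> + \<bar>s\<bar> * K * radius w" for w
  proof -
    have "\<bar>s * gauss_field c w i j\<bar> \<le> \<bar>s\<bar> * K * radius w" if "i \<in> I" "j \<in> J" for i j
      using mult_left_mono[OF K(2)[OF that, of w], of "\<bar>s\<bar>"] by (simp add: abs_mult mult_ac)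
    then have "\<bar>soft_val (displace c s w x) - soft_val x\<bar> \<le> \<bar>s\<bar> * K * radius w"
      unfolding displace_def by (rule soft_val_lipschitz)
    then show ?thesis by linarith
  qed
  then have *: "norm (soft_val (displace c s w x)) \<le> norm (\<bar>soft_val x\<bar> + \<bar>s\<bar> * K * radius w)" for w
    by (simp add: order_trans[OF _ abs_ge_self])
  have "integrable gauss_space (\<lambda>w :: 'k \<Rightarrow> real. \<bar>soft_val x\<bar> + \<bar>s\<bar> * K * radius w ^ 1)"
    by (intro Bochner_Integration.integrable_add integrable_mult_right integrable_power_radius
        gauss_space.integrable_const)
  then show ?thesis
    by (rule Bochner_Integration.integrable_bound) (simp_all add: *[unfolded real_norm_def])
qed

text \<open>The first-order term averages to zero since the field is centred, and the third-order remainder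
  is at most a multiple of \<open>(s * radius w) ^ 3\<close>, whose mean is finite.\<close>
lemma mean_soft_val_expansion:
  fixes c :: "'i \<Rightarrow> 'j \<Rightarrow> 'k::finite \<Rightarrow> real"
  shows "\<exists>C\<ge>0. \<forall>x. \<forall>s\<ge>0. \<bar>mean_soft_val c s x - soft_val x - s\<^sup>2 / 2 * mean_d2 c x\<bar> \<le> C * s ^ 3"
proof -
  obtain K where K: "K \<ge> 0" "\<And>w i j. i \<in> I \<Longrightarrow> j \<in> J \<Longrightarrow> \<bar>gauss_field c w i j\<bar> \<le> K * radius w"
    using gauss_field_bound[OF finI finJ] by blast
  let ?R = "\<integral>w. radius (w :: 'k \<Rightarrow> real) ^ 3 \<partial>gauss_space"
  let ?C = "4 * \<beta>\<^sup>2 * K ^ 3 * ?R"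
  have "\<bar>mean_soft_val c s x - soft_val x - s\<^sup>2 / 2 * mean_d2 c x\<bar> \<le> ?C * s ^ 3" if "s \<ge> 0" for x s
  proof -
    let ?E = "\<lambda>w. soft_val (displace c s w x) - soft_val x - s * d1 (gauss_field c w) x - s\<^sup>2 / 2 * d2 (gauss_field c w) x"
    have E: "\<bar>?E w\<bar> \<le> 4 * \<beta>\<^sup>2 * K ^ 3 * s ^ 3 * radius w ^ 3" for w
    proof -
      have "\<bar>s * gauss_field c w i j\<bar> \<le> s * K * radius w" if "i \<in> I" "j \<in> J" for i j
        using mult_left_mono[OF K(2)[OF that, of w], of s] \<open>s \<ge> 0\<close> by (simp add: abs_mult mult_ac)
      then have "\<bar>soft_val (\<lambda>i j. x i j + s * gauss_field c w i j) - soft_val x - d1 (\<lambda>i j. s * gauss_field c w i j) x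
         - d2 (\<lambda>i j. s * gauss_field c w i j) x / 2\<bar> \<le> 4 * \<beta>\<^sup>2 * (s * K * radius w) ^ 3"
        by (rule soft_val_taylor3)
      then show ?thesis
        by (simp add: displace_def d1_scale d2_scale power_mult_distrib mult_ac)
    qed
    have I: "integrable gauss_space (\<lambda>w. 4 * \<beta>\<^sup>2 * K ^ 3 * s ^ 3 * radius (w :: 'k \<Rightarrow> real) ^ 3)"
      by (intro integrable_mult_right integrable_power_radius)
    have hE: "has_bochner_integral gauss_space ?E (mean_soft_val c s x - soft_val x - s * 0 - s\<^sup>2 / 2 * mean_d2 c x)"
      unfolding mean_soft_val_def
      by (intro has_bochner_integral_diff has_bochner_integral_mult_right d1_field_integral
          d2_field_integral has_bochner_integral_integrable soft_val_field_integrable)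
        (simp add: has_bochner_integral_iff)
    have iE: "integrable gauss_space ?E" by (rule integrable.intros[OF hE])
    have eq: "mean_soft_val c s x - soft_val x - s\<^sup>2 / 2 * mean_d2 c x = (\<integral>w. ?E w \<partial>gauss_space)"
      using has_bochner_integral_integral_eq[OF hE] by (simp only: mult_zero_right diff_0_right)
    have "\<bar>\<integral>w. ?E w \<partial>gauss_space\<bar> \<le> (\<integral>w. \<bar>?E w\<bar> \<partial>gauss_space)"
      by (rule integral_abs_bound)
    also have "\<dots> \<le> (\<integral>w. 4 * \<beta>\<^sup>2 * K ^ 3 * s ^ 3 * radius (w :: 'k \<Rightarrow> real) ^ 3 \<partial>gauss_space)"
      by (rule integral_mono[OF integrable_abs[OF iE] I E])
    also have "\<dots> = ?C * s ^ 3" by (simp add: mult_ac)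
    finally show ?thesis unfolding eq .
  qed
  moreover have "?C \<ge> 0" using K(1) by (intro mult_nonneg_nonneg Bochner_Integration.integral_nonneg) simp_all
  ultimately show ?thesis by blast
qed

end

section \<open>Comparison of two Gaussian arrays\<close>

text \<open>Gordon's conditions on two Gaussian arrays, up to a constant \<open>\<kappa>\<close> in the covariances. Adding \<open>\<kappa> \<ge> 0\<close>
  to all covariances means adding one common Gaussian variable to all entries, and \<open>soft_val\<close> merely
  passes such a common summand on; the constant therefore does not influence the comparison.\<close>
locale gordon_comparison = soft_minmax I J \<beta> for I :: "'i set" and J :: "'j set" and \<beta> +
  fixes cX :: "'i \<Rightarrow> 'j \<Rightarrow> 'k::finite \<Rightarrow> real" and cY :: "'i \<Rightarrow> 'j \<Rightarrow> 'l::finite \<Rightarrow> real" and \<kappa> :: real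
  assumes var: "\<And>i j. i \<in> I \<Longrightarrow> j \<in> J \<Longrightarrow> (\<Sum>k\<in>UNIV. (cX i j k)\<^sup>2) \<le> 1"
    and cov_same: "\<And>i j j'. i \<in> I \<Longrightarrow> j \<in> J \<Longrightarrow> j' \<in> J \<Longrightarrow>
      (\<Sum>k\<in>UNIV. cX i j k * cX i j' k) + \<kappa> = (\<Sum>k\<in>UNIV. cY i j k * cY i j' k)"
    and cov_diff: "\<And>i i' j j'. i \<in> I \<Longrightarrow> i' \<in> I \<Longrightarrow> j \<in> J \<Longrightarrow> j' \<in> J \<Longrightarrow>
      (\<Sum>k\<in>UNIV. cX i j k * cX i' j' k) + \<kappa> \<ge> (\<Sum>k\<in>UNIV. cY i j k * cY i' j' k)"
begin

text \<open>This inequality is where the sign conditions on the covariances enter. Entries in the same row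
  contribute \<open>- \<kappa>\<close> through the second moments and \<open>+ 2 * \<kappa>\<close> through the squared row means, since the
  weights sum to one and \<open>cov_same\<close> is an equality. The square of the mean over all entries has
  nonnegative weights, so \<open>cov_diff\<close> yields at least \<open>- \<kappa>\<close>. The sum of the three is nonnegative.\<close>
lemma mean_d2_le: "mean_d2 cY x \<le> mean_d2 cX x"
proof -
  let ?r = "\<lambda>i j. p x i * q x i j"
  let ?CX = "\<lambda>i j i' j'. \<Sum>k\<in>UNIV. cX i j k * cX i' j' k"
  let ?CY = "\<lambda>i j i' j'. \<Sum>k\<in>UNIV. cY i j k * cY i' j' k"
  have 1: "(\<Sum>j\<in>J. q x i j * (\<Sum>k\<in>UNIV. (cY i j k)\<^sup>2)) = (\<Sum>j\<in>J. q x i j * (\<Sum>k\<in>UNIV. (cX i j k)\<^sup>2)) + \<kappa>"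
    if "i \<in> I" for i
  proof -
    have "(\<Sum>j\<in>J. q x i j * (\<Sum>k\<in>UNIV. (cY i j k)\<^sup>2)) = (\<Sum>j\<in>J. q x i j * ((\<Sum>k\<in>UNIV. (cX i j k)\<^sup>2) + \<kappa>))"
      using cov_same[OF that] by (intro sum.cong refl) (simp add: power2_eq_square)
    then show ?thesis by (simp add: distrib_left sum.distrib q_sum flip: sum_distrib_right)
  qed
  have 2: "(\<Sum>k\<in>UNIV. (\<Sum>(i',j)\<in>{i} \<times> J. q x i' j * cY i' j k)\<^sup>2)
    = (\<Sum>k\<in>UNIV. (\<Sum>(i',j)\<in>{i} \<times> J. q x i' j * cX i' j k)\<^sup>2) + \<kappa>" if "i \<in> I" for i
  proof -
    have "(\<Sum>(i1,j)\<in>{i} \<times> J. \<Sum>(i',j')\<in>{i} \<times> J. q x i1 j * q x i' j' * ?CY i1 j i' j')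
       = (\<Sum>(i1,j)\<in>{i} \<times> J. \<Sum>(i',j')\<in>{i} \<times> J. q x i1 j * q x i' j' * ?CX i1 j i' j' + q x i1 j * q x i' j' * \<kappa>)"
      using cov_same[OF that] by (intro sum.cong refl) (auto simp flip: distrib_left intro!: sum.cong)
    also have "\<dots> = (\<Sum>(i1,j)\<in>{i} \<times> J. \<Sum>(i',j')\<in>{i} \<times> J. q x i1 j * q x i' j' * ?CX i1 j i' j') + \<kappa>"
    proof -
      have "(\<Sum>a\<in>{i} \<times> J. q x (fst a) (snd a)) = 1"
        using q_sum[of x i] sum.cartesian_product[of "q x" J "{i}"] by (simp add: case_prod_unfold)
      then have "(\<Sum>a\<in>{i} \<times> J. \<Sum>b\<in>{i} \<times> J. q x (fst a) (snd a) * q x (fst b) (snd b) * \<kappa>) = \<kappa>"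
        by (simp flip: sum_distrib_left sum_distrib_right)
      then show ?thesis by (simp only: case_prod_unfold sum.distrib)
    qed
    finally show ?thesis unfolding mix_sq .
  qed
  have 3: "(\<Sum>k\<in>UNIV. (\<Sum>(i,j)\<in>I \<times> J. ?r i j * cY i j k)\<^sup>2)
    \<le> (\<Sum>k\<in>UNIV. (\<Sum>(i,j)\<in>I \<times> J. ?r i j * cX i j k)\<^sup>2) + \<kappa>"
  proof -
    have "(\<Sum>(i,j)\<in>I \<times> J. \<Sum>(i',j')\<in>I \<times> J. ?r i j * ?r i' j' * ?CY i j i' j')
       \<le> (\<Sum>(i,j)\<in>I \<times> J. \<Sum>(i',j')\<in>I \<times> J. ?r i j * ?r i' j' * (?CX i j i' j' + \<kappa>))"
      using cov_diff p_nonneg q_nonneg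
      by (intro sum_mono) (auto intro!: sum_mono mult_left_mono mult_nonneg_nonneg)
    also have "\<dots> = (\<Sum>(i,j)\<in>I \<times> J. \<Sum>(i',j')\<in>I \<times> J. ?r i j * ?r i' j' * ?CX i j i' j')
       + (\<Sum>a\<in>I \<times> J. ?r (fst a) (snd a)) * (\<Sum>b\<in>I \<times> J. ?r (fst b) (snd b)) * \<kappa>"
    proof -
      have "(\<Sum>a\<in>S. \<Sum>b\<in>S. f a * f b * (g a b + \<kappa>)) = (\<Sum>a\<in>S. \<Sum>b\<in>S. f a * f b * g a b) + sum f S * sum f S * \<kappa>"
        for f g and S :: "('i \<times> 'j) set"
        unfolding distrib_left sum.distrib
        by (simp add: sum_distrib_left[symmetric] sum_distrib_right[symmetric])
      then show ?thesis unfolding case_prod_unfold .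
    qed
    also have "(\<Sum>a\<in>I \<times> J. ?r (fst a) (snd a)) = 1"
      using weights_sum[of x] unfolding sum.cartesian_product case_prod_unfold .
    finally show ?thesis unfolding mix_sq by (simp only: mult_1)
  qed
  have 4: "(\<Sum>i\<in>I. p x i * ((\<Sum>j\<in>J. q x i j * (\<Sum>k\<in>UNIV. (cY i j k)\<^sup>2))
      - 2 * (\<Sum>k\<in>UNIV. (\<Sum>(i',j)\<in>{i} \<times> J. q x i' j * cY i' j k)\<^sup>2)))
    = (\<Sum>i\<in>I. p x i * ((\<Sum>j\<in>J. q x i j * (\<Sum>k\<in>UNIV. (cX i j k)\<^sup>2))
      - 2 * (\<Sum>k\<in>UNIV. (\<Sum>(i',j)\<in>{i} \<times> J. q x i' j * cX i' j k)\<^sup>2))) - \<kappa>"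
  proof -
    have gen: "(\<Sum>i\<in>I. p x i * (f' i - 2 * g' i)) = (\<Sum>i\<in>I. p x i * (f i - 2 * g i)) - \<kappa>"
      if "\<And>i. i \<in> I \<Longrightarrow> f' i = f i + \<kappa>" "\<And>i. i \<in> I \<Longrightarrow> g' i = g i + \<kappa>" for f g f' g' :: "'i \<Rightarrow> real"
    proof -
      have "(\<Sum>i\<in>I. p x i * (f' i - 2 * g' i)) = (\<Sum>i\<in>I. p x i * (f i - 2 * g i) - p x i * \<kappa>)"
        using that by (intro sum.cong refl) (simp add: algebra_simps)
      also have "\<dots> = (\<Sum>i\<in>I. p x i * (f i - 2 * g i)) - sum (p x) I * \<kappa>"
        by (simp only: sum_subtractf sum_distrib_right)
      finally show ?thesis by (simp only: p_sum mult_1)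
    qed
    show ?thesis by (rule gen[OF 1 2])
  qed
  have gen: "\<beta> * ((S - \<kappa>) + a) \<le> \<beta> * (S + b)" if "a \<le> b + \<kappa>" for S a b
    using that beta by (intro mult_left_mono) auto
  show ?thesis
    unfolding mean_d2_def 4 by (rule gen[OF 3])
qed

lemma mean_soft_val_compare:
  obtains C where "C \<ge> 0" "\<And>x s. s \<ge> 0 \<Longrightarrow> mean_soft_val cX s x \<ge> mean_soft_val cY s x - C * s ^ 3"
proof -
  obtain C1 where C1: "C1 \<ge> 0" "\<And>x s. s \<ge> 0 \<Longrightarrow> \<bar>mean_soft_val cX s x - soft_val x - s\<^sup>2 / 2 * mean_d2 cX x\<bar> \<le> C1 * s ^ 3"
    using mean_soft_val_expansion[of cX] by blast
  obtain C2 where C2: "C2 \<ge> 0" "\<And>x s. s \<ge> 0 \<Longrightarrow> \<bar>mean_soft_val cY s x - soft_val x - s\<^sup>2 / 2 * mean_d2 cY x\<bar> \<le> C2 * s ^ 3"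
    using mean_soft_val_expansion[of cY] by blast
  show ?thesis
  proof (rule that[of "C1 + C2"])
    fix x and s :: real assume s: "s \<ge> 0"
    have "s\<^sup>2 / 2 * mean_d2 cY x \<le> s\<^sup>2 / 2 * mean_d2 cX x"
      by (intro mult_left_mono mean_d2_le) auto
    then show "mean_soft_val cX s x \<ge> mean_soft_val cY s x - (C1 + C2) * s ^ 3"
      using C1(2)[OF s, of x] C2(2)[OF s, of x] by (simp add: distrib_right)
  qed (use C1 C2 in auto)
qed

end

context soft_minmax
begin

lemma mean_soft_val_measurable [measurable (raw)]:
  fixes c :: "'i \<Rightarrow> 'j \<Rightarrow> 'k::finite \<Rightarrow> real"
  assumes "\<And>i j. (\<lambda>w. g w i j) \<in> borel_measurable M"
  shows "(\<lambda>w. mean_soft_val c s (g w)) \<in> borel_measurable M"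
proof -
  have [measurable]: "(\<lambda>x. g (fst x) i j) \<in> borel_measurable (M \<Otimes>\<^sub>M (gauss_space :: ('k \<Rightarrow> real) measure))" for i j
    by (rule measurable_compose[OF measurable_fst assms])
  have "(\<lambda>x. soft_val (displace c s (snd x) (g (fst x)))) \<in> borel_measurable (M \<Otimes>\<^sub>M (gauss_space :: ('k \<Rightarrow> real) measure))"
    by (intro soft_val_measurable displace_measurable) measurable
  then show ?thesis
    unfolding mean_soft_val_def
    by (intro gauss_space.borel_measurable_lebesgue_integral) (simp add: case_prod_unfold)
qed

text \<open>The average keeps the first-order structure of \<open>soft_val\<close>: the averaged Gibbs weights \<open>\<rho>\<close> are
  again convex, and the quadratic remainder bound survives averaging.\<close>
lemma mean_soft_val_linear:
  fixes c :: "'i \<Rightarrow> 'j \<Rightarrow> 'k::finite \<Rightarrow> real"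
  obtains \<rho> where "\<And>i j. \<rho> i j \<ge> 0" "(\<Sum>(i,j)\<in>I \<times> J. \<rho> i j) = 1"
    "\<And>v M. (\<And>i j. i \<in> I \<Longrightarrow> j \<in> J \<Longrightarrow> \<bar>v i j\<bar> \<le> M) \<Longrightarrow>
       \<bar>mean_soft_val c r (\<lambda>i j. x i j + v i j) - mean_soft_val c r x - (\<Sum>(i,j)\<in>I \<times> J. \<rho> i j * v i j)\<bar> \<le> 2 * \<beta> * M\<^sup>2"
proof -
  let ?y = "\<lambda>w :: 'k \<Rightarrow> real. displace c r w x"
  define \<rho> where "\<rho> i j = (\<integral>w. p (?y w) i * q (?y w) i j \<partial>gauss_space)" for i j
  have I: "integrable gauss_space (\<lambda>w. p (?y w) i * q (?y w) i j)" if "i \<in> I" "j \<in> J" for i j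
  proof (rule gauss_space.integrable_const_bound[of _ 1])
    have "p z i \<le> 1" "q z i j \<le> 1" for z
      using member_le_sum[of i I "p z"] member_le_sum[of j J "q z i"] that finI finJ
      by (simp_all add: p_nonneg q_nonneg p_sum q_sum)
    then show "AE w in gauss_space. norm (p (?y w) i * q (?y w) i j) \<le> 1"
      using p_nonneg q_nonneg by (simp add: abs_mult mult_le_one)
    show "(\<lambda>w. p (?y w) i * q (?y w) i j) \<in> borel_measurable gauss_space"
      by (intro borel_measurable_times p_measurable q_measurable displace_measurable) auto
  qed
  have d1i: "has_bochner_integral gauss_space (\<lambda>w. d1 v (?y w)) (\<Sum>(i,j)\<in>I \<times> J. \<rho> i j * v i j)" for v
    unfolding d1_eq \<rho>_def sum.cartesian_product[symmetric]
    by (intro has_bochner_integral_sum has_bochner_integral_mult_left has_bochner_integral_integrable I)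
  show ?thesis
  proof
    show "\<rho> i j \<ge> 0" for i j
      unfolding \<rho>_def using p_nonneg q_nonneg by (intro Bochner_Integration.integral_nonneg) auto
    have "(\<Sum>(i,j)\<in>I \<times> J. \<rho> i j * 1) = (\<integral>w. d1 (\<lambda>_ _. 1) (?y w) \<partial>gauss_space)"
      using has_bochner_integral_integral_eq[OF d1i[of "\<lambda>_ _. 1"]] by simp
    also have "\<dots> = 1" by (simp add: d1_eq weights_sum)
    finally show "(\<Sum>(i,j)\<in>I \<times> J. \<rho> i j) = 1" by simp
    fix v :: "'i \<Rightarrow> 'j \<Rightarrow> real" and M assume M: "\<And>i j. i \<in> I \<Longrightarrow> j \<in> J \<Longrightarrow> \<bar>v i j\<bar> \<le> M"
    let ?E = "\<lambda>w. soft_val (\<lambda>i j. ?y w i j + v i j) - soft_val (?y w) - d1 v (?y w)"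
    have h: "has_bochner_integral gauss_space ?E
       (mean_soft_val c r (\<lambda>i j. x i j + v i j) - mean_soft_val c r x - (\<Sum>(i,j)\<in>I \<times> J. \<rho> i j * v i j))"
      unfolding mean_soft_val_def displace_add[symmetric]
      by (intro has_bochner_integral_diff d1i has_bochner_integral_integrable soft_val_field_integrable)
    have "\<bar>\<integral>w. ?E w \<partial>gauss_space\<bar> \<le> (\<integral>w. \<bar>?E w\<bar> \<partial>gauss_space)"
      by (rule integral_abs_bound)
    also have "\<dots> \<le> (\<integral>w. 2 * \<beta> * M\<^sup>2 \<partial>(gauss_space :: ('k \<Rightarrow> real) measure))"
      by (rule integral_mono[OF integrable_abs[OF integrable.intros[OF h]] gauss_space.integrable_const soft_val_taylor2[OF M]])
    finally show "\<bar>mean_soft_val c r (\<lambda>i j. x i j + v i j) - mean_soft_val c r x - (\<Sum>(i,j)\<in>I \<times> J. \<rho> i j * v i j)\<bar> \<le> 2 * \<beta> * M\<^sup>2"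
      unfolding has_bochner_integral_integral_eq[OF h] by simp
  qed
qed

lemma mean_soft_val_lipschitz:
  fixes c :: "'i \<Rightarrow> 'j \<Rightarrow> 'k::finite \<Rightarrow> real"
  assumes M: "\<And>i j. i \<in> I \<Longrightarrow> j \<in> J \<Longrightarrow> \<bar>v i j\<bar> \<le> M"
  shows "\<bar>mean_soft_val c r (\<lambda>i j. x i j + v i j) - mean_soft_val c r x\<bar> \<le> M"
proof -
  let ?E = "\<lambda>w. soft_val (\<lambda>i j. displace c r w x i j + v i j) - soft_val (displace c r w x)"
  have h: "has_bochner_integral gauss_space ?E (mean_soft_val c r (\<lambda>i j. x i j + v i j) - mean_soft_val c r x)"
    unfolding mean_soft_val_def displace_add[symmetric]
    by (intro has_bochner_integral_diff has_bochner_integral_integrable soft_val_field_integrable)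
  have "\<bar>\<integral>w. ?E w \<partial>gauss_space\<bar> \<le> (\<integral>w. \<bar>?E w\<bar> \<partial>gauss_space)"
    by (rule integral_abs_bound)
  also have "\<dots> \<le> (\<integral>w. M \<partial>(gauss_space :: ('k \<Rightarrow> real) measure))"
    by (rule integral_mono[OF integrable_abs[OF integrable.intros[OF h]] gauss_space.integrable_const soft_val_lipschitz[OF M]])
  finally show ?thesis
    unfolding has_bochner_integral_integral_eq[OF h] by simp
qed

lemma soft_val_shift_bound:
  assumes "s \<ge> 0" "\<And>w i j. i \<in> I \<Longrightarrow> j \<in> J \<Longrightarrow> \<bar>gauss_field c w i j\<bar> \<le> K * radius w"
  shows "\<bar>soft_val (displace c s w x)\<bar> \<le> \<bar>soft_val x\<bar> + s * K * radius w"
proof -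
  have "\<bar>soft_val (displace c s w x) - soft_val x\<bar> \<le> s * K * radius w"
    unfolding displace_def using assms by (intro soft_val_lipschitz gauss_field_scaled_bound)
  then show ?thesis by linarith
qed

lemma mean_soft_val_shift_bound:
  assumes "s \<ge> 0" "\<And>w i j. i \<in> I \<Longrightarrow> j \<in> J \<Longrightarrow> \<bar>gauss_field c w i j\<bar> \<le> K * radius w"
  shows "\<bar>mean_soft_val c' r (displace c s w x) - mean_soft_val c' r x\<bar> \<le> s * K * radius w"
  unfolding displace_def using assms by (intro mean_soft_val_lipschitz gauss_field_scaled_bound)

lemma mean_soft_val_shift_integrable:
  fixes c :: "'i \<Rightarrow> 'j \<Rightarrow> 'k::finite \<Rightarrow> real"
  assumes "s \<ge> 0"
  shows "integrable gauss_space (\<lambda>w. mean_soft_val c' r (displace c s w x))"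
    and "integrable gauss_space (\<lambda>w. exp (a * mean_soft_val c' r (displace c s w x)))"
proof -
  obtain K where K: "K \<ge> 0" "\<And>w i j. i \<in> I \<Longrightarrow> j \<in> J \<Longrightarrow> \<bar>gauss_field c w i j\<bar> \<le> K * radius w"
    using gauss_field_bound[OF finI finJ] by blast
  have b: "\<bar>mean_soft_val c' r (displace c s w x)\<bar> \<le> \<bar>mean_soft_val c' r x\<bar> + s * K * radius w" for w
    using mean_soft_val_shift_bound[OF assms K(2), of c' r w x] by linarith
  have m: "(\<lambda>w. mean_soft_val c' r (displace c s w x)) \<in> borel_measurable gauss_space"
    by (intro mean_soft_val_measurable displace_measurable) auto
  show "integrable gauss_space (\<lambda>w. mean_soft_val c' r (displace c s w x))"
    by (rule Bochner_Integration.integrable_bound[OF integrable_radius[of "\<bar>mean_soft_val c' r x\<bar>" "s * K"] m])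
      (intro AE_I2, use b in \<open>simp add: order_trans[OF b abs_ge_self]\<close>)
  show "integrable gauss_space (\<lambda>w. exp (a * mean_soft_val c' r (displace c s w x)))"
  proof (rule Bochner_Integration.integrable_bound)
    show "integrable gauss_space (\<lambda>w :: 'k \<Rightarrow> real. exp (\<bar>a\<bar> * \<bar>mean_soft_val c' r x\<bar>) * exp ((\<bar>a\<bar> * s * K) * radius w))"
      by (intro integrable_mult_right integrable_exp_radius)
    show "(\<lambda>w. exp (a * mean_soft_val c' r (displace c s w x))) \<in> borel_measurable gauss_space"
      using m by measurable
    have "a * mean_soft_val c' r (displace c s w x) \<le> \<bar>a\<bar> * \<bar>mean_soft_val c' r x\<bar> + (\<bar>a\<bar> * s * K) * radius w" for w
    proof -
      have "a * mean_soft_val c' r (displace c s w x) \<le> \<bar>a\<bar> * \<bar>mean_soft_val c' r (displace c s w x)\<bar>"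
        by (metis abs_ge_self abs_mult)
      also have "\<dots> \<le> \<bar>a\<bar> * (\<bar>mean_soft_val c' r x\<bar> + s * K * radius w)"
        using b by (intro mult_left_mono) auto
      finally show ?thesis by (simp add: algebra_simps)
    qed
    then show "AE w in gauss_space. norm (exp (a * mean_soft_val c' r (displace c s w x)))
      \<le> norm (exp (\<bar>a\<bar> * \<bar>mean_soft_val c' r x\<bar>) * exp ((\<bar>a\<bar> * s * K) * radius w))"
      by (intro AE_I2) (simp flip: exp_add)
  qed
qed

text \<open>Displacements commute, so the two averages may be exchanged. The integrand grows at most linearly
  in the two radii and Fubini's theorem applies.\<close>
lemma mean_soft_val_swap:
  fixes c :: "'i \<Rightarrow> 'j \<Rightarrow> 'k::finite \<Rightarrow> real" and c' :: "'i \<Rightarrow> 'j \<Rightarrow> 'l::finite \<Rightarrow> real"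
  assumes "r \<ge> 0" "s \<ge> 0"
  shows "(\<integral>z. mean_soft_val c' r (displace c s z y) \<partial>gauss_space) = (\<integral>w. mean_soft_val c s (displace c' r w y) \<partial>gauss_space)"
proof -
  let ?G = "gauss_space :: ('k \<Rightarrow> real) measure" and ?H = "gauss_space :: ('l \<Rightarrow> real) measure"
  interpret pair_prob_space ?G ?H by unfold_locales
  obtain K where K: "K \<ge> 0" "\<And>w i j. i \<in> I \<Longrightarrow> j \<in> J \<Longrightarrow> \<bar>gauss_field c w i j\<bar> \<le> K * radius w"
    using gauss_field_bound[OF finI finJ] by blast
  obtain K' where K': "K' \<ge> 0" "\<And>w i j. i \<in> I \<Longrightarrow> j \<in> J \<Longrightarrow> \<bar>gauss_field c' w i j\<bar> \<le> K' * radius w"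
    using gauss_field_bound[OF finI finJ] by blast
  have comm: "displace c' r w (displace c s z y) = displace c s z (displace c' r w y)" for w z
    by (simp add: displace_def fun_eq_iff)
  have m: "(\<lambda>(z, w). soft_val (displace c' r w (displace c s z y))) \<in> borel_measurable (?G \<Otimes>\<^sub>M ?H)"
    unfolding case_prod_unfold by (intro soft_val_measurable displace_measurable) measurable
  have I: "integrable (?G \<Otimes>\<^sub>M ?H) (\<lambda>(z, w). soft_val (displace c' r w (displace c s z y)))"
  proof (rule Bochner_Integration.integrable_bound[OF _ m])
    show "integrable (?G \<Otimes>\<^sub>M ?H) (\<lambda>(z, w). \<bar>soft_val y\<bar> + s * K * radius z + r * K' * radius w)"
    proof (rule Fubini_integrable)
      show "integrable ?G (\<lambda>z. \<integral>w. norm (case (z, w) of (z, w) \<Rightarrow> \<bar>soft_val y\<bar> + s * K * radius z + r * K' * radius w) \<partial>?H)"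
        using assms K(1) K'(1) integrable_power_radius[of 1, where 'k='k] integrable_power_radius[of 1, where 'k='l]
        by (simp add: abs_of_nonneg)
      show "AE z in ?G. integrable ?H (\<lambda>w. case (z, w) of (z, w) \<Rightarrow> \<bar>soft_val y\<bar> + s * K * radius z + r * K' * radius w)"
        using integrable_radius[where 'k='l] by (intro AE_I2) simp
    qed measurable
    have "\<bar>soft_val (displace c' r w (displace c s z y))\<bar> \<le> \<bar>soft_val y\<bar> + s * K * radius z + r * K' * radius w" for z w
      using soft_val_shift_bound[OF assms(1) K'(2), of w "displace c s z y"] soft_val_shift_bound[OF assms(2) K(2), of z y] by linarith
    then show "AE x in ?G \<Otimes>\<^sub>M ?H. norm (case x of (z, w) \<Rightarrow> soft_val (displace c' r w (displace c s z y)))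
      \<le> norm (case x of (z, w) \<Rightarrow> \<bar>soft_val y\<bar> + s * K * radius z + r * K' * radius w)"
      by (intro AE_I2) (auto intro: order_trans[OF _ abs_ge_self])
  qed
  from Fubini_integral[OF I] show ?thesis
    unfolding mean_soft_val_def comm ..
qed

lemma mean_soft_val_semigroup:
  assumes "r \<ge> 0" "s \<ge> 0" "t \<ge> 0" "t\<^sup>2 = r\<^sup>2 + s\<^sup>2"
  shows "(\<integral>w. mean_soft_val c s (displace c r w y) \<partial>gauss_space) = mean_soft_val c t y"
proof -
  have m: "(\<lambda>w. soft_val (displace c 1 w y)) \<in> borel_measurable gauss_space"
    by (intro soft_val_measurable displace_measurable) measurable
  have "soft_val (displace c s z (displace c r w y)) = soft_val (displace c 1 (\<lambda>k. r * w k + s * z k) y)" for w z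
    by (simp add: displace_def gauss_field_linear add.assoc)
  moreover have "displace c 1 (\<lambda>k. t * w k) y = displace c t w y" for w
    by (simp add: displace_def gauss_field_scale)
  ultimately show ?thesis
    unfolding mean_soft_val_def
    using integral_gauss_space_stable[OF assms(1,2,3,4) m] soft_val_field_integrable[of c t y] by simp
qed

lemma exp_shift_semigroup:
  assumes "r \<ge> 0" "s \<ge> 0" "t \<ge> 0" "t\<^sup>2 = r\<^sup>2 + s\<^sup>2"
  shows "(\<integral>w. (\<integral>z. exp (a * mean_soft_val c' r' (displace c s z (displace c r w y))) \<partial>gauss_space) \<partial>gauss_space)
    = (\<integral>w. exp (a * mean_soft_val c' r' (displace c t w y)) \<partial>gauss_space)"
proof -
  have m: "(\<lambda>w. exp (a * mean_soft_val c' r' (displace c 1 w y))) \<in> borel_measurable gauss_space"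
  proof -
    have [measurable]: "(\<lambda>w. mean_soft_val c' r' (displace c 1 w y)) \<in> borel_measurable gauss_space"
      by (intro mean_soft_val_measurable displace_measurable) measurable
    show ?thesis by measurable
  qed
  have "displace c s z (displace c r w y) = displace c 1 (\<lambda>k. r * w k + s * z k) y" for w z
    by (simp add: displace_def gauss_field_linear add.assoc)
  moreover have "displace c 1 (\<lambda>k. t * w k) y = displace c t w y" for w
    by (simp add: displace_def gauss_field_scale)
  ultimately show ?thesis
    using integral_gauss_space_stable[OF assms(1,2,3,4) m] mean_soft_val_shift_integrable(2)[OF assms(3), of a c' r' c y] by simp
qed

end

lemma exp_le_cubic: "exp (x::real) \<le> 1 + x + x\<^sup>2 / 2 + \<bar>x\<bar> ^ 3 * exp \<bar>x\<bar> / 6"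
proof -
  obtain t where t: "\<bar>t\<bar> \<le> \<bar>x\<bar>" "exp x = (\<Sum>m<3. x ^ m / fact m) + exp t / fact 3 * x ^ 3"
    using Maclaurin_exp_le[of x 3] by blast
  have "exp t * x ^ 3 \<le> exp t * \<bar>x\<bar> ^ 3"
    by (intro mult_left_mono) (auto simp flip: power_abs)
  also have "\<dots> \<le> exp \<bar>x\<bar> * \<bar>x\<bar> ^ 3"
    using t(1) by (intro mult_right_mono) auto
  finally have "exp t * x ^ 3 \<le> exp \<bar>x\<bar> * \<bar>x\<bar> ^ 3" .
  then have "exp t / fact 3 * x ^ 3 \<le> \<bar>x\<bar> ^ 3 * exp \<bar>x\<bar> / 6"
    by (simp add: fact_numeral mult.commute)
  then show ?thesis unfolding t(2) by (simp add: numeral_3_eq_3 power2_eq_square)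
qed

context gordon_comparison
begin

text \<open>Convexity of the square, applied to each coordinate of the coefficient vectors.\<close>
lemma mixture_variance:
  assumes "\<And>i j. \<rho> i j \<ge> 0" "(\<Sum>(i,j)\<in>I \<times> J. \<rho> i j) = 1"
  shows "(\<integral>w. (\<Sum>(i,j)\<in>I \<times> J. \<rho> i j * gauss_field cX w i j)\<^sup>2 \<partial>gauss_space) \<le> 1"
proof -
  have "(\<Sum>k\<in>UNIV. (\<Sum>(i,j)\<in>I \<times> J. \<rho> i j * cX i j k)\<^sup>2)
    \<le> (\<Sum>k\<in>UNIV. \<Sum>(i,j)\<in>I \<times> J. \<rho> i j * (cX i j k)\<^sup>2)"
    unfolding case_prod_unfold
    using assms by (intro sum_mono convex_sq_le) (auto simp: case_prod_unfold)
  also have "\<dots> = (\<Sum>(i,j)\<in>I \<times> J. \<rho> i j * (\<Sum>k\<in>UNIV. (cX i j k)\<^sup>2))"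
    unfolding case_prod_unfold by (subst sum.swap) (simp add: sum_distrib_left)
  also have "\<dots> \<le> (\<Sum>(i,j)\<in>I \<times> J. \<rho> i j * 1)"
    using assms var by (intro sum_mono) (auto intro!: mult_left_le)
  also have "\<dots> = 1" using assms by simp
  finally show ?thesis unfolding mix_field integral_linear_sq .
qed

text \<open>The price of moving a small Gaussian average out of the exponential. The increment of the averaged
  function is \<open>s\<close> times a convex mixture \<open>l\<close> of the field plus a term of order \<open>s\<^sup>2\<close>. Expanding the
  exponential, the mean of the increment appears to first order, \<open>\<tau>\<^sup>2 * s\<^sup>2 / 2\<close> times the variance of
  \<open>l\<close> to second order, and everything else is of order \<open>s ^ 3\<close> with an integrable factor. This is the
  infinitesimal form of Gaussian concentration with the optimal constant.\<close>
lemma exp_step: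
  assumes "\<tau> \<ge> 0"
  shows "\<exists>C\<ge>0. \<forall>x r. \<forall>s\<in>{0..1}.
    (\<integral>w. exp (- \<tau> * mean_soft_val cY r (displace cX s w x)) \<partial>gauss_space)
      \<le> exp (- \<tau> * (\<integral>w. mean_soft_val cY r (displace cX s w x) \<partial>gauss_space) + \<tau>\<^sup>2 * s\<^sup>2 / 2 + C * s ^ 3)"
proof -
  obtain K where K: "K \<ge> 0" "\<And>w i j. i \<in> I \<Longrightarrow> j \<in> J \<Longrightarrow> \<bar>gauss_field cX w i j\<bar> \<le> K * radius w"
    using gauss_field_bound[OF finI finJ] by blast
  define B where "B w = 2 * \<tau>\<^sup>2 * \<beta> * K ^ 3 * radius w ^ 3
     + \<tau> ^ 3 * K ^ 3 / 6 * (radius w ^ 3 * exp (\<tau> * K * radius w))" for w :: "'k \<Rightarrow> real"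
  define C where "C = (\<integral>w. B w \<partial>gauss_space)"
  have B0: "B w \<ge> 0" for w
    unfolding B_def using K(1) assms beta by (intro add_nonneg_nonneg mult_nonneg_nonneg) auto
  have Bi: "integrable gauss_space B"
    unfolding B_def using K(1) assms
    by (intro Bochner_Integration.integrable_add integrable_mult_right integrable_power_radius integrable_power_exp_radius) auto
  have C0: "C \<ge> 0" unfolding C_def using B0 by (intro Bochner_Integration.integral_nonneg) auto
  have "(\<integral>w. exp (- \<tau> * mean_soft_val cY r (displace cX s w x)) \<partial>gauss_space)
      \<le> exp (- \<tau> * (\<integral>w. mean_soft_val cY r (displace cX s w x) \<partial>gauss_space) + \<tau>\<^sup>2 * s\<^sup>2 / 2 + C * s ^ 3)"
    if s: "0 \<le> s" "s \<le> 1" for x r s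
  proof -
    obtain \<rho> where \<rho>: "\<And>i j. \<rho> i j \<ge> 0" "(\<Sum>(i,j)\<in>I \<times> J. \<rho> i j) = 1"
      "\<And>v M. (\<And>i j. i \<in> I \<Longrightarrow> j \<in> J \<Longrightarrow> \<bar>v i j\<bar> \<le> M) \<Longrightarrow>
       \<bar>mean_soft_val cY r (\<lambda>i j. x i j + v i j) - mean_soft_val cY r x - (\<Sum>(i,j)\<in>I \<times> J. \<rho> i j * v i j)\<bar> \<le> 2 * \<beta> * M\<^sup>2"
      by (rule mean_soft_val_linear[of cY r x]) blast
    define u where "u = mean_soft_val cY r x"
    define Z where "Z w = mean_soft_val cY r (displace cX s w x) - u" for w
    define l where "l w = (\<Sum>(i,j)\<in>I \<times> J. \<rho> i j * gauss_field cX w i j)" for w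
    have Zb: "\<bar>Z w\<bar> \<le> s * K * radius w" for w
      unfolding Z_def u_def using s K(2) by (intro mean_soft_val_shift_bound) auto
    have Zl: "\<bar>Z w - s * l w\<bar> \<le> 2 * \<beta> * (s * K * radius w)\<^sup>2" for w
    proof -
      have "(\<Sum>(i,j)\<in>I \<times> J. \<rho> i j * (s * gauss_field cX w i j)) = s * l w"
        unfolding l_def case_prod_unfold by (simp add: sum_distrib_left mult_ac)
      then show ?thesis
        unfolding Z_def u_def displace_def
        using \<rho>(3)[of "\<lambda>i j. s * gauss_field cX w i j" "s * K * radius w"] gauss_field_scaled_bound[OF s(1) K(2)] by simp
    qed
    have lb: "\<bar>l w\<bar> \<le> K * radius w" for w
    proof -
      have "\<bar>l w\<bar> \<le> (\<Sum>(i,j)\<in>I \<times> J. \<rho> i j * (K * radius w))"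
        unfolding l_def case_prod_unfold
        by (intro order_trans[OF sum_abs] sum_mono) (auto simp: abs_mult \<rho>(1) intro!: mult_left_mono K(2))
      also have "\<dots> = K * radius w"
        using \<rho>(2) unfolding case_prod_unfold by (simp flip: sum_distrib_right)
      finally show ?thesis .
    qed
    have sq: "(Z w)\<^sup>2 \<le> s\<^sup>2 * (l w)\<^sup>2 + s ^ 3 * (4 * \<beta> * K ^ 3 * radius w ^ 3)" for w
    proof -
      have "\<bar>s * l w\<bar> \<le> s * K * radius w"
        using mult_left_mono[OF lb[of w] s(1)] s(1) by (simp add: abs_mult mult_ac)
      then have "\<bar>Z w + s * l w\<bar> \<le> 2 * (s * K * radius w)" using Zb[of w] by linarith
      then have "\<bar>Z w - s * l w\<bar> * \<bar>Z w + s * l w\<bar> \<le> (2 * \<beta> * (s * K * radius w)\<^sup>2) * (2 * (s * K * radius w))"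
        using Zl[of w] beta by (intro mult_mono) auto
      also have "\<dots> = s ^ 3 * (4 * \<beta> * K ^ 3 * radius w ^ 3)"
        by (simp add: power2_eq_square power3_eq_cube)
      finally have "(Z w - s * l w) * (Z w + s * l w) \<le> s ^ 3 * (4 * \<beta> * K ^ 3 * radius w ^ 3)"
        unfolding abs_mult[symmetric] by linarith
      then show ?thesis by (simp add: power2_eq_square algebra_simps)
    qed
    have pt: "exp (- \<tau> * Z w) \<le> 1 - \<tau> * Z w + (\<tau>\<^sup>2 * s\<^sup>2 / 2) * (l w)\<^sup>2 + s ^ 3 * B w" for w
    proof -
      have a: "\<bar>- \<tau> * Z w\<bar> \<le> \<tau> * (s * K * radius w)"
        using mult_left_mono[OF Zb[of w] assms] assms by (simp add: abs_mult)
      also have le: "\<tau> * (s * K * radius w) \<le> \<tau> * K * radius w"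
        using assms K(1) s mult_right_mono[OF s(2), of "\<tau> * (K * radius w)"] by (simp add: mult_ac)
      finally have a2: "\<bar>- \<tau> * Z w\<bar> \<le> \<tau> * K * radius w" .
      have "\<bar>- \<tau> * Z w\<bar> ^ 3 * exp \<bar>- \<tau> * Z w\<bar> \<le> (\<tau> * (s * K * radius w)) ^ 3 * exp (\<tau> * K * radius w)"
        using a a2 assms s K(1) by (intro mult_mono power_mono) auto
      also have "\<dots> = s ^ 3 * (\<tau> ^ 3 * K ^ 3 * (radius w ^ 3 * exp (\<tau> * K * radius w)))"
        by (simp add: power_mult_distrib mult_ac)
      finally have 3: "\<bar>- \<tau> * Z w\<bar> ^ 3 * exp \<bar>- \<tau> * Z w\<bar> / 6
         \<le> s ^ 3 * (\<tau> ^ 3 * K ^ 3 * (radius w ^ 3 * exp (\<tau> * K * radius w))) / 6" by simp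
      have "(- \<tau> * Z w)\<^sup>2 / 2 \<le> \<tau>\<^sup>2 / 2 * (s\<^sup>2 * (l w)\<^sup>2 + s ^ 3 * (4 * \<beta> * K ^ 3 * radius w ^ 3))"
        using mult_left_mono[OF sq[of w], of "\<tau>\<^sup>2 / 2"] by (simp add: power_mult_distrib)
      then have "exp (- \<tau> * Z w) \<le> 1 + - \<tau> * Z w + \<tau>\<^sup>2 / 2 * (s\<^sup>2 * (l w)\<^sup>2 + s ^ 3 * (4 * \<beta> * K ^ 3 * radius w ^ 3))
         + s ^ 3 * (\<tau> ^ 3 * K ^ 3 * (radius w ^ 3 * exp (\<tau> * K * radius w))) / 6"
        using exp_le_cubic[of "- \<tau> * Z w"] 3 by linarith
      also have "\<dots> = 1 - \<tau> * Z w + (\<tau>\<^sup>2 * s\<^sup>2 / 2) * (l w)\<^sup>2 + s ^ 3 * B w"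
        unfolding B_def by (simp add: algebra_simps)
      finally show ?thesis .
    qed
    have ui: "integrable gauss_space (\<lambda>w. mean_soft_val cY r (displace cX s w x))"
      by (rule mean_soft_val_shift_integrable(1)[OF s(1)])
    have Zi: "integrable gauss_space Z"
      unfolding Z_def by (intro Bochner_Integration.integrable_diff ui gauss_space.integrable_const)
    have EZ: "(\<integral>w. Z w \<partial>gauss_space) = (\<integral>w. mean_soft_val cY r (displace cX s w x) \<partial>gauss_space) - u"
      unfolding Z_def by (subst Bochner_Integration.integral_diff[OF ui gauss_space.integrable_const]) simp
    have li: "integrable gauss_space (\<lambda>w. (l w)\<^sup>2)"
      unfolding l_def mix_field by (rule integrable_linear_sq)
    have El: "(\<integral>w. (l w)\<^sup>2 \<partial>gauss_space) \<le> 1"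
      unfolding l_def by (rule mixture_variance[OF \<rho>(1,2)])
    have eq: "exp (- \<tau> * mean_soft_val cY r (displace cX s w x)) = exp (- \<tau> * u) * exp (- \<tau> * Z w)" for w
      unfolding Z_def by (simp add: algebra_simps flip: exp_add)
    have "integrable gauss_space (\<lambda>w. exp (\<tau> * u) * exp (- \<tau> * mean_soft_val cY r (displace cX s w x)))"
      by (intro integrable_mult_right mean_soft_val_shift_integrable(2) s)
    then have ei: "integrable gauss_space (\<lambda>w. exp (- \<tau> * Z w))"
      unfolding eq by (simp add: mult.assoc[symmetric] flip: exp_add)
    have "(\<integral>w. exp (- \<tau> * Z w) \<partial>gauss_space)
      \<le> (\<integral>w. 1 - \<tau> * Z w + (\<tau>\<^sup>2 * s\<^sup>2 / 2) * (l w)\<^sup>2 + s ^ 3 * B w \<partial>gauss_space)"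
      by (intro integral_mono ei Bochner_Integration.integrable_add Bochner_Integration.integrable_diff
          integrable_mult_right gauss_space.integrable_const Zi li Bi pt)
    also have "\<dots> = 1 - \<tau> * (\<integral>w. Z w \<partial>gauss_space) + (\<tau>\<^sup>2 * s\<^sup>2 / 2) * (\<integral>w. (l w)\<^sup>2 \<partial>gauss_space) + s ^ 3 * C"
      unfolding C_def by (simp add: Zi li Bi)
    also have "\<dots> \<le> 1 - \<tau> * (\<integral>w. Z w \<partial>gauss_space) + (\<tau>\<^sup>2 * s\<^sup>2 / 2) * 1 + s ^ 3 * C"
      using El by (intro add_mono mult_left_mono order_refl) auto
    also have "\<dots> = 1 + (- \<tau> * (\<integral>w. Z w \<partial>gauss_space) + \<tau>\<^sup>2 * s\<^sup>2 / 2 + C * s ^ 3)"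
      by simp
    also have "\<dots> \<le> exp (- \<tau> * (\<integral>w. Z w \<partial>gauss_space) + \<tau>\<^sup>2 * s\<^sup>2 / 2 + C * s ^ 3)"
      by (rule exp_ge_add_one_self)
    finally have "exp (- \<tau> * u) * (\<integral>w. exp (- \<tau> * Z w) \<partial>gauss_space)
       \<le> exp (- \<tau> * u) * exp (- \<tau> * (\<integral>w. Z w \<partial>gauss_space) + \<tau>\<^sup>2 * s\<^sup>2 / 2 + C * s ^ 3)"
      by (intro mult_left_mono) auto
    also have "\<dots> = exp (- \<tau> * (\<integral>w. mean_soft_val cY r (displace cX s w x) \<partial>gauss_space) + \<tau>\<^sup>2 * s\<^sup>2 / 2 + C * s ^ 3)"
      unfolding EZ exp_add[symmetric] by (simp add: algebra_simps)
    finally show ?thesis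
      unfolding eq integral_mult_right_zero .
  qed
  with C0 show ?thesis by (intro exI[of _ C]) auto
qed

text \<open>The path from \<open>exp (- \<tau> * E (soft_val Y))\<close> to \<open>E (exp (- \<tau> * soft_val X))\<close> at time \<open>k / N\<close>: the
  part of the randomness that comes from \<open>X\<close> is averaged outside of the exponential, and the part
  from \<open>Y\<close> inside.\<close>
definition interpolant :: "real \<Rightarrow> nat \<Rightarrow> nat \<Rightarrow> real" where
  "interpolant \<tau> N k = (\<integral>w. exp (- \<tau> * mean_soft_val cY (sqrt (1 - real k / real N))
      (displace cX (sqrt (real k / real N)) w (\<lambda>_ _. 0))) \<partial>gauss_space)"

text \<open>One step of size \<open>1 / N\<close> replaces an average over \<open>Y\<close> inside of the exponential by an average over
  \<open>X\<close> outside. Replacing \<open>Y\<close> by \<open>X\<close> inside lowers the mean by at most a term of order \<open>s ^ 3\<close>, by the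
  comparison of curvatures; moving the average outside is \<open>exp_step\<close>.\<close>
lemma interpolant_step:
  assumes "\<tau> \<ge> 0"
  shows "\<exists>C\<ge>0. \<forall>N k. k < N \<longrightarrow>
    interpolant \<tau> N (Suc k) \<le> interpolant \<tau> N k * exp (\<tau>\<^sup>2 / 2 / real N + C * sqrt (1 / real N) ^ 3)"
proof -
  obtain C1 where C1: "C1 \<ge> 0" "\<And>x s. s \<ge> 0 \<Longrightarrow> mean_soft_val cX s x \<ge> mean_soft_val cY s x - C1 * s ^ 3"
    using mean_soft_val_compare by blast
  obtain C2 where C2: "C2 \<ge> 0" "\<And>x r s. 0 \<le> s \<Longrightarrow> s \<le> 1 \<Longrightarrow>
    (\<integral>w. exp (- \<tau> * mean_soft_val cY r (displace cX s w x)) \<partial>gauss_space)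
      \<le> exp (- \<tau> * (\<integral>w. mean_soft_val cY r (displace cX s w x) \<partial>gauss_space) + \<tau>\<^sup>2 * s\<^sup>2 / 2 + C2 * s ^ 3)"
    using exp_step[OF assms] by (metis atLeastAtMost_iff)
  define C where "C = \<tau> * C1 + C2"
  have "interpolant \<tau> N (Suc k) \<le> interpolant \<tau> N k * exp (\<tau>\<^sup>2 / 2 / real N + C * sqrt (1 / real N) ^ 3)"
    if "k < N" for N k
  proof -
    define s where "s = sqrt (1 / real N)"
    define t where "t = sqrt (real k / real N)"
    define t' where "t' = sqrt (real (Suc k) / real N)"
    \<comment> \<open>The outer and inner scales are \<open>t\<close> and \<open>r'\<close> before the step, \<open>t'\<close> and \<open>r\<close> after it.\<close>
    define r where "r = sqrt (1 - real (Suc k) / real N)"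
    define r' where "r' = sqrt (1 - real k / real N)"
    have N: "real N > 0" using that by simp
    have pos: "s \<ge> 0" "s \<le> 1" "t \<ge> 0" "t' \<ge> 0" "r \<ge> 0" "r' \<ge> 0"
      using that by (auto simp: s_def t_def t'_def r_def r'_def field_simps)
    have s2: "s\<^sup>2 = 1 / real N" unfolding s_def by simp
    have tt: "t'\<^sup>2 = t\<^sup>2 + s\<^sup>2" unfolding t'_def t_def s2 by (simp add: add_divide_distrib add.commute)
    have rr: "r'\<^sup>2 = r\<^sup>2 + s\<^sup>2"
      using that unfolding r'_def r_def s2 by (simp add: field_simps)
    have low: "(\<integral>z. mean_soft_val cY r (displace cX s z y) \<partial>gauss_space) \<ge> mean_soft_val cY r' y - C1 * s ^ 3" for y
    proof -
      have "mean_soft_val cY r' y - C1 * s ^ 3 = (\<integral>w. mean_soft_val cY s (displace cY r w y) - C1 * s ^ 3 \<partial>gauss_space)"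
        using mean_soft_val_semigroup[OF pos(5,1,6) rr, of cY y] mean_soft_val_shift_integrable(1)[OF pos(5), of cY s cY y]
        by simp
      also have "\<dots> \<le> (\<integral>w. mean_soft_val cX s (displace cY r w y) \<partial>gauss_space)"
        by (intro integral_mono Bochner_Integration.integrable_diff mean_soft_val_shift_integrable(1) pos
            gauss_space.integrable_const C1(2))
      also have "\<dots> = (\<integral>z. mean_soft_val cY r (displace cX s z y) \<partial>gauss_space)"
        using mean_soft_val_swap[OF pos(5,1), of cY cX y] by simp
      finally show ?thesis .
    qed
    let ?e = "\<tau>\<^sup>2 * s\<^sup>2 / 2 + C * s ^ 3"
    let ?y = "\<lambda>w. displace cX t w (\<lambda>_ _. 0)"
    have "interpolant \<tau> N (Suc k) = (\<integral>w. (\<integral>z. exp (- \<tau> * mean_soft_val cY r (displace cX s z (?y w))) \<partial>gauss_space) \<partial>gauss_space)"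
      unfolding interpolant_def r_def[symmetric] t'_def[symmetric]
      by (rule exp_shift_semigroup[OF pos(3,1,4) tt, symmetric])
    also have "\<dots> \<le> (\<integral>w. exp ?e * exp (- \<tau> * mean_soft_val cY r' (?y w)) \<partial>gauss_space)"
    proof (rule integral_mono')
      show "integrable gauss_space (\<lambda>w. exp ?e * exp (- \<tau> * mean_soft_val cY r' (?y w)))"
        by (intro integrable_mult_right mean_soft_val_shift_integrable(2) pos)
      fix w
      have "- \<tau> * (\<integral>z. mean_soft_val cY r (displace cX s z (?y w)) \<partial>gauss_space) \<le> - \<tau> * (mean_soft_val cY r' (?y w) - C1 * s ^ 3)"
        using mult_left_mono[OF low assms] by simp
      then have "- \<tau> * (\<integral>z. mean_soft_val cY r (displace cX s z (?y w)) \<partial>gauss_space) + \<tau>\<^sup>2 * s\<^sup>2 / 2 + C2 * s ^ 3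
         \<le> ?e + - \<tau> * mean_soft_val cY r' (?y w)"
        unfolding C_def by (simp add: algebra_simps)
      then have "exp (- \<tau> * (\<integral>z. mean_soft_val cY r (displace cX s z (?y w)) \<partial>gauss_space) + \<tau>\<^sup>2 * s\<^sup>2 / 2 + C2 * s ^ 3)
         \<le> exp ?e * exp (- \<tau> * mean_soft_val cY r' (?y w))"
        unfolding exp_add[symmetric] by simp
      with C2(2)[OF pos(1,2), of r "?y w"]
      show "(\<integral>z. exp (- \<tau> * mean_soft_val cY r (displace cX s z (?y w))) \<partial>gauss_space) \<le> exp ?e * exp (- \<tau> * mean_soft_val cY r' (?y w))"
        by (rule order_trans)
      show "0 \<le> exp ?e * exp (- \<tau> * mean_soft_val cY r' (?y w))" by simp
    qed
    also have "\<dots> = interpolant \<tau> N k * exp ?e"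
      unfolding interpolant_def r'_def[symmetric] t_def[symmetric]
      by (subst integral_mult_right_zero) (rule mult.commute)
    also have "?e = \<tau>\<^sup>2 / 2 / real N + C * sqrt (1 / real N) ^ 3"
      unfolding s2 unfolding s_def by simp
    finally show ?thesis .
  qed
  moreover have "C \<ge> 0" unfolding C_def using C1 C2 assms by simp
  ultimately show ?thesis by blast
qed

text \<open>Over \<open>N\<close> steps the quadratic costs add up to \<open>\<tau>\<^sup>2 / 2\<close>, and the cubic ones to a multiple of
  \<open>sqrt (1 / N)\<close>, which tends to zero.\<close>
lemma soft_val_mgf:
  assumes "\<tau> \<ge> 0"
  shows "(\<integral>w. exp (- \<tau> * soft_val (gauss_field cX w)) \<partial>gauss_space)
    \<le> exp (- \<tau> * (\<integral>w. soft_val (gauss_field cY w) \<partial>gauss_space) + \<tau>\<^sup>2 / 2)"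
proof -
  obtain C where C: "C \<ge> 0" "\<And>N k. k < N \<Longrightarrow>
    interpolant \<tau> N (Suc k) \<le> interpolant \<tau> N k * exp (\<tau>\<^sup>2 / 2 / real N + C * sqrt (1 / real N) ^ 3)"
    using interpolant_step[OF assms] by blast
  have shift0: "displace c 0 w x = x" for c :: "'i \<Rightarrow> 'j \<Rightarrow> 'a::finite \<Rightarrow> real" and w x
    by (simp add: displace_def)
  have shift1: "displace c 1 w (\<lambda>_ _. 0) = gauss_field c w" for c :: "'i \<Rightarrow> 'j \<Rightarrow> 'a::finite \<Rightarrow> real" and w
    by (simp add: displace_def)
  have e0: "interpolant \<tau> N 0 = exp (- \<tau> * (\<integral>w. soft_val (gauss_field cY w) \<partial>gauss_space))" for N
    unfolding interpolant_def by (simp add: shift0 mean_soft_val_def shift1)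
  have eN: "interpolant \<tau> N N = (\<integral>w. exp (- \<tau> * soft_val (gauss_field cX w)) \<partial>gauss_space)" if "N > 0" for N
    unfolding interpolant_def using that by (simp add: mean_soft_val_def shift0 shift1)
  have it: "interpolant \<tau> N k \<le> interpolant \<tau> N 0 * exp (real k * (\<tau>\<^sup>2 / 2 / real N + C * sqrt (1 / real N) ^ 3))"
    if "k \<le> N" for N k
    using that
  proof (induction k)
    case (Suc k)
    let ?e = "\<tau>\<^sup>2 / 2 / real N + C * sqrt (1 / real N) ^ 3"
    have "interpolant \<tau> N (Suc k) \<le> interpolant \<tau> N k * exp ?e" using C(2)[of k N] Suc.prems by simp
    also have "\<dots> \<le> (interpolant \<tau> N 0 * exp (real k * ?e)) * exp ?e"
      using Suc by (intro mult_right_mono) auto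
    also have "\<dots> = interpolant \<tau> N 0 * exp (real (Suc k) * ?e)"
    proof -
      have "exp (real (Suc k) * e) = exp (real k * e) * exp e" for e :: real
        by (simp add: distrib_right exp_add)
      then show ?thesis by (simp only: mult.assoc)
    qed
    finally show ?case .
  qed simp
  let ?f = "\<lambda>N. exp (- \<tau> * (\<integral>w. soft_val (gauss_field cY w) \<partial>gauss_space)) * exp (\<tau>\<^sup>2 / 2 + C * sqrt (1 / real N))"
  have le: "(\<integral>w. exp (- \<tau> * soft_val (gauss_field cX w)) \<partial>gauss_space) \<le> ?f N" if "N > 0" for N
  proof -
    have "real N * (\<tau>\<^sup>2 / 2 / real N + C * sqrt (1 / real N) ^ 3) = \<tau>\<^sup>2 / 2 + C * sqrt (1 / real N)"
      using that by (simp add: power3_eq_cube algebra_simps flip: real_sqrt_mult)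
    then show ?thesis using it[of N N] that unfolding e0 eN[OF that] by simp
  qed
  have "?f \<longlonglongrightarrow> exp (- \<tau> * (\<integral>w. soft_val (gauss_field cY w) \<partial>gauss_space)) * exp (\<tau>\<^sup>2 / 2 + C * sqrt 0)"
    by (intro tendsto_intros lim_1_over_n)
  then have "(\<integral>w. exp (- \<tau> * soft_val (gauss_field cX w)) \<partial>gauss_space) \<le> exp (- \<tau> * (\<integral>w. soft_val (gauss_field cY w) \<partial>gauss_space)) * exp (\<tau>\<^sup>2 / 2 + C * sqrt 0)"
    by (rule LIMSEQ_le_const) (use le in \<open>auto intro!: exI[of _ 1]\<close>)
  then show ?thesis unfolding exp_add by simp
qed

text \<open>Markov's inequality for the exponential moment at \<open>\<tau> = \<theta>\<close>, the optimal choice.\<close>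
lemma soft_val_tail:
  assumes "\<theta> > 0"
  shows "measure gauss_space {w. soft_val (gauss_field cX w) \<le> (\<integral>w. soft_val (gauss_field cY w) \<partial>gauss_space) - \<theta>} \<le> exp (- \<theta>\<^sup>2 / 2)"
proof -
  let ?m = "\<integral>w. soft_val (gauss_field cY w) \<partial>gauss_space"
  let ?A = "{w. soft_val (gauss_field cX w) \<le> ?m - \<theta>}"
  have shift1: "displace cX 1 w (\<lambda>_ _. 0) = gauss_field cX w" for w by (simp add: displace_def)
  have meas [measurable]: "(\<lambda>w. soft_val (gauss_field cX w)) \<in> borel_measurable gauss_space"
    by (intro soft_val_measurable gauss_field_measurable)
  have A: "?A \<in> sets gauss_space"
    using borel_measurable_le[OF meas, of "\<lambda>_. ?m - \<theta>"] by simp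
  have mF0: "mean_soft_val cY 0 x = soft_val x" for x by (simp add: mean_soft_val_def displace_def)
  have I: "integrable gauss_space (\<lambda>w. exp (- \<theta> * soft_val (gauss_field cX w)))"
    using mean_soft_val_shift_integrable(2)[of 1 "- \<theta>" cY 0 cX "\<lambda>_ _. 0"] by (simp add: mF0 shift1)
  have "measure gauss_space ?A = (\<integral>w. indicator ?A w \<partial>gauss_space)" using A by simp
  also have "\<dots> \<le> (\<integral>w. exp (\<theta> * (?m - \<theta>)) * exp (- \<theta> * soft_val (gauss_field cX w)) \<partial>gauss_space)"
  proof (intro integral_mono integrable_mult_right I)
    show "integrable gauss_space (indicator ?A :: _ \<Rightarrow> real)"
      using A by (intro integrable_real_indicator) (simp_all add: gauss_space.emeasure_finite less_top[symmetric])
    fix w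
    show "indicator ?A w \<le> exp (\<theta> * (?m - \<theta>)) * exp (- \<theta> * soft_val (gauss_field cX w))"
    proof (cases "w \<in> ?A")
      case True
      then have "0 \<le> \<theta> * ((?m - \<theta>) - soft_val (gauss_field cX w))" using assms by simp
      then show ?thesis using True by (simp add: algebra_simps flip: exp_add)
    qed simp
  qed
  also have "\<dots> = exp (\<theta> * (?m - \<theta>)) * (\<integral>w. exp (- \<theta> * soft_val (gauss_field cX w)) \<partial>gauss_space)"
    by simp
  also have "\<dots> \<le> exp (\<theta> * (?m - \<theta>)) * exp (- \<theta> * ?m + \<theta>\<^sup>2 / 2)"
    using soft_val_mgf[of \<theta>] assms by (intro mult_left_mono) auto
  also have "\<dots> = exp (- \<theta>\<^sup>2 / 2)"
    unfolding exp_add[symmetric] by (simp add: algebra_simps power2_eq_square)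
  finally show ?thesis .
qed

end

section \<open>The standard Gaussian vector\<close>

text \<open>The image of Lebesgue measure in dimension \<open>n\<close> under the Euclidean norm: its density is the
  derivative of the volume of the ball of radius \<open>r\<close>.\<close>
definition radial_vol :: "nat \<Rightarrow> real measure" where
  "radial_vol n = density lborel (\<lambda>r. ennreal (unit_ball_vol n * real n * r ^ (n - 1)) * indicator {0..} r)"

lemma emeasure_radial_vol:
  assumes "n > 0"
  shows "emeasure (radial_vol n) {..r} = (if r < 0 then 0 else ennreal (unit_ball_vol n * r ^ n))"
proof (cases "r < 0")
  case True
  have "emeasure (radial_vol n) {..r}
     = (\<integral>\<^sup>+x. ennreal (unit_ball_vol n * real n * x ^ (n - 1)) * indicator {0..} x * indicator {..r} x \<partial>lborel)"
    unfolding radial_vol_def by (rule emeasure_density) auto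
  also have "\<dots> = (\<integral>\<^sup>+x. 0 \<partial>(lborel :: real measure))"
    using True by (intro nn_integral_cong) (simp add: indicator_def)
  finally show ?thesis using True by simp
next
  case False
  have "emeasure (radial_vol n) {..r} = (\<integral>\<^sup>+x. ennreal (unit_ball_vol n * real n * x ^ (n - 1)) * indicator {0..r} x \<partial>lborel)"
    unfolding radial_vol_def
    by (subst emeasure_density) (auto intro!: nn_integral_cong split: split_indicator)
  also have "\<dots> = ennreal (unit_ball_vol n * r ^ n - unit_ball_vol n * 0 ^ n)"
    using False
    by (intro nn_integral_FTC_Icc)
      (auto intro!: derivative_eq_intros mult_nonneg_nonneg simp: mult_ac)
  finally show ?thesis using False assms by simp
qed

text \<open>Both measures give \<open>{..r}\<close> the volume of the ball of radius \<open>r\<close>, and these half-lines generate.\<close>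
lemma distr_norm_lborel:
  "distr (lborel :: 'a::euclidean_space measure) borel norm = radial_vol DIM('a)"
proof -
  let ?M = "distr (lborel :: 'a measure) borel norm"
  have M: "emeasure ?M {..r} = (if r < 0 then 0 else ennreal (unit_ball_vol DIM('a) * r ^ DIM('a)))" for r
  proof -
    have "emeasure ?M {..r} = emeasure lborel {x :: 'a. norm x \<le> r}"
      by (subst emeasure_distr) (auto intro!: arg_cong2[where f=emeasure])
    also have "{x :: 'a. norm x \<le> r} = (if r < 0 then {} else cball 0 r)"
    proof (cases "r < 0")
      case True
      then have "\<not> norm x \<le> r" for x :: 'a using norm_ge_zero[of x] by linarith
      with True show ?thesis by simp
    qed (simp add: cball_def dist_norm)
    finally show ?thesis by (simp add: emeasure_cball)
  qed
  show ?thesis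
  proof (rule measure_eqI_generator_eq)
    show "Int_stable (range (atMost :: real \<Rightarrow> real set))"
      by (auto simp: Int_stable_def)
    show "sets ?M = sigma_sets UNIV (range atMost)"
      by (simp add: borel_eq_atMost)
    show "sets (radial_vol DIM('a)) = sigma_sets UNIV (range atMost)"
      by (simp add: radial_vol_def borel_eq_atMost)
    show "emeasure ?M X = emeasure (radial_vol DIM('a)) X" if X: "X \<in> range atMost" for X
      using that by (auto simp: M emeasure_radial_vol)
    show "range (\<lambda>k::nat. {..real k}) \<subseteq> range atMost" by auto
    show "(\<Union>k::nat. {..real k}) = UNIV" using real_arch_simple by auto
    show "emeasure ?M {..real k} \<noteq> \<infinity>" for k by (simp add: M)
  qed auto
qed

lemma nn_integral_radial:
  assumes [measurable]: "f \<in> borel_measurable borel"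
  shows "(\<integral>\<^sup>+x. f (norm x) \<partial>(lborel :: 'a::euclidean_space measure))
    = ennreal (unit_ball_vol DIM('a) * DIM('a)) * (\<integral>\<^sup>+r. ennreal (r ^ (DIM('a) - 1)) * f r * indicator {0..} r \<partial>lborel)"
proof -
  have "(\<integral>\<^sup>+x. f (norm x) \<partial>(lborel :: 'a measure)) = (\<integral>\<^sup>+r. f r \<partial>distr (lborel :: 'a measure) borel norm)"
    by (subst nn_integral_distr) auto
  also have "\<dots> = (\<integral>\<^sup>+r. ennreal (unit_ball_vol DIM('a) * DIM('a)) * (ennreal (r ^ (DIM('a) - 1)) * f r * indicator {0..} r) \<partial>lborel)"
    unfolding distr_norm_lborel radial_vol_def
    by (subst nn_integral_density)
      (auto intro!: nn_integral_cong simp: indicator_def ennreal_mult mult_ac)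
  finally show ?thesis by (subst (asm) nn_integral_cmult) auto
qed

lemma std_gaussian_density:
  "(\<Prod>i\<in>UNIV. std_normal_density (x $ i)) = (1 / sqrt (2 * pi)) ^ CARD('n) * exp (- (norm x)\<^sup>2 / 2)"
  for x :: "real ^ 'n"
proof -
  have "(\<Prod>i\<in>UNIV. std_normal_density (x $ i)) = (1 / sqrt (2 * pi)) ^ CARD('n) * exp (\<Sum>i\<in>UNIV. - (x $ i)\<^sup>2 / 2)"
    by (simp only: std_normal_density_def prod.distrib exp_sum[OF finite_class.finite_UNIV] prod_constant)
  also have "(\<Sum>i\<in>UNIV. - (x $ i)\<^sup>2 / 2) = - (norm x)\<^sup>2 / 2"
    by (simp add: norm_vec_def L2_set_def sum_nonneg sum_negf flip: sum_divide_distrib)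
  finally show ?thesis .
qed

lemma sets_std_gaussian [measurable_cong]: "sets std_gaussian = sets borel"
  by (simp add: std_gaussian_def)

lemma space_std_gaussian [simp]: "space std_gaussian = UNIV"
  by (simp add: std_gaussian_def)

lemma Basis_real_vec: "(Basis :: (real ^ 'n) set) = range (\<lambda>i. axis i 1)"
  by (auto simp: Basis_vec_def)

text \<open>Lebesgue measure is determined by its values on boxes.\<close>
lemma lborel_vec: "distr (PiM UNIV (\<lambda>_. lborel)) borel (\<lambda>w. \<chi> i. w i) = (lborel :: (real ^ 'n) measure)"
proof (rule lborel_eqI[symmetric])
  interpret finite_product_sigma_finite "\<lambda>_::'n. lborel :: real measure" UNIV by unfold_locales auto
  have [measurable]: "(\<lambda>w. \<chi> i. w i) \<in> measurable (PiM UNIV (\<lambda>_::'n. lborel :: real measure)) (borel :: (real ^ 'n) measure)"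
    by (rule borel_measurable_euclidean_space[THEN iffD2]) (auto simp: Basis_real_vec inner_axis)
  fix l u :: "real ^ 'n" assume le: "\<And>b. b \<in> Basis \<Longrightarrow> l \<bullet> b \<le> u \<bullet> b"
  have le': "l $ i \<le> u $ i" for i
    using le[of "axis i 1"] by (simp add: Basis_real_vec inner_axis)
  have "emeasure (distr (PiM UNIV (\<lambda>_. lborel)) borel (\<lambda>w. \<chi> i. w i)) (box l u)
    = emeasure (PiM UNIV (\<lambda>_::'n. lborel :: real measure)) (PiE UNIV (\<lambda>i. {l $ i <..< u $ i}))"
    by (subst emeasure_distr)
      (auto intro!: arg_cong2[where f=emeasure] simp: space_PiM PiE_UNIV_domain mem_box_cart Pi_iff)
  also have "\<dots> = (\<Prod>i\<in>UNIV. emeasure lborel {l $ i <..< u $ i})"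
    by (rule measure_times) auto
  also have "\<dots> = ennreal (\<Prod>i\<in>UNIV. u $ i - l $ i)"
    using le' by (simp add: prod_ennreal)
  also have "(\<Prod>i\<in>UNIV. u $ i - l $ i) = (\<Prod>b\<in>Basis. (u - l) \<bullet> b)"
    unfolding Basis_real_vec
    by (subst prod.reindex) (auto intro!: injI simp: axis_eq_axis inner_axis)
  finally show "emeasure (distr (PiM UNIV (\<lambda>_. lborel)) borel (\<lambda>w. \<chi> i. w i)) (box l u) = (\<Prod>b\<in>Basis. (u - l) \<bullet> b)" .
qed simp

lemma gauss_space_density:
  "(gauss_space :: ('k::finite \<Rightarrow> real) measure)
    = density (PiM UNIV (\<lambda>_. lborel)) (\<lambda>w. ennreal (\<Prod>i\<in>UNIV. std_normal_density (w i)))"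
proof -
  interpret L: finite_product_sigma_finite "\<lambda>_::'k. lborel :: real measure" UNIV by unfold_locales auto
  have [measurable]: "(\<lambda>w. ennreal (\<Prod>i\<in>UNIV. std_normal_density (w i))) \<in> borel_measurable (PiM UNIV (\<lambda>_::'k. lborel))"
    by measurable
  have "density (PiM UNIV (\<lambda>_. lborel)) (\<lambda>w. ennreal (\<Prod>i\<in>UNIV. std_normal_density (w i))) = PiM UNIV (\<lambda>_::'k. gauss1)"
  proof (rule gauss_prod.PiM_eqI)
    fix A :: "'k \<Rightarrow> real set" assume A: "\<And>i. i \<in> UNIV \<Longrightarrow> A i \<in> sets gauss1"
    then have [measurable]: "A i \<in> sets borel" for i by simp
    have PA: "PiE UNIV A \<in> sets (PiM UNIV (\<lambda>_::'k. lborel :: real measure))"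
      by (rule sets_PiM_I_finite) auto
    have "emeasure (density (PiM UNIV (\<lambda>_. lborel)) (\<lambda>w. ennreal (\<Prod>i\<in>UNIV. std_normal_density (w i)))) (PiE UNIV A)
      = (\<integral>\<^sup>+w. ennreal (\<Prod>i\<in>UNIV. std_normal_density (w i)) * indicator (PiE UNIV A) w \<partial>PiM UNIV (\<lambda>_::'k. lborel))"
      using PA by (subst emeasure_density) auto
    also have "\<dots> = (\<integral>\<^sup>+w. (\<Prod>i\<in>UNIV. ennreal (std_normal_density (w i)) * indicator (A i) (w i)) \<partial>PiM UNIV (\<lambda>_::'k. lborel))"
    proof (rule nn_integral_cong)
      fix w :: "'k \<Rightarrow> real"
      have "(\<Prod>i\<in>UNIV. indicator (A i) (w i)) = (indicator (PiE UNIV A) w :: ennreal)"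
      proof (cases "w \<in> PiE UNIV A")
        case False
        then obtain i where "w i \<notin> A i" by (auto simp: PiE_UNIV_domain)
        then have "(\<Prod>i\<in>UNIV. indicator (A i) (w i) :: ennreal) = 0"
          by (intro prod_zero bexI[of _ i]) auto
        with False show ?thesis by simp
      qed (simp add: PiE_UNIV_domain Pi_iff)
      then show "ennreal (\<Prod>i\<in>UNIV. std_normal_density (w i)) * indicator (PiE UNIV A) w
         = (\<Prod>i\<in>UNIV. ennreal (std_normal_density (w i)) * indicator (A i) (w i))"
        by (simp add: prod.distrib prod_ennreal)
    qed
    also have "\<dots> = (\<Prod>i\<in>UNIV. \<integral>\<^sup>+x. ennreal (std_normal_density x) * indicator (A i) x \<partial>lborel)"
      by (rule L.product_nn_integral_prod) auto
    also have "\<dots> = (\<Prod>i\<in>UNIV. emeasure gauss1 (A i))"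
      by (intro prod.cong refl) (simp add: emeasure_density)
    finally show "emeasure (density (PiM UNIV (\<lambda>_. lborel)) (\<lambda>w. ennreal (\<Prod>i\<in>UNIV. std_normal_density (w i)))) (PiE UNIV A)
      = (\<Prod>i\<in>UNIV. emeasure gauss1 (A i))" .
  qed (auto intro!: sets_PiM_cong)
  then show ?thesis unfolding gauss_space_def ..
qed

lemma vec_measurable [measurable]: "(\<lambda>w. \<chi> i. w (f i)) \<in> measurable gauss_space (borel :: (real ^ 'n) measure)"
  by (rule borel_measurable_euclidean_space[THEN iffD2]) (auto simp: Basis_real_vec inner_axis)

lemma std_gaussian_eq_distr: "std_gaussian = distr gauss_space borel (\<lambda>w. \<chi> i. w i)"
proof -
  have [measurable]: "(\<lambda>w. \<chi> i. w i) \<in> measurable (PiM UNIV (\<lambda>_::'n. lborel :: real measure)) (borel :: (real ^ 'n) measure)"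
    by (rule borel_measurable_euclidean_space[THEN iffD2]) (auto simp: Basis_real_vec inner_axis)
  show ?thesis
    unfolding std_gaussian_def lborel_vec[symmetric] gauss_space_density
    by (subst density_distr) auto
qed

lemma distr_gauss_space_inj:
  fixes f :: "'n::finite \<Rightarrow> 'k::finite"
  assumes "inj f"
  shows "distr gauss_space borel (\<lambda>w. \<chi> i. w (f i)) = std_gaussian"
proof -
  have 1: "distr gauss_space gauss_space (\<lambda>w i. w (f i)) = (gauss_space :: ('n \<Rightarrow> real) measure)"
    using distr_PiM_reindex[of "UNIV :: 'k set" "\<lambda>_. gauss1" f UNIV] assms prob_space_gauss1
    by (simp add: gauss_space_def restrict_UNIV)
  have [measurable]: "(\<lambda>w i. w (f i)) \<in> measurable gauss_space (gauss_space :: ('n \<Rightarrow> real) measure)"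
    unfolding measurable_cong_sets[OF refl sets_gauss_space]
    by (rule measurable_PiM_single') auto
  have "std_gaussian = distr (distr gauss_space gauss_space (\<lambda>w i. w (f i))) borel (\<lambda>w. \<chi> i. w i)"
    unfolding 1 by (rule std_gaussian_eq_distr)
  also have "\<dots> = distr gauss_space borel (\<lambda>w. \<chi> i. w (f i))"
    by (subst distr_distr) (auto simp: o_def)
  finally show ?thesis ..
qed

lemma prob_space_std_gaussian: "prob_space std_gaussian"
  unfolding std_gaussian_eq_distr by (rule gauss_space.prob_space_distr) measurable

interpretation std_gaussian: prob_space std_gaussian by (rule prob_space_std_gaussian)

lemma prob_std_gaussian_UNIV [simp]: "measure std_gaussian UNIV = 1"
  using std_gaussian.prob_space by simp

text \<open>The integral over the half-line that polar coordinates produce.\<close>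
definition half_moment :: "nat \<Rightarrow> ennreal" where
  "half_moment n = (\<integral>\<^sup>+r. ennreal (r ^ n * exp (- r\<^sup>2 / 2)) * indicator {0..} r \<partial>lborel)"

lemma nn_integral_std_gaussian_norm:
  "(\<integral>\<^sup>+x. ennreal (norm x ^ k) \<partial>(std_gaussian :: (real ^ 'n) measure))
    = ennreal ((1 / sqrt (2 * pi)) ^ CARD('n) * (unit_ball_vol CARD('n) * CARD('n))) * half_moment (k + (CARD('n) - 1))"
proof -
  let ?c = "(1 / sqrt (2 * pi)) ^ CARD('n)"
  have "(\<integral>\<^sup>+x. ennreal (norm x ^ k) \<partial>(std_gaussian :: (real ^ 'n) measure))
    = (\<integral>\<^sup>+x. ennreal (?c * (norm x ^ k * exp (- (norm x)\<^sup>2 / 2))) \<partial>(lborel :: (real ^ 'n) measure))"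
    unfolding std_gaussian_def std_gaussian_density
    by (subst nn_integral_density) (auto intro!: nn_integral_cong simp: mult_ac simp flip: ennreal_mult)
  also have "\<dots> = ennreal (unit_ball_vol CARD('n) * CARD('n)) *
     (\<integral>\<^sup>+r. ennreal (r ^ (CARD('n) - 1)) * ennreal (?c * (r ^ k * exp (- r\<^sup>2 / 2))) * indicator {0..} r \<partial>lborel)"
    by (subst nn_integral_radial[of "\<lambda>r. ennreal (?c * (r ^ k * exp (- r\<^sup>2 / 2)))"]) auto
  also have "(\<integral>\<^sup>+r. ennreal (r ^ (CARD('n) - 1)) * ennreal (?c * (r ^ k * exp (- r\<^sup>2 / 2))) * indicator {0..} r \<partial>lborel)
    = (\<integral>\<^sup>+r. ennreal ?c * (ennreal (r ^ (k + (CARD('n) - 1)) * exp (- r\<^sup>2 / 2)) * indicator {0..} r) \<partial>lborel)"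
  proof (rule nn_integral_cong)
    have "ennreal (r ^ m) * ennreal (c * (r ^ k * e)) * indicator {0..} r
       = ennreal c * (ennreal (r ^ (k + m) * e) * indicator {0..} r)" if "c \<ge> 0" "e \<ge> 0" for c e r :: real and m
      using that by (auto split: split_indicator simp: power_add mult_ac simp flip: ennreal_mult)
    then show "ennreal (r ^ (CARD('n) - 1)) * ennreal (?c * (r ^ k * exp (- r\<^sup>2 / 2))) * indicator {0..} r
      = ennreal ?c * (ennreal (r ^ (k + (CARD('n) - 1)) * exp (- r\<^sup>2 / 2)) * indicator {0..} r)" for r
      by simp
  qed
  also have "\<dots> = ennreal ?c * half_moment (k + (CARD('n) - 1))"
    unfolding half_moment_def by (subst nn_integral_cmult) auto
  finally show ?thesis
    by (simp add: ennreal_mult mult_ac)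
qed

text \<open>The constant that multiplies the radial integral in polar coordinates, with the powers of \<open>pi\<close>
  from the density and from the volume of the ball cancelled.\<close>
lemma gaussian_ball_const:
  assumes "n > 0"
  shows "(1 / sqrt (2 * pi)) ^ n * (unit_ball_vol (real n) * real n) = 2 / (2 powr (n / 2) * Gamma (n / 2))"
proof -
  have "sqrt (2 * pi) ^ n = ((2 * pi) powr (1 / 2)) powr n"
    by (simp add: powr_half_sqrt powr_realpow)
  also have "\<dots> = 2 powr (n / 2) * pi powr (n / 2)"
    by (simp add: powr_powr powr_mult)
  finally have 1: "sqrt (2 * pi) ^ n = 2 powr (n / 2) * pi powr (n / 2)" .
  have "(real n / 2) \<notin> \<int>\<^sub>\<le>\<^sub>0"
    using assms by auto
  then have 2: "Gamma (real n / 2 + 1) = (real n / 2) * Gamma (real n / 2)"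
    by (rule Gamma_plus1)
  have "Gamma (real n / 2) > 0" using assms by (intro Gamma_real_pos) auto
  then show ?thesis
    using assms unfolding unit_ball_vol_def 2 power_one_over 1 by (simp add: field_simps)
qed

text \<open>In dimension \<open>n + 1\<close> the total mass of the standard Gaussian measure is one and, in polar
  coordinates, a known constant times the \<open>n\<close>-th half moment. Solving for the half moment
  evaluates it; the type \<open>'n option\<close> provides the extra dimension.\<close>
lemma half_moment_eq:
  "half_moment CARD('n::finite) = ennreal (2 powr ((real CARD('n) + 1) / 2) * Gamma ((real CARD('n) + 1) / 2) / 2)"
proof -
  let ?n = "CARD('n)"
  have card: "CARD('n option) = Suc ?n"
    by (simp add: UNIV_option_conv card_image)
  define a where "a = 2 / (2 powr (real (Suc ?n) / 2) * Gamma (real (Suc ?n) / 2))"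
  have "Gamma (real (Suc ?n) / 2) > 0" by (intro Gamma_real_pos) auto
  then have a: "a > 0" unfolding a_def by simp
  have "(\<integral>\<^sup>+x. ennreal (norm x ^ 0) \<partial>(std_gaussian :: (real ^ ('n option)) measure)) = 1"
  proof -
    have "emeasure (std_gaussian :: (real ^ ('n option)) measure) (space std_gaussian) = 1"
      by (rule std_gaussian.emeasure_space_1)
    then show ?thesis by simp
  qed
  then have 1: "ennreal a * half_moment ?n = 1"
    unfolding nn_integral_std_gaussian_norm card a_def gaussian_ball_const[OF zero_less_Suc] by simp
  have "half_moment ?n = ennreal (1 / a) * (ennreal a * half_moment ?n)"
    using a by (simp add: mult.assoc[symmetric] ennreal_mult[symmetric])
  also have "\<dots> = ennreal (1 / a)" unfolding 1 by simp
  also have "1 / a = 2 powr ((real ?n + 1) / 2) * Gamma ((real ?n + 1) / 2) / 2"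
    by (simp add: a_def add.commute)
  finally show ?thesis .
qed

text \<open>In polar coordinates the mean length in dimension \<open>n\<close> is the constant of \<open>gaussian_ball_const\<close>
  times the \<open>n\<close>-th half moment; the ratio of Gamma values arises from consecutive dimensions.\<close>
lemma norm_std_gaussian:
  "has_bochner_integral (std_gaussian :: (real ^ 'n) measure) norm (gauss_b CARD('n))"
proof (rule has_bochner_integral_nn_integral)
  have Gp: "Gamma (real CARD('n) / 2) > 0" "Gamma ((real CARD('n) + 1) / 2) > 0"
    by (auto intro!: Gamma_real_pos)
  then show "0 \<le> gauss_b CARD('n)"
    unfolding gauss_b_def by simp
  have idx: "1 + (CARD('n) - 1) = CARD('n)" by (simp add: Suc_leI)
  have c: "(2::real) powr ((real CARD('n) + 1) / 2) = 2 powr (real CARD('n) / 2) * sqrt 2"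
    by (simp add: add_divide_distrib powr_add powr_half_sqrt)
  have "(\<integral>\<^sup>+x. ennreal (norm x) \<partial>(std_gaussian :: (real ^ 'n) measure))
    = ennreal (2 / (2 powr (real CARD('n) / 2) * Gamma (real CARD('n) / 2))) * half_moment CARD('n)"
    using nn_integral_std_gaussian_norm[of 1, where 'n='n] gaussian_ball_const[of "CARD('n)"]
    unfolding idx by simp
  also have "\<dots> = ennreal (gauss_b CARD('n))"
    unfolding half_moment_eq c gauss_b_def using Gp
    by (simp add: ennreal_mult[symmetric])
  finally show "(\<integral>\<^sup>+x. ennreal (norm x) \<partial>(std_gaussian :: (real ^ 'n) measure)) = ennreal (gauss_b CARD('n))" .
qed auto

section \<open>Deviation inequality for the min-max\<close>

text \<open>Gordon's min-max comparison together with Gaussian concentration. Any integrable lower bound \<open>h\<close>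
  of the min-max of \<open>Y\<close> will do; taking \<open>h\<close> instead of the min-max itself saves its computation in the
  applications. In the limit \<open>\<beta> \<rightarrow> \<infinity>\<close> the soft min-max becomes the exact one; the gaps on both sides
  sum to \<open>c / \<beta>\<close>, and the events with this margin increase to the event with strict inequality.\<close>
lemma gordon_deviation:
  fixes cX :: "'i \<Rightarrow> 'j \<Rightarrow> 'k::finite \<Rightarrow> real" and cY :: "'i \<Rightarrow> 'j \<Rightarrow> 'l::finite \<Rightarrow> real" and \<kappa> \<theta> :: real
  assumes fin: "finite I" "finite J" and ne: "I \<noteq> {}" "J \<noteq> {}"
    and var: "\<And>i j. i \<in> I \<Longrightarrow> j \<in> J \<Longrightarrow> (\<Sum>k\<in>UNIV. (cX i j k)\<^sup>2) \<le> 1"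
    and cov_same: "\<And>i j j'. i \<in> I \<Longrightarrow> j \<in> J \<Longrightarrow> j' \<in> J \<Longrightarrow>
      (\<Sum>k\<in>UNIV. cX i j k * cX i j' k) + \<kappa> = (\<Sum>k\<in>UNIV. cY i j k * cY i j' k)"
    and cov_diff: "\<And>i i' j j'. i \<in> I \<Longrightarrow> i' \<in> I \<Longrightarrow> j \<in> J \<Longrightarrow> j' \<in> J \<Longrightarrow>
      (\<Sum>k\<in>UNIV. cX i j k * cX i' j' k) + \<kappa> \<ge> (\<Sum>k\<in>UNIV. cY i j k * cY i' j' k)"
    and \<theta>: "\<theta> > 0"
    and h: "integrable gauss_space h"
    and h_le: "\<And>w i. i \<in> I \<Longrightarrow> \<exists>j\<in>J. h w \<le> gauss_field cY w i j"
  shows "measure gauss_space {w. \<exists>i\<in>I. \<forall>j\<in>J. gauss_field cX w i j < (\<integral>w. h w \<partial>gauss_space) - \<theta>} \<le> exp (- \<theta>\<^sup>2 / 2)"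
proof -
  let ?T = "(\<integral>w. h w \<partial>gauss_space) - \<theta>"
  define c where "c = ln (real (card I)) + ln (real (card J))"
  have card: "card I \<ge> 1" "card J \<ge> 1" using fin ne by (simp_all add: Suc_le_eq card_gt_0_iff)
  then have c: "c \<ge> 0" unfolding c_def by simp
  define A where "A n = {w. \<exists>i\<in>I. \<forall>j\<in>J. gauss_field cX w i j < ?T - c / real (Suc n)}" for n
  have A_sets: "A n \<in> sets gauss_space" for n
  proof -
    have "A n = (\<Union>i\<in>I. \<Inter>j\<in>J. {w \<in> space gauss_space. gauss_field cX w i j < ?T - c / real (Suc n)})"
      unfolding A_def by auto
    also have "\<dots> \<in> sets gauss_space"
      using fin ne by (intro sets.finite_UN sets.finite_INT borel_measurable_less gauss_field_measurable) auto
    finally show ?thesis .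
  qed
  have A_le: "measure gauss_space (A n) \<le> exp (- \<theta>\<^sup>2 / 2)" for n
  proof -
    interpret gordon_comparison I J "real (Suc n)" cX cY \<kappa>
      by unfold_locales (use fin ne var cov_same cov_diff in auto)
    have Fi: "integrable gauss_space (\<lambda>w. soft_val (gauss_field cY w))"
      using soft_val_field_integrable[of cY 1 "\<lambda>_ _. 0"] by (simp add: displace_def)
    have "(\<integral>w. h w \<partial>gauss_space) - ln (card I) / real (Suc n) = (\<integral>w. h w - ln (card I) / real (Suc n) \<partial>gauss_space)"
      using h by simp
    also have "\<dots> \<le> (\<integral>w. soft_val (gauss_field cY w) \<partial>gauss_space)"
      using h Fi h_le by (intro integral_mono soft_val_ge) auto
    finally have lower: "(\<integral>w. h w \<partial>gauss_space) - ln (card I) / real (Suc n) \<le> (\<integral>w. soft_val (gauss_field cY w) \<partial>gauss_space)" .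
    have "A n \<subseteq> {w. soft_val (gauss_field cX w) \<le> (\<integral>w. soft_val (gauss_field cY w) \<partial>gauss_space) - \<theta>}"
    proof
      fix w assume "w \<in> A n"
      then obtain i where i: "i \<in> I" "\<And>j. j \<in> J \<Longrightarrow> gauss_field cX w i j \<le> ?T - c / real (Suc n)"
        unfolding A_def using less_imp_le by blast
      have "soft_val (gauss_field cX w) \<le> (?T - c / real (Suc n)) + ln (card J) / real (Suc n)"
        using i by (rule soft_val_le)
      also have "\<dots> = ((\<integral>w. h w \<partial>gauss_space) - ln (card I) / real (Suc n)) - \<theta>"
        unfolding c_def by (simp add: add_divide_distrib)
      also have "\<dots> \<le> (\<integral>w. soft_val (gauss_field cY w) \<partial>gauss_space) - \<theta>" using lower by simp
      finally show "w \<in> {w. soft_val (gauss_field cX w) \<le> (\<integral>w. soft_val (gauss_field cY w) \<partial>gauss_space) - \<theta>}" by simp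
    qed
    moreover have "{w. soft_val (gauss_field cX w) \<le> (\<integral>w. soft_val (gauss_field cY w) \<partial>gauss_space) - \<theta>} \<in> sets gauss_space"
    proof -
      have [measurable]: "(\<lambda>w. soft_val (gauss_field cX w)) \<in> borel_measurable gauss_space"
        by (intro soft_val_measurable gauss_field_measurable)
      have "{w \<in> space gauss_space. soft_val (gauss_field cX w) \<le> (\<integral>w. soft_val (gauss_field cY w) \<partial>gauss_space) - \<theta>} \<in> sets gauss_space"
        by (intro borel_measurable_le) measurable
      then show ?thesis by simp
    qed
    ultimately show ?thesis
      using gauss_space.finite_measure_mono soft_val_tail[OF \<theta>] order_trans by blast
  qed
  have inc: "incseq A"
  proof (rule incseq_SucI, rule subsetI)
    fix n w assume "w \<in> A n"
    then obtain i where i: "i \<in> I" "\<And>j. j \<in> J \<Longrightarrow> gauss_field cX w i j < ?T - c / real (Suc n)"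
      unfolding A_def by blast
    have "c / real (Suc (Suc n)) \<le> c / real (Suc n)" using c by (intro divide_left_mono) auto
    then have "gauss_field cX w i j < ?T - c / real (Suc (Suc n))" if "j \<in> J" for j
      using i(2)[OF that] by linarith
    with i(1) show "w \<in> A (Suc n)" unfolding A_def by blast
  qed
  have un: "(\<Union>n. A n) = {w. \<exists>i\<in>I. \<forall>j\<in>J. gauss_field cX w i j < ?T}"
  proof (intro equalityI subsetI)
    fix w assume "w \<in> (\<Union>n. A n)"
    then obtain n i where i: "i \<in> I" "\<And>j. j \<in> J \<Longrightarrow> gauss_field cX w i j < ?T - c / real (Suc n)"
      unfolding A_def by blast
    have "c / real (Suc n) \<ge> 0" using c by simp
    then have "gauss_field cX w i j < ?T" if "j \<in> J" for j using i(2)[OF that] by linarith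
    with i(1) show "w \<in> {w. \<exists>i\<in>I. \<forall>j\<in>J. gauss_field cX w i j < ?T}" by blast
  next
    fix w assume "w \<in> {w. \<exists>i\<in>I. \<forall>j\<in>J. gauss_field cX w i j < ?T}"
    then obtain i where i: "i \<in> I" "\<And>j. j \<in> J \<Longrightarrow> gauss_field cX w i j < ?T" by blast
    let ?m = "Max (gauss_field cX w i ` J)"
    have "?m < ?T" using fin ne i by simp
    moreover have "(\<lambda>n. c / real (Suc n)) \<longlonglongrightarrow> 0"
      using tendsto_mult[OF tendsto_const[of c] LIMSEQ_inverse_real_of_nat] by (simp add: divide_inverse)
    ultimately have "eventually (\<lambda>n. c / real (Suc n) < ?T - ?m) sequentially"
      by (intro order_tendstoD(2)[of _ 0]) auto
    then obtain n where n: "c / real (Suc n) < ?T - ?m"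
      using eventually_sequentially by auto
    have "gauss_field cX w i j \<le> ?m" if "j \<in> J" for j using fin that by (intro Max_ge) auto
    then have "gauss_field cX w i j < ?T - c / real (Suc n)" if "j \<in> J" for j using n that by fastforce
    with i(1) show "w \<in> (\<Union>n. A n)" unfolding A_def by blast
  qed
  have "(\<lambda>n. measure gauss_space (A n)) \<longlonglongrightarrow> measure gauss_space (\<Union>n. A n)"
    using A_sets by (intro gauss_space.finite_Lim_measure_incseq inc) auto
  then show ?thesis
    unfolding un by (rule LIMSEQ_le_const2) (use A_le in auto)
qed

section \<open>Gaussian widths of sets of unit vectors\<close>

text \<open>The support function; the Gaussian width is its mean.\<close>
definition sup_inner :: "(real ^ 'n) set \<Rightarrow> real ^ 'n \<Rightarrow> real" where
  "sup_inner S g = (SUP v\<in>S. v \<bullet> g)"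

lemma inner_le_norm: "v \<in> sphere 0 1 \<Longrightarrow> v \<bullet> g \<le> norm g" for v g :: "real ^ 'n"
  using norm_cauchy_schwarz[of v g] by simp

lemma sup_inner_bdd: "bdd_above ((\<lambda>v. v \<bullet> g) ` S)" if "S \<subseteq> sphere 0 1" for S :: "(real ^ 'n) set"
proof (rule bdd_aboveI[of _ "norm g"])
  fix x assume "x \<in> (\<lambda>v. v \<bullet> g) ` S"
  then show "x \<le> norm g" using that inner_le_norm by blast
qed

lemma sup_inner_upper: "S \<subseteq> sphere 0 1 \<Longrightarrow> v \<in> S \<Longrightarrow> v \<bullet> g \<le> sup_inner S g"
  unfolding sup_inner_def using sup_inner_bdd by (intro cSUP_upper)

lemma sup_inner_le_norm: "S \<subseteq> sphere 0 1 \<Longrightarrow> S \<noteq> {} \<Longrightarrow> sup_inner S g \<le> norm g"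
  unfolding sup_inner_def using inner_le_norm by (intro cSUP_least) blast+

lemma sup_inner_mono: "S \<subseteq> T \<Longrightarrow> T \<subseteq> sphere 0 1 \<Longrightarrow> S \<noteq> {} \<Longrightarrow> sup_inner S g \<le> sup_inner T g"
  unfolding sup_inner_def by (rule cSUP_subset_mono[OF _ sup_inner_bdd]) auto

lemma sup_inner_abs_le: "\<bar>sup_inner S g\<bar> \<le> norm g" if S: "S \<subseteq> sphere 0 1" "S \<noteq> {}"
proof -
  obtain v where v: "v \<in> S" using S by blast
  then have "norm v = 1" using S by auto
  then have "- norm g \<le> v \<bullet> g" using norm_cauchy_schwarz[of "-v" g] by simp
  also have "\<dots> \<le> sup_inner S g" using v S by (intro sup_inner_upper)
  finally show ?thesis using sup_inner_le_norm[OF S, of g] by simp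
qed

lemma sup_inner_attained: "finite S \<Longrightarrow> S \<noteq> {} \<Longrightarrow> \<exists>v\<in>S. sup_inner S g = v \<bullet> g"
  using Max_in[of "(\<lambda>v. v \<bullet> g) ` S"] by (simp add: sup_inner_def cSup_eq_Max image_iff)

lemma sphere_ne: "sphere 0 1 \<noteq> ({} :: (real ^ 'n) set)"
  using vector_choose_size[of 1] by (auto simp: sphere_def)

lemma sup_inner_sphere: "sup_inner (sphere 0 1) g = norm g"
proof (rule antisym)
  show "sup_inner (sphere 0 1) g \<le> norm g" using sphere_ne by (intro sup_inner_le_norm) auto
  show "norm g \<le> sup_inner (sphere 0 1) g"
  proof (cases "g = 0")
    case True
    then show ?thesis using sup_inner_abs_le[of "sphere 0 1" g] sphere_ne by simp
  next
    case False
    have "norm g = (g /\<^sub>R norm g) \<bullet> g"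
      using False by (simp add: dot_square_norm power2_eq_square)
    also have "\<dots> \<le> sup_inner (sphere 0 1) g" using False by (intro sup_inner_upper) auto
    finally show ?thesis .
  qed
qed

text \<open>A support function of a subset of the sphere is 1-Lipschitz, hence continuous.\<close>
lemma sup_inner_measurable:
  assumes S: "S \<subseteq> sphere 0 1" "S \<noteq> {}"
  shows "sup_inner S \<in> borel_measurable borel"
proof (rule borel_measurable_continuous_onI)
  have le: "sup_inner S g \<le> sup_inner S g' + norm (g - g')" for g g'
    unfolding sup_inner_def[of S g]
  proof (rule cSUP_least)
    fix v assume v: "v \<in> S"
    have "v \<bullet> g = v \<bullet> g' + v \<bullet> (g - g')" by (simp add: inner_diff_right)
    also have "\<dots> \<le> sup_inner S g' + norm (g - g')"
      using v S by (intro add_mono sup_inner_upper inner_le_norm) auto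
    finally show "v \<bullet> g \<le> sup_inner S g' + norm (g - g')" .
  qed (use S in auto)
  have "\<bar>sup_inner S g - sup_inner S g'\<bar> \<le> norm (g - g')" for g g'
    using le[of g g'] le[of g' g] by (simp add: norm_minus_commute)
  then have "1-lipschitz_on UNIV (sup_inner S)"
    by (intro lipschitz_onI) (auto simp: dist_norm)
  then show "continuous_on UNIV (sup_inner S)" by (rule lipschitz_on_continuous_on)
qed

lemma sup_inner_integrable:
  assumes S: "S \<subseteq> sphere 0 1" "S \<noteq> {}"
  shows "integrable std_gaussian (sup_inner S)"
proof (rule Bochner_Integration.integrable_bound[OF integrable.intros[OF norm_std_gaussian]])
  show "sup_inner S \<in> borel_measurable std_gaussian"
    using sup_inner_measurable[OF S] by (simp add: measurable_cong_sets[OF sets_std_gaussian refl])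
  show "AE g in std_gaussian. norm (sup_inner S g) \<le> norm (norm g)"
    using sup_inner_abs_le[OF S] by simp
qed

lemma gaussian_width_eq: "gaussian_width S = (\<integral>g. sup_inner S g \<partial>std_gaussian)"
  by (simp add: gaussian_width_def sup_inner_def)

lemma width_mono: "S \<subseteq> T \<Longrightarrow> T \<subseteq> sphere 0 1 \<Longrightarrow> S \<noteq> {} \<Longrightarrow> gaussian_width S \<le> gaussian_width T"
  unfolding gaussian_width_eq by (intro integral_mono sup_inner_integrable sup_inner_mono) auto

lemma width_sphere: "gaussian_width (sphere 0 1 :: (real ^ 'n) set) = gauss_b CARD('n)"
  unfolding gaussian_width_eq sup_inner_sphere by (rule has_bochner_integral_integral_eq[OF norm_std_gaussian])

lemma sup_inner_coords:
  fixes f :: "'n::finite \<Rightarrow> 'k::finite"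
  assumes S: "S \<subseteq> sphere 0 1" "S \<noteq> {}" and f: "inj f"
  shows "has_bochner_integral gauss_space (\<lambda>w. sup_inner S (\<chi> i. w (f i))) (gaussian_width S)"
proof -
  note [measurable] = sup_inner_measurable[OF S]
  have "integrable (distr gauss_space borel (\<lambda>w. \<chi> i. w (f i))) (sup_inner S)"
    unfolding distr_gauss_space_inj[OF f] by (rule sup_inner_integrable[OF S])
  then have I: "integrable gauss_space (\<lambda>w. sup_inner S (\<chi> i. w (f i)))"
    by (subst (asm) integrable_distr_eq) auto
  have "gaussian_width S = (\<integral>g. sup_inner S g \<partial>distr gauss_space borel (\<lambda>w. \<chi> i. w (f i)))"
    unfolding distr_gauss_space_inj[OF f] gaussian_width_eq ..
  also have "\<dots> = (\<integral>w. sup_inner S (\<chi> i. w (f i)) \<partial>gauss_space)"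
    by (subst integral_distr) auto
  finally show ?thesis using I by (simp add: has_bochner_integral_iff)
qed

section \<open>Extreme gains of a Gaussian matrix\<close>

text \<open>Matrices as families indexed by pairs, so that a random matrix with independent standard normal
  entries is a point of \<open>gauss_space\<close>.\<close>
definition mat_of :: "('m \<times> 'n \<Rightarrow> real) \<Rightarrow> real ^ 'n ^ 'm" where
  "mat_of w = (\<chi> i j. w (i, j))"

lemma inner_mat_of: "u \<bullet> (mat_of w *v y) = (\<Sum>(i,j)\<in>UNIV. u $ i * y $ j * w (i, j))"
  for u :: "real ^ 'm" and y :: "real ^ 'n"
  unfolding UNIV_Times_UNIV[symmetric] sum.cartesian_product[symmetric]
  by (simp add: inner_vec_def matrix_vector_mult_def mat_of_def sum_distrib_left mult_ac)

lemma cov_matrix: "(\<Sum>(i,j)\<in>UNIV. (u $ i * y $ j) * (u' $ i * y' $ j)) = (u \<bullet> u') * (y \<bullet> y')"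
  for u u' :: "real ^ 'm" and y y' :: "real ^ 'n"
  unfolding UNIV_Times_UNIV[symmetric] sum.cartesian_product[symmetric]
  by (simp add: inner_vec_def sum_product mult_ac)

lemma sum_Inl_Inr: "(\<Sum>k\<in>UNIV. f k) = (\<Sum>i\<in>UNIV. f (Inl i)) + (\<Sum>j\<in>UNIV. f (Inr j))"
  for f :: "'m::finite + 'n::finite \<Rightarrow> real"
  unfolding UNIV_Plus_UNIV[symmetric] by (subst sum.Plus) auto

lemma inner_sphere_le: "u \<in> sphere 0 1 \<Longrightarrow> u' \<in> sphere 0 1 \<Longrightarrow> u \<bullet> u' \<le> 1" for u u' :: "real ^ 'n"
  using norm_cauchy_schwarz[of u u'] by simp

lemma inner_sphere_self: "u \<in> sphere 0 1 \<Longrightarrow> u \<bullet> u = 1" for u :: "real ^ 'n"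
  by (simp add: dot_square_norm)

text \<open>Here \<open>X\<close> has the entries \<open>u \<bullet> (S y)\<close>, and \<open>Y\<close> has the entries \<open>u \<bullet> g - y \<bullet> h\<close> with independent
  Gaussian vectors \<open>g\<close> and \<open>h\<close>, encoded by the two summands of the index type. On unit vectors
  \<open>Cov X + 1 - Cov Y = (1 - u \<bullet> u') * (1 - y \<bullet> y')\<close>, which is nonnegative and vanishes when \<open>y = y'\<close>.
  The min-max of \<open>Y\<close> is the supremum of \<open>u \<bullet> g\<close> minus the supremum of \<open>y \<bullet> h\<close>.\<close>
lemma min_deviation_finite:
  fixes T :: "(real ^ 'n) set" and U :: "(real ^ 'm) set"
  assumes T: "finite T" "T \<noteq> {}" "T \<subseteq> sphere 0 1" and U: "finite U" "U \<noteq> {}" "U \<subseteq> sphere 0 1" and \<theta>: "\<theta> > 0"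
  shows "measure gauss_space {w. \<exists>y\<in>T. \<forall>u\<in>U. u \<bullet> (mat_of w *v y) < gaussian_width U - gaussian_width T - \<theta>}
    \<le> exp (- \<theta>\<^sup>2 / 2)"
proof -
  define cX where "cX y u = (\<lambda>(i, j). u $ i * y $ j)" for y :: "real ^ 'n" and u :: "real ^ 'm"
  define cY where "cY y u = (\<lambda>k. case k of Inl i \<Rightarrow> u $ i | Inr j \<Rightarrow> - y $ j)" for y :: "real ^ 'n" and u :: "real ^ 'm"
  define h where "h w = sup_inner U (\<chi> i. w (Inl i)) - sup_inner T (\<chi> j. w (Inr j))" for w :: "'m + 'n \<Rightarrow> real"
  have X: "gauss_field cX w y u = u \<bullet> (mat_of w *v y)" for w y u
    unfolding gauss_field_def inner_mat_of cX_def by (simp add: case_prod_unfold)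
  have Y: "gauss_field cY w y u = u \<bullet> (\<chi> i. w (Inl i)) - y \<bullet> (\<chi> j. w (Inr j))" for w y u
    unfolding gauss_field_def cY_def sum_Inl_Inr by (simp add: inner_vec_def sum_negf)
  have CX: "(\<Sum>k\<in>UNIV. cX y u k * cX y' u' k) = (u \<bullet> u') * (y \<bullet> y')" for y u y' u'
    unfolding cX_def using cov_matrix[of u y u' y'] by (simp add: case_prod_unfold)
  have CY: "(\<Sum>k\<in>UNIV. cY y u k * cY y' u' k) = u \<bullet> u' + y \<bullet> y'" for y u y' u'
    unfolding cY_def sum_Inl_Inr by (simp add: inner_vec_def)
  have hb: "has_bochner_integral gauss_space h (gaussian_width U - gaussian_width T)"
    unfolding h_def using T U by (intro has_bochner_integral_diff sup_inner_coords) auto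
  have "measure gauss_space {w. \<exists>y\<in>T. \<forall>u\<in>U. gauss_field cX w y u < (\<integral>w. h w \<partial>gauss_space) - \<theta>} \<le> exp (- \<theta>\<^sup>2 / 2)"
  proof (rule gordon_deviation[where cY = cY and \<kappa> = 1])
    show "(\<Sum>k\<in>UNIV. (cX y u k)\<^sup>2) \<le> 1" if "y \<in> T" "u \<in> U" for y u
      using that T U CX[of y u y u] by (simp add: power2_eq_square inner_sphere_self subset_iff)
    show "(\<Sum>k\<in>UNIV. cX y u k * cX y u' k) + 1 = (\<Sum>k\<in>UNIV. cY y u k * cY y u' k)"
      if "y \<in> T" "u \<in> U" "u' \<in> U" for y u u'
    proof -
      have "y \<bullet> y = 1" using that T by (intro inner_sphere_self) auto
      then show ?thesis unfolding CX CY by simp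
    qed
    show "(\<Sum>k\<in>UNIV. cY y u k * cY y' u' k) \<le> (\<Sum>k\<in>UNIV. cX y u k * cX y' u' k) + 1"
      if "y \<in> T" "y' \<in> T" "u \<in> U" "u' \<in> U" for y y' u u'
    proof -
      have "y \<bullet> y' \<le> 1" "u \<bullet> u' \<le> 1" using that T U by (auto intro!: inner_sphere_le)
      then have "0 \<le> (1 - y \<bullet> y') * (1 - u \<bullet> u')" by simp
      then show ?thesis unfolding CX CY by (simp add: algebra_simps)
    qed
    show "\<exists>u\<in>U. h w \<le> gauss_field cY w y u" if y: "y \<in> T" for w y
    proof -
      obtain u where u: "u \<in> U" "sup_inner U (\<chi> i. w (Inl i)) = u \<bullet> (\<chi> i. w (Inl i))"
        using sup_inner_attained[OF U(1,2)] by blast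
      have "y \<bullet> (\<chi> j. w (Inr j)) \<le> sup_inner T (\<chi> j. w (Inr j))" using T y by (intro sup_inner_upper)
      then show ?thesis using u unfolding h_def Y by (intro bexI[of _ u]) auto
    qed
  qed (use T U \<theta> hb in \<open>auto intro: integrable.intros\<close>)
  then show ?thesis unfolding X has_bochner_integral_integral_eq[OF hb] .
qed

text \<open>Now \<open>X\<close> has the entries \<open>- (u \<bullet> (S y))\<close> and \<open>Y\<close> the entries \<open>- (u \<bullet> g + y \<bullet> h)\<close>, with the pairs
  \<open>(y, u)\<close> as first index and a single second index. The covariances are as before. The equality of covariances is then required for equal pairs only, and the minimum of the negated
  field is the negative of the maximum.\<close>
lemma max_deviation_finite:
  fixes T :: "(real ^ 'n) set" and U :: "(real ^ 'm) set"
  assumes T: "finite T" "T \<noteq> {}" "T \<subseteq> sphere 0 1" and U: "finite U" "U \<noteq> {}" "U \<subseteq> sphere 0 1" and \<theta>: "\<theta> > 0"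
  shows "measure gauss_space {w. \<exists>y\<in>T. \<exists>u\<in>U. u \<bullet> (mat_of w *v y) > gaussian_width U + gaussian_width T + \<theta>}
    \<le> exp (- \<theta>\<^sup>2 / 2)"
proof -
  define cX where "cX a z = (\<lambda>(i, j). - (snd a $ i * fst a $ j))" for a :: "(real ^ 'n) \<times> (real ^ 'm)" and z :: unit
  define cY where "cY a z = (\<lambda>k. case k of Inl i \<Rightarrow> - snd a $ i | Inr j \<Rightarrow> - fst a $ j)"
    for a :: "(real ^ 'n) \<times> (real ^ 'm)" and z :: unit
  define h where "h w = - (sup_inner U (\<chi> i. w (Inl i)) + sup_inner T (\<chi> j. w (Inr j)))" for w :: "'m + 'n \<Rightarrow> real"
  have X: "gauss_field cX w a z = - (snd a \<bullet> (mat_of w *v fst a))" for w a z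
    unfolding gauss_field_def inner_mat_of cX_def by (simp add: case_prod_unfold sum_negf)
  have Y: "gauss_field cY w a z = - (snd a \<bullet> (\<chi> i. w (Inl i)) + fst a \<bullet> (\<chi> j. w (Inr j)))" for w a z
    unfolding gauss_field_def cY_def sum_Inl_Inr by (simp add: inner_vec_def sum_negf)
  have CX: "(\<Sum>k\<in>UNIV. cX a z k * cX a' z' k) = (snd a \<bullet> snd a') * (fst a \<bullet> fst a')" for a z a' z'
    unfolding cX_def using cov_matrix[of "snd a" "fst a" "snd a'" "fst a'"] by (simp add: case_prod_unfold)
  have CY: "(\<Sum>k\<in>UNIV. cY a z k * cY a' z' k) = snd a \<bullet> snd a' + fst a \<bullet> fst a'" for a z a' z'
    unfolding cY_def sum_Inl_Inr by (simp add: inner_vec_def)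
  have hb: "has_bochner_integral gauss_space h (- (gaussian_width U + gaussian_width T))"
    unfolding h_def using T U by (intro has_bochner_integral_minus has_bochner_integral_add sup_inner_coords) auto
  have one: "fst a \<bullet> fst a = 1" "snd a \<bullet> snd a = 1" if "a \<in> T \<times> U" for a
    using that T U by (auto intro!: inner_sphere_self)
  have "measure gauss_space {w. \<exists>a\<in>T \<times> U. \<forall>z\<in>{()}. gauss_field cX w a z < (\<integral>w. h w \<partial>gauss_space) - \<theta>} \<le> exp (- \<theta>\<^sup>2 / 2)"
  proof (rule gordon_deviation[where cY = cY and \<kappa> = 1])
    show "(\<Sum>k\<in>UNIV. (cX a z k)\<^sup>2) \<le> 1" if "a \<in> T \<times> U" for a z
      using CX[of a z a z] one[OF that] by (simp add: power2_eq_square)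
    show "(\<Sum>k\<in>UNIV. cX a z k * cX a z' k) + 1 = (\<Sum>k\<in>UNIV. cY a z k * cY a z' k)"
      if "a \<in> T \<times> U" for a z z'
      using one[OF that] unfolding CX CY by simp
    show "(\<Sum>k\<in>UNIV. cY a z k * cY a' z' k) \<le> (\<Sum>k\<in>UNIV. cX a z k * cX a' z' k) + 1"
      if "a \<in> T \<times> U" "a' \<in> T \<times> U" for a a' z z'
    proof -
      have "fst a \<bullet> fst a' \<le> 1" "snd a \<bullet> snd a' \<le> 1" using that T U by (auto intro!: inner_sphere_le)
      then have "0 \<le> (1 - fst a \<bullet> fst a') * (1 - snd a \<bullet> snd a')" by simp
      then show ?thesis unfolding CX CY by (simp add: algebra_simps)
    qed
    show "\<exists>z\<in>{()}. h w \<le> gauss_field cY w a z" if a: "a \<in> T \<times> U" for w a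
    proof -
      have "fst a \<bullet> (\<chi> j. w (Inr j)) \<le> sup_inner T (\<chi> j. w (Inr j))" "snd a \<bullet> (\<chi> i. w (Inl i)) \<le> sup_inner U (\<chi> i. w (Inl i))"
        using T U a by (auto intro!: sup_inner_upper)
      then show ?thesis unfolding h_def Y by simp
    qed
  qed (use T U \<theta> hb in \<open>auto intro: integrable.intros\<close>)
  moreover have "{w. \<exists>a\<in>T \<times> U. \<forall>z\<in>{()}. gauss_field cX w a z < (\<integral>w. h w \<partial>gauss_space) - \<theta>}
    = {w. \<exists>y\<in>T. \<exists>u\<in>U. u \<bullet> (mat_of w *v y) > gaussian_width U + gaussian_width T + \<theta>}"
    unfolding X has_bochner_integral_integral_eq[OF hb] by (auto simp: algebra_simps; force)
  ultimately show ?thesis by simp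
qed

lemma dense_sequence:
  fixes S :: "'a::{metric_space,second_countable_topology} set"
  assumes "S \<noteq> {}"
  shows "\<exists>d :: nat \<Rightarrow> 'a. range d \<subseteq> S \<and> (\<forall>U. open U \<longrightarrow> U \<inter> S \<noteq> {} \<longrightarrow> (\<exists>k. d k \<in> U))"
proof -
  obtain D where D: "countable D" "D \<subseteq> S" "S \<subseteq> closure D"
    by (rule separable)
  then have "D \<noteq> {}" using assms by auto
  then have r: "range (from_nat_into D) = D" using D by (simp add: range_from_nat_into)
  show ?thesis
  proof (intro exI[of _ "from_nat_into D"] conjI allI impI)
    show "range (from_nat_into D) \<subseteq> S" using r D by simp
    fix U :: "'a set" assume "open U" "U \<inter> S \<noteq> {}"
    then have "U \<inter> closure D \<noteq> {}" using D by blast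
    then have "U \<inter> D \<noteq> {}" using \<open>open U\<close> by (simp add: open_Int_closure_eq_empty)
    then show "\<exists>k. from_nat_into D k \<in> U" using r by (metis IntE ex_in_conv rangeE)
  qed
qed

text \<open>The support functions of the initial segments increase to that of the whole set, and all of them
  are dominated by the norm.\<close>
lemma width_dense:
  fixes S :: "(real ^ 'n) set"
  assumes S: "S \<subseteq> sphere 0 1" "S \<noteq> {}" and d: "range d \<subseteq> S" "\<And>U. open U \<Longrightarrow> U \<inter> S \<noteq> {} \<Longrightarrow> \<exists>k. d k \<in> U"
  shows "(\<lambda>n. gaussian_width (d ` {..n::nat})) \<longlonglongrightarrow> gaussian_width S"
  unfolding gaussian_width_eq
proof (rule integral_dominated_convergence[where w = norm])
  have sub: "d ` {..n} \<subseteq> S" "d ` {..n} \<subseteq> sphere 0 1" "d ` {..n} \<noteq> {}" for n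
    using d S by auto
  show "sup_inner S \<in> borel_measurable std_gaussian" "sup_inner (d ` {..n}) \<in> borel_measurable std_gaussian" for n
    using sup_inner_measurable[OF S] sup_inner_measurable[OF sub(2,3)] by (simp_all add: measurable_cong_sets[OF sets_std_gaussian refl])
  show "integrable std_gaussian norm" by (rule integrable.intros[OF norm_std_gaussian])
  show "AE g in std_gaussian. norm (sup_inner (d ` {..n}) g) \<le> norm g" for n
    using sup_inner_abs_le[OF sub(2,3)] by simp
  have "(\<lambda>n. sup_inner (d ` {..n}) g) \<longlonglongrightarrow> sup_inner S g" for g
  proof (rule order_tendstoI)
    fix a assume "a < sup_inner S g"
    then obtain v where v: "v \<in> S" "a < v \<bullet> g"
      unfolding sup_inner_def using S sup_inner_bdd[OF S(1)] by (subst (asm) less_cSUP_iff) auto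
    have "open {v. a < v \<bullet> g}" by (intro open_Collect_less continuous_intros)
    then obtain k where k: "a < d k \<bullet> g" using d(2)[of "{v. a < v \<bullet> g}"] v by auto
    have "a < sup_inner (d ` {..n}) g" if "n \<ge> k" for n
      using k sup_inner_upper[OF sub(2), of "d k" n g] that by force
    then show "eventually (\<lambda>n. a < sup_inner (d ` {..n}) g) sequentially"
      unfolding eventually_sequentially by blast
  next
    fix a assume "sup_inner S g < a"
    then show "eventually (\<lambda>n. sup_inner (d ` {..n}) g < a) sequentially"
      using sup_inner_mono[OF sub(1) S(1) sub(3)] by (intro always_eventually allI) (rule order_le_less_trans)
  qed
  then show "AE g in std_gaussian. (\<lambda>n. sup_inner (d ` {..n}) g) \<longlonglongrightarrow> sup_inner S g" by simp
qed

lemma mat_norm_measurable: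
  "(\<lambda>w. norm (mat_of w *v y)) \<in> borel_measurable gauss_space" for y :: "real ^ 'n"
proof -
  have [measurable]: "(\<lambda>w :: 'm::finite \<times> 'n \<Rightarrow> real. (mat_of w *v y) $ i) \<in> borel_measurable gauss_space" for i
    unfolding mat_of_def matrix_vector_mult_def by simp
  show ?thesis unfolding norm_vec_def L2_set_def by measurable
qed

lemma mat_inner_measurable:
  "(\<lambda>w. u \<bullet> (mat_of w *v y)) \<in> borel_measurable gauss_space" for y :: "real ^ 'n" and u :: "real ^ 'm"
  unfolding inner_mat_of by simp

text \<open>Finite pieces of dense sequences of \<open>T\<close> and of the unit sphere approximate the event from inside.
  The thresholds \<open>r n\<close> increase to the limit because the widths of the pieces of the sphere increase
  to \<open>gauss_b\<close>, while the width of a piece of \<open>T\<close> is bounded by that of \<open>T\<close>. Hence the finite events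
  increase to the event in question, and the bound passes to their union.\<close>
lemma min_deviation:
  fixes T :: "(real ^ 'n) set"
  assumes T: "T \<subseteq> sphere 0 1" "T \<noteq> {}" and \<theta>: "\<theta> > 0"
  defines "E \<equiv> {w :: 'm::finite \<times> 'n \<Rightarrow> real. \<exists>y\<in>T. norm (mat_of w *v y) < gauss_b CARD('m) - gaussian_width T - \<theta>}"
  shows "E \<in> sets gauss_space" and "measure gauss_space E \<le> exp (- \<theta>\<^sup>2 / 2)"
proof -
  let ?U = "sphere 0 1 :: (real ^ 'm) set"
  from dense_sequence[OF T(2)] obtain d :: "nat \<Rightarrow> real ^ 'n"
    where "range d \<subseteq> T \<and> (\<forall>U. open U \<longrightarrow> U \<inter> T \<noteq> {} \<longrightarrow> (\<exists>k. d k \<in> U))" ..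
  note d = conjunct1[OF this] conjunct2[OF this, rule_format]
  from dense_sequence[OF sphere_ne] obtain e :: "nat \<Rightarrow> real ^ 'm"
    where "range e \<subseteq> ?U \<and> (\<forall>U. open U \<longrightarrow> U \<inter> ?U \<noteq> {} \<longrightarrow> (\<exists>k. e k \<in> U))" ..
  note e = conjunct1[OF this] conjunct2[OF this, rule_format]
  have subT: "d ` {..n} \<subseteq> T" "d ` {..n} \<subseteq> sphere 0 1" for n using d T by auto
  have subU: "e ` {..n} \<subseteq> sphere 0 1" for n using e by auto
  define r where "r n = gaussian_width (e ` {..n}) - gaussian_width T - \<theta>" for n :: nat
  define A where "A n = {w :: 'm \<times> 'n \<Rightarrow> real. \<exists>y\<in>d ` {..n}. norm (mat_of w *v y) < r n}" for n :: nat
  have r_mono: "r m \<le> r n" if "m \<le> n" for m n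
    unfolding r_def using that subU by (intro diff_right_mono width_mono) auto
  have r_lim: "r \<longlonglongrightarrow> gauss_b CARD('m) - gaussian_width T - \<theta>"
    unfolding r_def width_sphere[symmetric]
    by (intro tendsto_intros width_dense sphere_ne e order_refl)
  have r_le: "r n \<le> gauss_b CARD('m) - gaussian_width T - \<theta>" for n
    unfolding r_def width_sphere[symmetric] using subU by (intro diff_right_mono width_mono) auto
  have A_sets: "A n \<in> sets gauss_space" for n
  proof -
    have "A n = (\<Union>y\<in>d ` {..n}. {w \<in> space gauss_space. norm (mat_of w *v y) < r n})"
      unfolding A_def by auto
    also have "\<dots> \<in> sets gauss_space"
      by (intro sets.finite_UN borel_measurable_less mat_norm_measurable) auto
    finally show ?thesis .
  qed
  have fin_sets: "{w :: 'm \<times> 'n \<Rightarrow> real. \<exists>y\<in>S. \<forall>u\<in>V. u \<bullet> (mat_of w *v y) < c} \<in> sets gauss_space"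
    if "finite S" "finite V" "V \<noteq> {}" for S V c
  proof -
    have "{w :: 'm \<times> 'n \<Rightarrow> real. \<exists>y\<in>S. \<forall>u\<in>V. u \<bullet> (mat_of w *v y) < c}
      = (\<Union>y\<in>S. \<Inter>u\<in>V. {w \<in> space gauss_space. u \<bullet> (mat_of w *v y) < c})" by auto
    also have "\<dots> \<in> sets gauss_space"
      using that by (intro sets.finite_UN sets.finite_INT borel_measurable_less mat_inner_measurable) auto
    finally show ?thesis .
  qed
  have A_le: "measure gauss_space (A n) \<le> exp (- \<theta>\<^sup>2 / 2)" for n
  proof -
    let ?B = "{w :: 'm \<times> 'n \<Rightarrow> real. \<exists>y\<in>d ` {..n}. \<forall>u\<in>e ` {..n}. u \<bullet> (mat_of w *v y) < gaussian_width (e ` {..n}) - gaussian_width (d ` {..n}) - \<theta>}"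
    have "A n \<subseteq> ?B"
    proof
      fix w assume "w \<in> A n"
      then obtain y where y: "y \<in> d ` {..n}" "norm (mat_of w *v y) < r n" unfolding A_def by blast
      have "gaussian_width (d ` {..n}) \<le> gaussian_width T" using subT T by (intro width_mono) auto
      then have "r n \<le> gaussian_width (e ` {..n}) - gaussian_width (d ` {..n}) - \<theta>" unfolding r_def by simp
      moreover have "u \<bullet> (mat_of w *v y) \<le> norm (mat_of w *v y)" if "u \<in> e ` {..n}" for u
        using that subU by (intro inner_le_norm) blast
      ultimately have "\<forall>u\<in>e ` {..n}. u \<bullet> (mat_of w *v y) < gaussian_width (e ` {..n}) - gaussian_width (d ` {..n}) - \<theta>"
        using y(2) by (meson le_less_trans less_le_trans)
      then show "w \<in> ?B" using y(1) by blast
    qed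
    then have "measure gauss_space (A n) \<le> measure gauss_space ?B"
      by (rule gauss_space.finite_measure_mono) (rule fin_sets, auto)
    also have "\<dots> \<le> exp (- \<theta>\<^sup>2 / 2)"
      by (rule min_deviation_finite) (use subT subU \<theta> in simp_all)
    finally show ?thesis .
  qed
  have inc: "incseq A"
  proof (rule incseq_SucI, rule subsetI)
    fix n w assume "w \<in> A n"
    then obtain y where y: "y \<in> d ` {..n}" "norm (mat_of w *v y) < r n" unfolding A_def by blast
    have "r n \<le> r (Suc n)" by (rule r_mono) simp
    with y(2) have "norm (mat_of w *v y) < r (Suc n)" by linarith
    moreover have "y \<in> d ` {..Suc n}" using y(1) by auto
    ultimately show "w \<in> A (Suc n)" unfolding A_def by blast
  qed
  have un: "(\<Union>n. A n) = E"
  proof (intro equalityI subsetI)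
    fix w assume "w \<in> (\<Union>n. A n)"
    then obtain n y where y: "y \<in> d ` {..n}" "norm (mat_of w *v y) < r n" unfolding A_def by blast
    then have "y \<in> T" using subT by blast
    moreover have "norm (mat_of w *v y) < gauss_b CARD('m) - gaussian_width T - \<theta>"
      using y(2) r_le[of n] by linarith
    ultimately show "w \<in> E" unfolding E_def by blast
  next
    fix w assume "w \<in> E"
    then obtain y where y: "y \<in> T" "norm (mat_of w *v y) < gauss_b CARD('m) - gaussian_width T - \<theta>"
      unfolding E_def by blast
    obtain c where c: "norm (mat_of w *v y) < c" "c < gauss_b CARD('m) - gaussian_width T - \<theta>"
      using dense[OF y(2)] by blast
    have "open {y. norm (mat_of w *v y) < c}"
      by (intro open_Collect_less continuous_intros)
    then obtain k where k: "norm (mat_of w *v d k) < c"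
      using d(2)[of "{y. norm (mat_of w *v y) < c}"] y c by blast
    obtain N where N: "\<And>n. n \<ge> N \<Longrightarrow> c < r n"
      using order_tendstoD(1)[OF r_lim c(2)] unfolding eventually_sequentially by blast
    have "norm (mat_of w *v d k) < r (max k N)" using k N[of "max k N"] by simp
    then have "w \<in> A (max k N)" unfolding A_def by auto
    then show "w \<in> (\<Union>n. A n)" by blast
  qed
  show "E \<in> sets gauss_space" unfolding un[symmetric] using A_sets by blast
  have "(\<lambda>n. measure gauss_space (A n)) \<longlonglongrightarrow> measure gauss_space (\<Union>n. A n)"
    using A_sets by (intro gauss_space.finite_Lim_measure_incseq inc) auto
  then show "measure gauss_space E \<le> exp (- \<theta>\<^sup>2 / 2)"
    unfolding un by (rule LIMSEQ_le_const2) (use A_le in auto)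
qed

text \<open>For the upper bound the threshold may be kept fixed, as the widths of the finite pieces stay below
  those of the full sets.\<close>
lemma max_deviation:
  fixes T :: "(real ^ 'n) set"
  assumes T: "T \<subseteq> sphere 0 1" "T \<noteq> {}" and \<theta>: "\<theta> > 0"
  defines "E \<equiv> {w :: 'm::finite \<times> 'n \<Rightarrow> real. \<exists>y\<in>T. norm (mat_of w *v y) > gauss_b CARD('m) + gaussian_width T + \<theta>}"
  shows "E \<in> sets gauss_space" and "measure gauss_space E \<le> exp (- \<theta>\<^sup>2 / 2)"
proof -
  let ?U = "sphere 0 1 :: (real ^ 'm) set"
  let ?r = "gauss_b CARD('m) + gaussian_width T + \<theta>"
  from dense_sequence[OF T(2)] obtain d :: "nat \<Rightarrow> real ^ 'n"
    where "range d \<subseteq> T \<and> (\<forall>U. open U \<longrightarrow> U \<inter> T \<noteq> {} \<longrightarrow> (\<exists>k. d k \<in> U))" ..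
  note d = conjunct1[OF this] conjunct2[OF this, rule_format]
  from dense_sequence[OF sphere_ne] obtain e :: "nat \<Rightarrow> real ^ 'm"
    where "range e \<subseteq> ?U \<and> (\<forall>U. open U \<longrightarrow> U \<inter> ?U \<noteq> {} \<longrightarrow> (\<exists>k. e k \<in> U))" ..
  note e = conjunct1[OF this] conjunct2[OF this, rule_format]
  have subT: "d ` {..n} \<subseteq> T" "d ` {..n} \<subseteq> sphere 0 1" for n using d T by auto
  have subU: "e ` {..n} \<subseteq> sphere 0 1" for n using e by auto
  define A where "A n c = {w :: 'm \<times> 'n \<Rightarrow> real. \<exists>y\<in>d ` {..n}. \<exists>u\<in>e ` {..n}. u \<bullet> (mat_of w *v y) > c}" for n :: nat and c
  have A_sets: "A n c \<in> sets gauss_space" for n c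
  proof -
    have "A n c = (\<Union>y\<in>d ` {..n}. \<Union>u\<in>e ` {..n}. {w \<in> space gauss_space. c < u \<bullet> (mat_of w *v y)})"
      unfolding A_def by auto
    also have "\<dots> \<in> sets gauss_space"
      by (intro sets.finite_UN borel_measurable_less mat_inner_measurable) auto
    finally show ?thesis .
  qed
  have A_le: "measure gauss_space (A n ?r) \<le> exp (- \<theta>\<^sup>2 / 2)" for n
  proof -
    let ?c = "gaussian_width (e ` {..n}) + gaussian_width (d ` {..n}) + \<theta>"
    have "gaussian_width (d ` {..n}) \<le> gaussian_width T" using subT T by (intro width_mono) auto
    moreover have "gaussian_width (e ` {..n}) \<le> gauss_b CARD('m)"
      unfolding width_sphere[symmetric] using subU by (intro width_mono) auto
    ultimately have "A n ?r \<subseteq> A n ?c" unfolding A_def by force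
    then have "measure gauss_space (A n ?r) \<le> measure gauss_space (A n ?c)"
      by (intro gauss_space.finite_measure_mono A_sets)
    also have "\<dots> \<le> exp (- \<theta>\<^sup>2 / 2)"
      unfolding A_def by (rule max_deviation_finite) (use subT subU \<theta> in simp_all)
    finally show ?thesis .
  qed
  have inc: "incseq (\<lambda>n. A n ?r)"
    unfolding A_def by (rule incseq_SucI) force
  have un: "(\<Union>n. A n ?r) = E"
  proof (intro equalityI subsetI)
    fix w assume "w \<in> (\<Union>n. A n ?r)"
    then obtain n y u where y: "y \<in> d ` {..n}" "u \<in> e ` {..n}" "?r < u \<bullet> (mat_of w *v y)" unfolding A_def by blast
    then have "y \<in> T" using subT by blast
    moreover have "u \<bullet> (mat_of w *v y) \<le> norm (mat_of w *v y)"
      using y subU by (intro inner_le_norm) blast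
    then have "?r < norm (mat_of w *v y)" using y(3) by linarith
    ultimately show "w \<in> E" unfolding E_def by blast
  next
    fix w assume "w \<in> E"
    then obtain y where y: "y \<in> T" "?r < norm (mat_of w *v y)"
      unfolding E_def by blast
    have "open {y. ?r < norm (mat_of w *v y)}"
      by (intro open_Collect_less continuous_intros)
    then obtain k where k: "?r < norm (mat_of w *v d k)"
      using d(2)[of "{y. ?r < norm (mat_of w *v y)}"] y by blast
    then have "?r < sup_inner ?U (mat_of w *v d k)" unfolding sup_inner_sphere .
    then obtain v where v: "v \<in> ?U" "?r < v \<bullet> (mat_of w *v d k)"
      unfolding sup_inner_def using sphere_ne sup_inner_bdd[of ?U] by (subst (asm) less_cSUP_iff) auto
    have "open {v. ?r < v \<bullet> (mat_of w *v d k)}"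
      by (intro open_Collect_less continuous_intros)
    then obtain l where l: "?r < e l \<bullet> (mat_of w *v d k)"
      using e(2)[of "{v. ?r < v \<bullet> (mat_of w *v d k)}"] v by blast
    then have "w \<in> A (max k l) ?r" unfolding A_def by force
    then show "w \<in> (\<Union>n. A n ?r)" by blast
  qed
  show "E \<in> sets gauss_space" unfolding un[symmetric] using A_sets by blast
  have "(\<lambda>n. measure gauss_space (A n ?r)) \<longlonglongrightarrow> measure gauss_space (\<Union>n. A n ?r)"
    using A_sets by (intro gauss_space.finite_Lim_measure_incseq inc) auto
  then show "measure gauss_space E \<le> exp (- \<theta>\<^sup>2 / 2)"
    unfolding un by (rule LIMSEQ_le_const2) (use A_le in auto)
qed

lemma inner_std_gaussian_sq:
  fixes a :: "real ^ 'n"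
  shows "has_bochner_integral std_gaussian (\<lambda>g. (a \<bullet> g)\<^sup>2) ((norm a)\<^sup>2)"
proof -
  have e: "a \<bullet> (\<chi> i. w i) = (\<Sum>i\<in>UNIV. a $ i * w i)" for w by (simp add: inner_vec_def)
  have "integrable (distr gauss_space borel (\<lambda>w. \<chi> i. w i)) (\<lambda>g. (a \<bullet> g)\<^sup>2)"
    by (subst integrable_distr_eq) (auto simp: e integrable_linear_sq)
  moreover have "(\<integral>g. (a \<bullet> g)\<^sup>2 \<partial>distr gauss_space borel (\<lambda>w. \<chi> i. w i)) = (\<Sum>i\<in>UNIV. (a $ i)\<^sup>2)"
    by (subst integral_distr) (auto simp: e integral_linear_sq)
  ultimately show ?thesis
    unfolding std_gaussian_eq_distr[symmetric]
    by (simp add: has_bochner_integral_iff norm_vec_def L2_set_def sum_nonneg)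
qed

text \<open>If \<open>P\<close> is the orthogonal projection onto \<open>V\<close>, then \<open>v \<bullet> g\<close> is at most the norm of \<open>P g\<close> for unit
  vectors \<open>v\<close> of \<open>V\<close>. By the inequality between geometric and arithmetic mean this is at most
  \<open>(Z g / s + s) / 2\<close> with \<open>Z g\<close> the squared norm of \<open>P g\<close> and \<open>s = sqrt k\<close>, and the mean of \<open>Z\<close> is the
  dimension of \<open>V\<close>.\<close>
lemma width_subspace:
  fixes V :: "(real ^ 'n) set"
  assumes V: "subspace V" "dim V \<le> k" and S: "S \<subseteq> V \<inter> sphere 0 1" "S \<noteq> {}" and k: "k > 0"
  shows "gaussian_width S \<le> sqrt (real k)"
proof -
  obtain B where B: "B \<subseteq> V" "pairwise orthogonal B" "\<And>x. x \<in> B \<Longrightarrow> norm x = 1" "independent B" "card B = dim V" "span B = V"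
    using orthonormal_basis_subspace[OF V(1)] by blast
  have finB: "finite B" using B(4) by (rule independent_imp_finite)
  let ?s = "sqrt (real k)"
  have s: "?s > 0" using k by simp
  define Z where "Z g = (\<Sum>b\<in>B. (b \<bullet> g)\<^sup>2)" for g
  have hZ: "has_bochner_integral std_gaussian Z (\<Sum>b\<in>B. (norm b)\<^sup>2)"
    unfolding Z_def by (intro has_bochner_integral_sum inner_std_gaussian_sq)
  have pt: "v \<bullet> g \<le> (Z g / ?s + ?s) / 2" if v: "v \<in> S" for v g
  proof -
    have vV: "v \<in> span B" and nv: "norm v = 1" using v S B by auto
    have rep: "(\<Sum>b\<in>B. (v \<bullet> b) *\<^sub>R b) = v"
      using orthonormal_basis_expand[OF B(2,3) vV finB] by simp
    have vg: "v \<bullet> g = (\<Sum>b\<in>B. (v \<bullet> b) * (b \<bullet> g))" for g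
    proof -
      have "v \<bullet> g = (\<Sum>b\<in>B. (v \<bullet> b) *\<^sub>R b) \<bullet> g" by (simp only: rep)
      then show ?thesis by (simp add: inner_sum_left)
    qed
    have vv: "(\<Sum>b\<in>B. (v \<bullet> b) * (v \<bullet> b)) = 1"
      using vg[of v] nv by (simp add: dot_square_norm inner_commute)
    have "0 \<le> (\<Sum>b\<in>B. (?s * (v \<bullet> b) - b \<bullet> g)\<^sup>2)" by (intro sum_nonneg) auto
    also have "\<dots> = ?s\<^sup>2 * (\<Sum>b\<in>B. (v \<bullet> b) * (v \<bullet> b)) - 2 * ?s * (\<Sum>b\<in>B. (v \<bullet> b) * (b \<bullet> g)) + Z g"
      unfolding Z_def by (simp add: power2_eq_square sum_distrib_left sum_subtractf sum.distrib algebra_simps)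
    also have "\<dots> = ?s\<^sup>2 - 2 * ?s * (v \<bullet> g) + Z g" by (simp only: vv vg[of g] mult_1_right)
    finally have "2 * ?s * (v \<bullet> g) \<le> Z g + ?s\<^sup>2" by simp
    then show ?thesis using s by (simp add: field_simps power2_eq_square)
  qed
  have S': "S \<subseteq> sphere 0 1" using S by auto
  have I: "integrable std_gaussian (\<lambda>g. (Z g / ?s + ?s) / 2)"
    using integrable.intros[OF hZ] by simp
  have "gaussian_width S \<le> (\<integral>g. (Z g / ?s + ?s) / 2 \<partial>std_gaussian)"
    unfolding gaussian_width_eq
  proof (intro integral_mono sup_inner_integrable S' S I)
    show "sup_inner S g \<le> (Z g / ?s + ?s) / 2" for g
      unfolding sup_inner_def using S pt by (intro cSUP_least) auto
  qed
  also have "\<dots> = ((\<Sum>b\<in>B. (norm b)\<^sup>2) / ?s + ?s) / 2"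
    using integrable.intros[OF hZ] has_bochner_integral_integral_eq[OF hZ]
    by simp
  also have "(\<Sum>b\<in>B. (norm b)\<^sup>2) = real (dim V)" using B by simp
  also have "(real (dim V) / ?s + ?s) / 2 \<le> (real k / ?s + ?s) / 2"
    using V s by (intro divide_right_mono add_right_mono) auto
  also have "\<dots> = ?s" using s by (simp add: real_div_sqrt)
  finally show ?thesis .
qed

section \<open>The contraction factor\<close>

lemma quadratic_form:
  fixes M :: "real ^ 'd ^ 'm"
  shows "v \<bullet> ((mat 1 - \<eta> *\<^sub>R (transpose M ** M)) *v u) = v \<bullet> u - \<eta> * ((M *v v) \<bullet> (M *v u))"
proof -
  have "v \<bullet> ((transpose M ** M) *v u) = (M *v v) \<bullet> (M *v u)"
    by (metis dot_lmul_matrix inner_commute matrix_vector_mul_assoc transpose_matrix_vector)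
  then show ?thesis
    by (simp add: matrix_vector_mult_diff_rdistrib inner_diff_right flip: scaleR_matrix_vector_assoc)
qed

text \<open>Otherwise a small step from \<open>v\<close> against \<open>Q v\<close> makes the quadratic form negative. The denominator
  \<open>q + 1\<close> keeps the step small enough for the linear term to dominate.\<close>
lemma psd_null_vector:
  fixes Q :: "'a::real_inner \<Rightarrow> 'a"
  assumes lin: "linear Q" and sym: "\<And>x y. x \<bullet> Q y = Q x \<bullet> y" and psd: "\<And>x. 0 \<le> x \<bullet> Q x"
    and null: "v \<bullet> Q v = 0"
  shows "Q v = 0"
proof (rule ccontr)
  assume "Q v \<noteq> 0"
  \<comment> \<open>\<open>t\<close> below is the step length in the direction \<open>e\<close>.\<close>
  define e where "e = Q v"
  define q where "q = e \<bullet> Q e"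
  define t where "t = - (e \<bullet> e) / (q + 1)"
  have e: "e \<bullet> e > 0" using \<open>Q v \<noteq> 0\<close> by (simp add: e_def)
  have q: "q \<ge> 0" unfolding q_def by (rule psd)
  have "(v + t *\<^sub>R e) \<bullet> Q (v + t *\<^sub>R e) = v \<bullet> Q v + t * (v \<bullet> Q e) + t * (e \<bullet> Q v) + t * t * q"
    unfolding q_def by (simp add: linear_add[OF lin] linear_scale[OF lin] inner_add_left inner_add_right algebra_simps)
  also have "v \<bullet> Q e = e \<bullet> e" by (simp add: sym e_def)
  finally have "0 \<le> 2 * t * (e \<bullet> e) + t * t * q"
    using psd[of "v + t *\<^sub>R e"] null by (simp add: e_def)
  also have "\<dots> = t * (2 * (e \<bullet> e) + t * q)" by (simp add: algebra_simps)
  finally have 1: "0 \<le> t * (2 * (e \<bullet> e) + t * q)" .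
  have t: "t < 0" unfolding t_def using e q by (simp add: divide_neg_pos)
  have "t * q = - (e \<bullet> e) * (q / (q + 1))" unfolding t_def by simp
  moreover have "(e \<bullet> e) * (q / (q + 1)) \<le> (e \<bullet> e) * 1" using e q by (intro mult_left_mono) auto
  ultimately have "2 * (e \<bullet> e) + t * q > 0" using e by linarith
  with t have "t * (2 * (e \<bullet> e) + t * q) < 0" by (rule mult_neg_pos)
  with 1 show False by simp
qed

text \<open>Let \<open>s\<close> be the maximum of the squared norm of \<open>A z\<close> on the unit sphere, attained at \<open>v\<close>. Then \<open>v\<close> is
  a null vector of the positive semidefinite form of \<open>s I - A^T A\<close>, so it is an eigenvector of
  \<open>A^T A\<close> with eigenvalue \<open>s\<close>, and \<open>s\<close> is a singular value of \<open>A^T A\<close>.\<close>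
lemma norm_le_largest_singular_value:
  fixes A :: "real ^ 'd ^ 'n"
  shows "(norm (A *v z))\<^sup>2 \<le> largest_singular_value (transpose A ** A) * (norm z)\<^sup>2"
proof -
  let ?M = "transpose A ** A"
  have inner_M: "x \<bullet> (?M *v y) = (A *v x) \<bullet> (A *v y)" for x y
    by (metis dot_lmul_matrix inner_commute matrix_vector_mul_assoc transpose_matrix_vector)
  have "continuous_on (sphere 0 1) (\<lambda>z. (norm (A *v z))\<^sup>2)"
    by (intro continuous_intros)
  then obtain v where v: "v \<in> sphere 0 1" "\<And>z. z \<in> sphere 0 1 \<Longrightarrow> (norm (A *v z))\<^sup>2 \<le> (norm (A *v v))\<^sup>2"
    using continuous_attains_sup[OF compact_sphere sphere_ne] by blast
  define s where "s = (norm (A *v v))\<^sup>2"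
  have le: "(norm (A *v z))\<^sup>2 \<le> s * (norm z)\<^sup>2" for z
  proof (cases "z = 0")
    case False
    then have z: "z = norm z *\<^sub>R (z /\<^sub>R norm z)" by simp
    have "(norm (A *v z))\<^sup>2 = (norm z)\<^sup>2 * (norm (A *v (z /\<^sub>R norm z)))\<^sup>2"
      by (subst z) (simp add: matrix_vector_mult_scaleR power_mult_distrib)
    also have "\<dots> \<le> (norm z)\<^sup>2 * s"
      unfolding s_def using False by (intro mult_left_mono v(2)) auto
    finally show ?thesis by (simp add: mult.commute)
  qed simp
  define Q where "Q x = s *\<^sub>R x - ?M *v x" for x
  have Qi: "x \<bullet> Q y = s * (x \<bullet> y) - (A *v x) \<bullet> (A *v y)" for x y
    unfolding Q_def by (simp add: inner_diff_right inner_M)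
  have "Q v = 0"
  proof (rule psd_null_vector[of Q v])
    show "linear Q"
      unfolding Q_def
      by (rule linearI) (simp_all add: matrix_vector_right_distrib matrix_vector_mult_scaleR algebra_simps)
    show "x \<bullet> Q y = Q x \<bullet> y" for x y
      by (subst (2) inner_commute) (simp add: Qi inner_commute)
    show "0 \<le> x \<bullet> Q x" for x
      using le[of x] by (simp add: Qi dot_square_norm)
    show "v \<bullet> Q v = 0"
      using v(1) by (simp add: Qi dot_square_norm s_def)
  qed
  then have Mv: "?M *v v = s *\<^sub>R v" unfolding Q_def by simp
  have "transpose ?M = ?M" by (simp add: matrix_transpose_mul)
  then have "(transpose ?M ** ?M) *v v = s\<^sup>2 *\<^sub>R v"
    by (simp add: Mv matrix_vector_mult_scaleR power2_eq_square flip: matrix_vector_mul_assoc[of ?M ?M])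
  moreover have "v \<noteq> 0" using v(1) by auto
  ultimately have "is_singular_value ?M s"
    unfolding is_singular_value_def s_def by auto
  then have "s \<le> largest_singular_value ?M"
    unfolding largest_singular_value_def by (intro Max_ge finite_singular_values) simp
  then have "s * (norm z)\<^sup>2 \<le> largest_singular_value ?M * (norm z)\<^sup>2"
    by (intro mult_right_mono) auto
  with le[of z] show ?thesis by simp
qed

text \<open>The supremum is taken over a bounded nonempty set of reals, so it is a genuine least upper bound.\<close>
lemma contraction_factor_le_iff:
  fixes M :: "real ^ 'd ^ 'm"
  assumes "C \<inter> cball 0 1 \<noteq> {}"
  shows "contraction_factor C \<eta> M \<le> c \<longleftrightarrow>
    (\<forall>u\<in>C \<inter> cball 0 1. \<forall>v\<in>C \<inter> cball 0 1. v \<bullet> u - \<eta> * ((M *v v) \<bullet> (M *v u)) \<le> c)"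
proof -
  let ?D = "C \<inter> cball 0 1"
  let ?f = "\<lambda>(u, v). v \<bullet> u - \<eta> * ((M *v v) \<bullet> (M *v u))"
  let ?K = "onorm ((*v) M)"
  have K: "norm (M *v v) \<le> ?K" if "v \<in> ?D" for v
  proof -
    have "norm (M *v v) \<le> ?K * norm v" by (rule onorm) (rule matrix_vector_mul_bounded_linear)
    also have "\<dots> \<le> ?K * 1"
      using that by (intro mult_left_mono onorm_pos_le matrix_vector_mul_bounded_linear) auto
    finally show ?thesis by simp
  qed
  have "?f a \<le> 1 + \<bar>\<eta>\<bar> * (?K * ?K)" if aD: "a \<in> ?D \<times> ?D" for a
  proof -
    obtain u v where a: "a = (u, v)" "u \<in> ?D" "v \<in> ?D" using aD by (elim SigmaE)
    have "v \<bullet> u \<le> norm v * norm u" by (rule norm_cauchy_schwarz)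
    also have "\<dots> \<le> 1 * 1" using a by (intro mult_mono) auto
    finally have 1: "v \<bullet> u \<le> 1" by simp
    have "\<bar>(M *v v) \<bullet> (M *v u)\<bar> \<le> norm (M *v v) * norm (M *v u)" by (rule Cauchy_Schwarz_ineq2)
    also have "\<dots> \<le> ?K * ?K"
      using a K[of u] K[of v] order_trans[OF norm_ge_zero K] by (intro mult_mono) auto
    finally have "\<bar>\<eta>\<bar> * \<bar>(M *v v) \<bullet> (M *v u)\<bar> \<le> \<bar>\<eta>\<bar> * (?K * ?K)" by (intro mult_left_mono) auto
    then have "- (\<eta> * ((M *v v) \<bullet> (M *v u))) \<le> \<bar>\<eta>\<bar> * (?K * ?K)"
      unfolding abs_mult[symmetric] by linarith
    with 1 show ?thesis by (simp add: a)
  qed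
  then have bdd: "bdd_above (?f ` (?D \<times> ?D))" by (intro bdd_aboveI2)
  have "contraction_factor C \<eta> M = (SUP a\<in>?D \<times> ?D. ?f a)"
    unfolding contraction_factor_def by (intro SUP_cong refl) (auto simp: quadratic_form)
  then show ?thesis
    using cSUP_le_iff[OF _ bdd] assms by auto
qed

lemma distr_iid_std_normal:
  fixes S :: "'w \<Rightarrow> real ^ 'n ^ 'm"
  assumes "prob_space P" "iid_std_normal_matrix P S"
  shows "(\<lambda>\<omega> (i, j). S \<omega> $ i $ j) \<in> measurable P gauss_space"
    and "distr P gauss_space (\<lambda>\<omega> (i, j). S \<omega> $ i $ j) = gauss_space"
proof -
  interpret prob_space P by fact
  let ?X = "\<lambda>(i, j) \<omega>. S \<omega> $ i $ j"
  have ind: "indep_vars (\<lambda>_. borel) ?X UNIV" and dist: "\<And>i j. distributed P lborel (?X (i, j)) std_normal_density"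
    using assms(2) by (auto simp: iid_std_normal_matrix_def)
  have meas: "?X k \<in> borel_measurable P" for k
    using ind unfolding indep_vars_def by blast
  have eq: "(\<lambda>\<omega>. \<lambda>k\<in>UNIV. ?X k \<omega>) = (\<lambda>\<omega> (i, j). S \<omega> $ i $ j)"
    by (auto simp: fun_eq_iff)
  have "(\<lambda>\<omega>. \<lambda>k\<in>UNIV. ?X k \<omega>) \<in> measurable P (PiM UNIV (\<lambda>_. borel))"
    by (rule measurable_restrict) (rule meas)
  then show "(\<lambda>\<omega> (i, j). S \<omega> $ i $ j) \<in> measurable P gauss_space"
    unfolding eq by (simp add: measurable_cong_sets[OF refl sets_gauss_space])
  \<comment> \<open>\<open>distributed\<close> refers to \<open>lborel\<close>, the product measure to \<open>borel\<close>; the sigma-algebras agree.\<close>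
  have "distr P borel (?X k) = gauss1" for k
  proof -
    have "distr P lborel (?X k) = gauss1"
      using dist[of "fst k" "snd k"] by (simp add: distributed_def case_prod_unfold)
    moreover have "distr P borel (?X k) = distr P lborel (?X k)" by (rule distr_cong) auto
    ultimately show ?thesis by simp
  qed
  then have "distr P (PiM UNIV (\<lambda>_. borel)) (\<lambda>\<omega>. \<lambda>k\<in>UNIV. ?X k \<omega>) = gauss_space"
    using indep_vars_iff_distr_eq_PiM'[where I=UNIV and M'="\<lambda>_. borel" and X="?X"] ind meas
    by (simp add: gauss_space_def)
  moreover have "distr P gauss_space (\<lambda>\<omega> (i, j). S \<omega> $ i $ j) = distr P (PiM UNIV (\<lambda>_. borel)) (\<lambda>\<omega>. \<lambda>k\<in>UNIV. ?X k \<omega>)"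
    unfolding eq by (rule distr_cong) (auto simp: sets_gauss_space)
  ultimately show "distr P gauss_space (\<lambda>\<omega> (i, j). S \<omega> $ i $ j) = gauss_space" by simp
qed

lemma mat_of_measurable: "mat_of \<in> measurable gauss_space (borel :: (real ^ 'n ^ 'm) measure)"
proof (rule borel_measurable_euclidean_space[THEN iffD2], rule ballI)
  fix b :: "real ^ 'n ^ 'm" assume "b \<in> Basis"
  then obtain i j where "b = axis i (axis j 1)" by (auto simp: Basis_vec_def)
  then show "(\<lambda>w. mat_of w \<bullet> b) \<in> borel_measurable gauss_space"
    by (simp add: inner_axis mat_of_def)
qed

text \<open>The event of the theorem is measurable: it is the preimage of an intersection of closed sets of
  matrices.\<close>
lemma closed_contraction_le:
  fixes A :: "real ^ 'd ^ 'n"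
  assumes "C \<inter> cball 0 1 \<noteq> {}"
  shows "closed {M :: real ^ 'n ^ 'm. contraction_factor C \<eta> (M ** A) \<le> c}"
proof -
  have cont: "continuous_on UNIV (\<lambda>M :: real ^ 'n ^ 'm. M *v x)" for x
    unfolding matrix_vector_mult_def by (intro continuous_intros)
  have "{M :: real ^ 'n ^ 'm. contraction_factor C \<eta> (M ** A) \<le> c}
    = (\<Inter>u\<in>C \<inter> cball 0 1. \<Inter>v\<in>C \<inter> cball 0 1.
        {M. v \<bullet> u - \<eta> * ((M *v (A *v v)) \<bullet> (M *v (A *v u))) \<le> c})"
    unfolding contraction_factor_le_iff[OF assms] matrix_vector_mul_assoc by auto
  also have "closed \<dots>"
    by (intro closed_INT ballI closed_Collect_le continuous_intros cont)
  finally show ?thesis .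
qed

text \<open>Let \<open>q\<close> be the quadratic form of \<open>I - \<eta> (M A)^T (M A)\<close>. The upper bound on \<open>M\<close> over the range of \<open>A\<close>
  and the choice of \<open>\<eta>\<close> make it nonnegative, so \<open>q (u - v) \<ge> 0\<close> bounds the bilinear form at \<open>(u, v)\<close> by
  the mean of \<open>q u\<close> and \<open>q v\<close>. On the cone the lower bound on \<open>M\<close> and the restricted convexity give
  \<open>q z \<le> c * (norm z)\<^sup>2\<close>, where \<open>c\<close> is nonnegative since \<open>q z0\<close> is.\<close>
lemma contraction_factor_deterministic:
  fixes A :: "real ^ 'd ^ 'n" and M :: "real ^ 'n ^ 'm"
  assumes C: "cone C" "z0 \<in> C" "z0 \<noteq> 0"
    and L: "L > 0" "\<And>z. (norm (A *v z))\<^sup>2 \<le> L * (norm z)\<^sup>2"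
    and \<mu>: "\<mu> > 0" "\<And>z. z \<in> C \<Longrightarrow> \<mu> * (norm z)\<^sup>2 \<le> (norm (A *v z))\<^sup>2"
    and a: "a \<ge> 0" "\<And>y. y \<in> (\<lambda>z. A *v z) ` C \<inter> sphere 0 1 \<Longrightarrow> a \<le> norm (M *v y)"
    and B: "B > 0" "\<And>y. y \<in> range (\<lambda>z. A *v z) \<inter> sphere 0 1 \<Longrightarrow> norm (M *v y) \<le> B"
  shows "contraction_factor C (1 / (L * B\<^sup>2)) (M ** A) \<le> 1 - \<mu> / L * (a\<^sup>2 / B\<^sup>2)"
proof -
  let ?\<eta> = "1 / (L * B\<^sup>2)"
  let ?c = "1 - \<mu> / L * (a\<^sup>2 / B\<^sup>2)"
  have \<eta>: "?\<eta> > 0" using L B by simp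
  have norm: "norm (M *v (A *v z)) = norm (A *v z) * norm (M *v (A *v (z /\<^sub>R norm (A *v z))))" if "A *v z \<noteq> 0" for z
    using that by (simp add: matrix_vector_mult_scaleR)
  have sph: "A *v (z /\<^sub>R norm (A *v z)) \<in> sphere 0 1" if "A *v z \<noteq> 0" for z
    using that by (simp add: matrix_vector_mult_scaleR)
  have up: "(norm (M *v (A *v z)))\<^sup>2 \<le> B\<^sup>2 * (norm (A *v z))\<^sup>2" for z
  proof (cases "A *v z = 0")
    case False
    have "norm (M *v (A *v z)) \<le> norm (A *v z) * B"
      unfolding norm[OF False] using sph[OF False] by (intro mult_left_mono B(2)) auto
    then have "(norm (M *v (A *v z)))\<^sup>2 \<le> (norm (A *v z) * B)\<^sup>2" by (intro power_mono) auto
    then show ?thesis by (simp add: power_mult_distrib mult.commute)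
  qed simp
  have low: "a\<^sup>2 * (norm (A *v z))\<^sup>2 \<le> (norm (M *v (A *v z)))\<^sup>2" if z: "z \<in> C" for z
  proof (cases "A *v z = 0")
    case False
    have "z /\<^sub>R norm (A *v z) \<in> C" using C(1) z by (auto simp: cone_def)
    then have "norm (A *v z) * a \<le> norm (M *v (A *v z))"
      unfolding norm[OF False] using sph[OF False] by (intro mult_left_mono a(2)) auto
    then have "(norm (A *v z) * a)\<^sup>2 \<le> (norm (M *v (A *v z)))\<^sup>2" using a(1) by (intro power_mono) auto
    then show ?thesis by (simp add: power_mult_distrib mult.commute)
  qed simp
  define q where "q z = z \<bullet> z - ?\<eta> * ((M *v (A *v z)) \<bullet> (M *v (A *v z)))" for z
  have q_nonneg: "0 \<le> q z" for z
  proof -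
    have "(norm (M *v (A *v z)))\<^sup>2 \<le> B\<^sup>2 * (L * (norm z)\<^sup>2)"
      using up[of z] mult_left_mono[OF L(2)[of z], of "B\<^sup>2"] by simp
    then have "?\<eta> * (norm (M *v (A *v z)))\<^sup>2 \<le> ?\<eta> * (B\<^sup>2 * (L * (norm z)\<^sup>2))"
      using \<eta> by (intro mult_left_mono) auto
    also have "\<dots> = (norm z)\<^sup>2" using L B by simp
    finally show ?thesis unfolding q_def by (simp add: dot_square_norm)
  qed
  have q_le: "q z \<le> ?c * (norm z)\<^sup>2" if z: "z \<in> C" for z
  proof -
    have "a\<^sup>2 * (\<mu> * (norm z)\<^sup>2) \<le> (norm (M *v (A *v z)))\<^sup>2"
      using low[OF z] mult_left_mono[OF \<mu>(2)[OF z], of "a\<^sup>2"] by simp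
    then have "?\<eta> * (a\<^sup>2 * (\<mu> * (norm z)\<^sup>2)) \<le> ?\<eta> * (norm (M *v (A *v z)))\<^sup>2"
      using \<eta> by (intro mult_left_mono) auto
    then show ?thesis unfolding q_def by (simp add: dot_square_norm algebra_simps)
  qed
  have c: "0 \<le> ?c"
  proof -
    have "0 \<le> ?c * (norm z0)\<^sup>2" using q_nonneg[of z0] q_le[OF C(2)] by linarith
    then show ?thesis using C(3) by (simp add: zero_le_mult_iff)
  qed
  have q_le': "q z \<le> ?c" if "z \<in> C \<inter> cball 0 1" for z
  proof -
    have "(norm z)\<^sup>2 \<le> 1" using that by (simp add: power_le_one)
    then have "?c * (norm z)\<^sup>2 \<le> ?c * 1" using c by (intro mult_left_mono)
    with q_le[of z] that show ?thesis by simp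
  qed
  have "0 *\<^sub>R z0 \<in> C" using C(1,2) unfolding cone_def by blast
  then have ne: "C \<inter> cball 0 1 \<noteq> {}" by (auto simp: ex_in_conv[symmetric] intro!: exI[of _ 0])
  show ?thesis
    unfolding contraction_factor_le_iff[OF ne]
  proof (intro ballI)
    fix u v assume u: "u \<in> C \<inter> cball 0 1" and v: "v \<in> C \<inter> cball 0 1"
    let ?m = "v \<bullet> u - ?\<eta> * (((M ** A) *v v) \<bullet> ((M ** A) *v u))"
    have "q (u - v) = q u + q v - 2 * ?m"
      unfolding q_def matrix_vector_mul_assoc matrix_vector_mult_diff_distrib
      by (simp add: inner_diff_left inner_diff_right inner_commute algebra_simps)
    then have "2 * ?m \<le> q u + q v" using q_nonneg[of "u - v"] by simp
    also have "\<dots> \<le> 2 * ?c" using q_le'[OF u] q_le'[OF v] by simp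
    finally show "?m \<le> ?c" by simp
  qed
qed

lemma cone_tangent_cone: "cone (tangent_cone K xs)"
  unfolding tangent_cone_def closed_cone_hull_def hull_def cone_def by auto

lemma gauss_b_pos: "m > 0 \<Longrightarrow> gauss_b m > 0"
  unfolding gauss_b_def by (intro divide_pos_pos mult_pos_pos Gamma_real_pos) auto

theorem lemma2:
  fixes K :: "(real ^ 'd) set"
    and xs :: "real ^ 'd"
    and A :: "real ^ 'd ^ 'n"
    and P :: "'w measure"
    and S :: "'w \<Rightarrow> real ^ 'n ^ 'm"
    and \<theta> \<eta> L \<mu> b W :: real
    and C :: "(real ^ 'd) set"
  assumes "xs \<in> K"
    and "C = tangent_cone K xs"
    and "L = largest_singular_value (transpose A ** A)"
    and "is_restricted_convexity_const A C \<mu>"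
    and "W = gaussian_width ((\<lambda>z. A *v z) ` C \<inter> sphere 0 1)"
    and "b = gauss_b CARD('m)"
    and "\<theta> > 0"
    and "b - W - \<theta> \<ge> 0"
    and "\<eta> = 1 / (L * (b + sqrt (real CARD('d)) + \<theta>)\<^sup>2)"
    and "prob_space P"
    and "iid_std_normal_matrix P S"
  shows "measure P {\<omega> \<in> space P.
           contraction_factor C \<eta> (S \<omega> ** A)
             \<le> 1 - \<mu> / L * ((b - W - \<theta>)\<^sup>2 / (b + sqrt (real CARD('d)) + \<theta>)\<^sup>2)}
         \<ge> 1 - 2 * exp (- \<theta>\<^sup>2 / 2)"
proof -
  interpret P: prob_space P by fact
  note conv = assms(4)[unfolded is_restricted_convexity_const_def]
  have \<mu>: "\<mu> > 0" "\<And>z. z \<in> C \<Longrightarrow> \<mu> * (norm z)\<^sup>2 \<le> (norm (A *v z))\<^sup>2" using conv by auto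
  have cone: "cone C" unfolding assms(2) by (rule cone_tangent_cone)
  \<comment> \<open>On the zero cone every positive number would satisfy the inequality, and none would be the largest.\<close>
  obtain z0 where z0: "z0 \<in> C" "z0 \<noteq> 0"
  proof (rule ccontr)
    assume "\<not> thesis"
    then have "C \<subseteq> {0}" using that by blast
    then have "\<forall>z\<in>C. (\<mu> + 1) * (norm z)\<^sup>2 \<le> (norm (A *v z))\<^sup>2" by auto
    with conv have "\<mu> + 1 \<le> \<mu>" by (metis add_pos_pos zero_less_one)
    then show False by simp
  qed
  have Lz: "(norm (A *v z))\<^sup>2 \<le> L * (norm z)\<^sup>2" for z
    unfolding assms(3) by (rule norm_le_largest_singular_value)
  have "0 < \<mu> * (norm z0)\<^sup>2" using \<mu>(1) z0(2) by simp
  also have "\<dots> \<le> (norm (A *v z0))\<^sup>2" by (rule \<mu>(2)[OF z0(1)])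
  finally have Az0: "0 < (norm (A *v z0))\<^sup>2" .
  then have "0 < L * (norm z0)\<^sup>2" using Lz[of z0] by linarith
  then have L: "L > 0" by (simp add: zero_less_mult_iff)
  \<comment> \<open>The lower bound is needed on the image of the cone only, the upper bound on the whole range of \<open>A\<close>.\<close>
  define T where "T = (\<lambda>z. A *v z) ` C \<inter> sphere 0 1"
  define V where "V = range (\<lambda>z. A *v z) \<inter> sphere 0 1"
  define B where "B = b + sqrt (real CARD('d)) + \<theta>"
  have "(1 / norm (A *v z0)) *\<^sub>R z0 \<in> C" using cone z0 by (auto simp: cone_def)
  moreover have "norm (A *v ((1 / norm (A *v z0)) *\<^sub>R z0)) = 1"
    using Az0 by (simp add: matrix_vector_mult_scaleR)
  ultimately have "A *v ((1 / norm (A *v z0)) *\<^sub>R z0) \<in> T"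
    unfolding T_def by (intro IntI imageI) simp_all
  then have T: "T \<subseteq> sphere 0 1" "T \<noteq> {}" unfolding T_def by auto
  have "T \<subseteq> V" unfolding T_def V_def by auto
  with T have V: "V \<subseteq> sphere 0 1" "V \<noteq> {}" unfolding V_def by auto
  have wV: "gaussian_width V \<le> sqrt (real CARD('d))"
  proof (rule width_subspace)
    show "subspace (range (\<lambda>z. A *v z))"
      by (intro linear_subspace_image subspace_UNIV) (rule matrix_vector_mul_linear)
    have "dim (range (\<lambda>z. A *v z)) \<le> dim (UNIV :: (real ^ 'd) set)"
      by (intro dim_image_le) (rule matrix_vector_mul_linear)
    then show "dim (range (\<lambda>z. A *v z)) \<le> CARD('d)" by simp
  qed (use V in \<open>auto simp: V_def\<close>)
  have B: "B > 0" unfolding B_def assms(6) using gauss_b_pos[of "CARD('m)"] assms(7) by (intro add_pos_pos add_pos_nonneg) auto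
  let ?c = "1 - \<mu> / L * ((b - W - \<theta>)\<^sup>2 / B\<^sup>2)"
  let ?X = "\<lambda>\<omega> (i, j). S \<omega> $ i $ j"
  let ?Q = "{\<omega> \<in> space P. contraction_factor C \<eta> (S \<omega> ** A) \<le> ?c}"
  define E1 where "E1 = {w :: 'm \<times> 'n \<Rightarrow> real. \<exists>y\<in>T. norm (mat_of w *v y) < gauss_b CARD('m) - gaussian_width T - \<theta>}"
  define E2 where "E2 = {w :: 'm \<times> 'n \<Rightarrow> real. \<exists>y\<in>V. norm (mat_of w *v y) > gauss_b CARD('m) + gaussian_width V + \<theta>}"
  note E1 = min_deviation[OF T assms(7), where 'm='m, folded E1_def]
  note E2 = max_deviation[OF V assms(7), where 'm='m, folded E2_def]
  note X = distr_iid_std_normal[OF assms(10,11)]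
  have mX: "mat_of (?X \<omega>) = S \<omega>" for \<omega> by (simp add: mat_of_def vec_eq_iff)
  have pX: "measure P {\<omega> \<in> space P. ?X \<omega> \<in> E} = measure gauss_space E" if "E \<in> sets gauss_space" for E
  proof -
    have "measure gauss_space E = measure (distr P gauss_space ?X) E" unfolding X(2) ..
    also have "\<dots> = measure P (?X -` E \<inter> space P)" by (rule measure_distr[OF X(1) that])
    finally show ?thesis by (simp add: vimage_def Int_def conj_commute)
  qed
  have sX: "{\<omega> \<in> space P. ?X \<omega> \<in> E} \<in> sets P" if "E \<in> sets gauss_space" for E
    using measurable_sets[OF X(1) that] by (simp add: vimage_def Int_def conj_commute)
  have "0 *\<^sub>R z0 \<in> C" using cone z0(1) unfolding cone_def by blast
  then have ne: "C \<inter> cball 0 1 \<noteq> {}" by (auto simp: ex_in_conv[symmetric] intro!: exI[of _ 0])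
  have Q_sets: "?Q \<in> sets P"
  proof -
    have "{M :: real ^ 'n ^ 'm. contraction_factor C \<eta> (M ** A) \<le> ?c} \<in> sets borel"
      by (intro borel_closed closed_contraction_le ne)
    from measurable_sets[OF measurable_compose[OF X(1) mat_of_measurable] this]
    show ?thesis by (simp add: mX vimage_def Int_def conj_commute)
  qed
  \<comment> \<open>Outside of the two bad events the deterministic estimate applies.\<close>
  have cover: "space P \<subseteq> ?Q \<union> {\<omega> \<in> space P. ?X \<omega> \<in> E1} \<union> {\<omega> \<in> space P. ?X \<omega> \<in> E2}"
  proof
    fix \<omega> assume \<omega>: "\<omega> \<in> space P"
    have "contraction_factor C \<eta> (S \<omega> ** A) \<le> ?c" if "?X \<omega> \<notin> E1" "?X \<omega> \<notin> E2"
    proof -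
      have lo: "b - W - \<theta> \<le> norm (S \<omega> *v y)" if "y \<in> T" for y
        using \<open>?X \<omega> \<notin> E1\<close> that unfolding E1_def mem_Collect_eq mX assms(5,6) T_def[symmetric] by force
      have hi: "norm (S \<omega> *v y) \<le> B" if "y \<in> V" for y
      proof -
        have "norm (S \<omega> *v y) \<le> gauss_b CARD('m) + gaussian_width V + \<theta>"
          using \<open>?X \<omega> \<notin> E2\<close> that unfolding E2_def mem_Collect_eq mX by force
        then show ?thesis using wV unfolding B_def assms(6) by simp
      qed
      have "\<eta> = 1 / (L * B\<^sup>2)" unfolding assms(9) B_def ..
      then show ?thesis
        using contraction_factor_deterministic[OF cone z0 L Lz \<mu> assms(8) _ B, of "S \<omega>"] lo hi
        unfolding T_def V_def by blast
    qed
    then show "\<omega> \<in> ?Q \<union> {\<omega> \<in> space P. ?X \<omega> \<in> E1} \<union> {\<omega> \<in> space P. ?X \<omega> \<in> E2}"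
      using \<omega> by blast
  qed
  have "1 = measure P (space P)" using P.prob_space by simp
  also have "\<dots> \<le> measure P (?Q \<union> {\<omega> \<in> space P. ?X \<omega> \<in> E1} \<union> {\<omega> \<in> space P. ?X \<omega> \<in> E2})"
    by (intro P.finite_measure_mono cover sets.Un Q_sets sX E1(1) E2(1))
  also have "\<dots> \<le> measure P (?Q \<union> {\<omega> \<in> space P. ?X \<omega> \<in> E1}) + measure P {\<omega> \<in> space P. ?X \<omega> \<in> E2}"
    by (intro measure_Un_le sets.Un Q_sets sX E1(1) E2(1))
  also have "measure P (?Q \<union> {\<omega> \<in> space P. ?X \<omega> \<in> E1}) \<le> measure P ?Q + measure P {\<omega> \<in> space P. ?X \<omega> \<in> E1}"
    by (intro measure_Un_le sets.Un Q_sets sX E1(1))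
  finally have "1 \<le> measure P ?Q + exp (- \<theta>\<^sup>2 / 2) + exp (- \<theta>\<^sup>2 / 2)"
    using E1(2) E2(2) unfolding pX[OF E1(1)] pX[OF E2(1)] by linarith
  then show ?thesis unfolding B_def by linarith
qed

end
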